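(* The locus of Hodge structures of K3-type on $\Gamma:= U^2_{\mathbb{Q}}\oplus (A_2)^2_{\mathbb{Q}}$ which admit a Hodge similarity of multiplier $3$ which is fixed by the Rosati involution is non-empty and has a two-dimensional component.
   Context: $U$ is the hyperbolic plane, $A_2$ is the negative definite root lattice of type $A_2$ (so $(A_2)_{\mathbb{Q}}\simeq\langle -2\rangle\oplus\langle -3/2\rangle$), $L_{\mathbb{Q}}=L\otimes\mathbb{Q}$; let $q$ be the form on $\Gamma$ (signature $(2,6)$). Hodge structures of K3-type on $\Gamma$ are weight-two rational Hodge structures with $\dim\Gamma^{2,0}=1$, $\Gamma^{a,b}=0$ for $|a-b|>2$, compatible with $q$ and with $(\Gamma^{2,0}\oplus\Gamma^{0,2})\cap\Gamma_{\mathbb{R}}$ positive definite; they are parametrized by $\Omega_\Gamma=\{\omega\in\mathbb{P}(\Gamma_{\mathbb{C}})\mid q(\omega)=0,\ q(\omega,\overline{\omega})>0\}$ via $\Gamma^{2,0}=\mathbb{C}\omega$. The locus is a subset of $\Omega_\Gamma$ and dimension means complex dimension. A Hodge similarity of multiplier $3$ is an automorphism $\psi$ of the Hodge structure $\Gamma$ with $q(\psi v,\psi w)=3q(v,w)$ for all $v,w\in\Gamma$; it is fixed by the Rosati involution if $q(\psi v,w)=q(v,\psi w)$ for all $v,w\in\Gamma$. *)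

theory Defs
  imports "HOL-Analysis.Analysis"
begin

subsection \<open>Lattices and their rational, real and complex scalar extensions\<close>

text \<open>A lattice of rank \<open>CARD('n)\<close> is given by its integral Gram matrix \<open>G\<close>. The scalar
  extensions of the lattice are \<open>rat ^ 'n\<close>, \<open>real ^ 'n\<close> and \<open>complex ^ 'n\<close>, all with the
  (bilinearly extended) form \<open>form G\<close>.\<close>

definition form :: "int ^ 'n ^ 'n \<Rightarrow> 'a::comm_ring_1 ^ 'n \<Rightarrow> 'a ^ 'n \<Rightarrow> 'a" where
  "form G v w = (\<Sum>i\<in>UNIV. \<Sum>j\<in>UNIV. of_int (G $ i $ j) * v $ i * w $ j)"

definition orth_sum :: "int ^ 'm ^ 'm \<Rightarrow> int ^ 'n ^ 'n \<Rightarrow> int ^ ('m + 'n) ^ ('m + 'n)"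
    (infixr "\<oplus>\<^sub>L" 65) where
  "A \<oplus>\<^sub>L B = (\<chi> i j. case i of
      Inl a \<Rightarrow> (case j of Inl b \<Rightarrow> A $ a $ b | Inr _ \<Rightarrow> 0)
    | Inr a \<Rightarrow> (case j of Inl _ \<Rightarrow> 0 | Inr b \<Rightarrow> B $ a $ b))"

definition U_lat :: "int ^ 2 ^ 2" where
  "U_lat = vector [vector [0, 1], vector [1, 0]]"

definition A2_lat :: "int ^ 2 ^ 2" where
  "A2_lat = vector [vector [-2, 1], vector [1, -2]]"

definition Gamma_lat :: "int ^ ((2 + 2) + (2 + 2)) ^ ((2 + 2) + (2 + 2))" where
  "Gamma_lat = (U_lat \<oplus>\<^sub>L U_lat) \<oplus>\<^sub>L (A2_lat \<oplus>\<^sub>L A2_lat)"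

definition vcnj :: "complex ^ 'n \<Rightarrow> complex ^ 'n" where
  "vcnj v = (\<chi> i. cnj (v $ i))"

definition real_to_complex :: "real ^ 'n \<Rightarrow> complex ^ 'n" where
  "real_to_complex v = (\<chi> i. complex_of_real (v $ i))"

definition complexify :: "(rat ^ 'n \<Rightarrow> rat ^ 'n) \<Rightarrow> complex ^ 'n \<Rightarrow> complex ^ 'n" where
  "complexify \<psi> v = (\<chi> i j. of_rat (matrix \<psi> $ i $ j)) *v v"


subsection \<open>Hodge structures\<close>

text \<open>\<open>H a b\<close> is the summand of type \<open>(a, b)\<close> of the complexification.\<close>

definition hodge_structure ::
    "int \<Rightarrow> (int \<Rightarrow> int \<Rightarrow> (complex ^ 'n) set) \<Rightarrow> bool" where
  "hodge_structure k H \<longleftrightarrow>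
     (\<forall>a b. vec.subspace (H a b)) \<and>
     (\<forall>a b. a + b \<noteq> k \<longrightarrow> H a b = {0}) \<and>
     (\<forall>v. \<exists>!f. (\<forall>a. f a \<in> H a (k - a)) \<and> finite {a. f a \<noteq> 0} \<and>
                v = (\<Sum>a | f a \<noteq> 0. f a)) \<and>
     (\<forall>a b. vcnj ` H a b = H b a)"

text \<open>The orthogonality clause says that the form is a morphism of Hodge structures from the
  tensor square of the lattice to the Tate structure of type \<open>(2, 2)\<close>.\<close>

definition K3_type ::
    "int ^ 'n ^ 'n \<Rightarrow> (int \<Rightarrow> int \<Rightarrow> (complex ^ 'n) set) \<Rightarrow> bool" where
  "K3_type G H \<longleftrightarrow>
     hodge_structure 2 H \<and>
     vec.dim (H 2 0) = 1 \<and>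
     (\<forall>a b. \<bar>a - b\<bar> > 2 \<longrightarrow> H a b = {0}) \<and>
     (\<forall>a b c d. (a + c, b + d) \<noteq> (2, 2) \<longrightarrow> (\<forall>x\<in>H a b. \<forall>y\<in>H c d. form G x y = 0)) \<and>
     (\<forall>v :: real ^ 'n. v \<noteq> 0 \<longrightarrow> (\<exists>x\<in>H 2 0. \<exists>y\<in>H 0 2. real_to_complex v = x + y) \<longrightarrow>
        form G v v > 0)"

definition hodge_automorphism ::
    "(int \<Rightarrow> int \<Rightarrow> (complex ^ 'n) set) \<Rightarrow> (rat ^ 'n \<Rightarrow> rat ^ 'n) \<Rightarrow> bool" where
  "hodge_automorphism H \<psi> \<longleftrightarrow>
     Vector_Spaces.linear (*s) (*s) \<psi> \<and> bij \<psi> \<and> (\<forall>a b. complexify \<psi> ` H a b = H a b)"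

definition hodge_similarity ::
    "int ^ 'n ^ 'n \<Rightarrow> (int \<Rightarrow> int \<Rightarrow> (complex ^ 'n) set) \<Rightarrow> rat \<Rightarrow> (rat ^ 'n \<Rightarrow> rat ^ 'n) \<Rightarrow> bool"
  where
  "hodge_similarity G H m \<psi> \<longleftrightarrow>
     hodge_automorphism H \<psi> \<and> (\<forall>v w. form G (\<psi> v) (\<psi> w) = m * form G v w)"

definition rosati_fixed :: "int ^ 'n ^ 'n \<Rightarrow> (rat ^ 'n \<Rightarrow> rat ^ 'n) \<Rightarrow> bool" where
  "rosati_fixed G \<psi> \<longleftrightarrow> (\<forall>v w. form G (\<psi> v) w = form G v (\<psi> w))"


subsection \<open>The period domain and the locus\<close>

text \<open>Points of the projective space are the complex lines through the origin, so that
  \<open>H 2 0\<close> itself is the period point of a Hodge structure \<open>H\<close> of K3 type.\<close>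

definition proj_space :: "(complex ^ 'n) set set" where
  "proj_space = {vec.span {v} | v. v \<noteq> 0}"

text \<open>The number \<open>form G \<omega> (vcnj \<omega>)\<close> is real when \<open>G\<close> is symmetric.\<close>

definition period_domain :: "int ^ 'n ^ 'n \<Rightarrow> (complex ^ 'n) set set" where
  "period_domain G =
     {vec.span {\<omega>} | \<omega>. form G \<omega> \<omega> = 0 \<and> Re (form G \<omega> (vcnj \<omega>)) > 0}"

definition similarity_locus :: "int ^ 'n ^ 'n \<Rightarrow> rat \<Rightarrow> (complex ^ 'n) set set" where
  "similarity_locus G m =
     {p \<in> period_domain G. \<exists>H. K3_type G H \<and> H 2 0 = p \<and>
        (\<exists>\<psi>. hodge_similarity G H m \<psi> \<and> rosati_fixed G \<psi>)}"


subsection \<open>Analytic subsets, irreducible components and dimension\<close>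

text \<open>Projective space is the quotient of the punctured vector space by a holomorphic submersion
  \<open>v \<mapsto> vec.span {v}\<close>. Hence its open sets and holomorphic functions are those whose pull-backs
  are open, respectively holomorphic, and the differentials of functions at a point are linearly
  independent if and only if those of their pull-backs at any vector above the point are.\<close>

definition affine_cone :: "(complex ^ 'n) set set \<Rightarrow> (complex ^ 'n) set" where
  "affine_cone N = {v. v \<noteq> 0 \<and> vec.span {v} \<in> N}"

definition proj_topology :: "(complex ^ 'n) set topology" where
  "proj_topology = topology (\<lambda>N. N \<subseteq> proj_space \<and> open (affine_cone N))"

lemma openin_proj_topology:
  "openin (proj_topology :: (complex ^ 'n) set topology) N \<longleftrightarrow>
     N \<subseteq> proj_space \<and> open (affine_cone N)"
proof -
  have "istopology (\<lambda>N :: (complex ^ 'n) set set. N \<subseteq> proj_space \<and> open (affine_cone N))"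
    unfolding istopology_def
  proof (intro conjI allI impI)
    fix S T :: "(complex ^ 'n) set set"
    assume "S \<subseteq> proj_space \<and> open (affine_cone S)" "T \<subseteq> proj_space \<and> open (affine_cone T)"
    moreover have "affine_cone (S \<inter> T) = affine_cone S \<inter> affine_cone T"
      by (auto simp: affine_cone_def)
    ultimately show "S \<inter> T \<subseteq> proj_space" "open (affine_cone (S \<inter> T))"
      by auto
  next
    fix K :: "(complex ^ 'n) set set set"
    assume K: "\<forall>N\<in>K. N \<subseteq> proj_space \<and> open (affine_cone N)"
    have "affine_cone (\<Union>K) = (\<Union>N\<in>K. affine_cone N)"
      by (auto simp: affine_cone_def)
    with K show "\<Union>K \<subseteq> proj_space" "open (affine_cone (\<Union>K))"
      by auto
  qed
  then show ?thesis
    by (simp add: proj_topology_def topology_inverse')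
qed

lemma topspace_proj_topology:
  "topspace (proj_topology :: (complex ^ 'n) set topology) = proj_space"
proof -
  have "affine_cone (proj_space :: (complex ^ 'n) set set) = - {0}"
    by (auto simp: affine_cone_def proj_space_def)
  then have "openin (proj_topology :: (complex ^ 'n) set topology) proj_space"
    by (simp add: openin_proj_topology open_Compl)
  then show ?thesis
    by (metis openin_proj_topology openin_subset openin_topspace subset_antisym)
qed

definition pullback :: "((complex ^ 'n) set \<Rightarrow> complex) \<Rightarrow> complex ^ 'n \<Rightarrow> complex" where
  "pullback f v = f (vec.span {v})"

definition proj_holomorphic_on ::
    "((complex ^ 'n) set \<Rightarrow> complex) \<Rightarrow> (complex ^ 'n) set set \<Rightarrow> bool" where
  "proj_holomorphic_on f N \<longleftrightarrow>
     (\<forall>v\<in>affine_cone N. \<exists>D. (pullback f has_derivative D) (at v) \<and> (\<forall>c w. D (c *s w) = c * D w))"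

text \<open>Analytic subsets of a locally closed complex submanifold \<open>X\<close> of projective space. Every
  holomorphic function on \<open>X\<close> extends locally to projective space, so it suffices to use
  functions on open subsets of the latter.\<close>

definition analytic_subset :: "(complex ^ 'n) set set \<Rightarrow> (complex ^ 'n) set set \<Rightarrow> bool" where
  "analytic_subset X A \<longleftrightarrow> A \<subseteq> X \<and>
     (\<forall>p\<in>X. \<exists>N (k::nat) f. openin proj_topology N \<and> p \<in> N \<and>
        (\<forall>i<k. proj_holomorphic_on (f i) N) \<and>
        A \<inter> N = {x \<in> X \<inter> N. \<forall>i<k. f i x = 0})"

text \<open>\<open>A\<close> is a \<open>d\<close>-dimensional complex submanifold near its point \<open>p\<close>: it is cut out by
  \<open>CARD('n) - 1 - d\<close> holomorphic functions with linearly independent differentials.\<close>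

definition regular_point ::
    "nat \<Rightarrow> (complex ^ 'n) set set \<Rightarrow> (complex ^ 'n) set \<Rightarrow> bool" where
  "regular_point d A p \<longleftrightarrow> p \<in> A \<and>
     (\<exists>N (k::nat) f. openin proj_topology N \<and> p \<in> N \<and> k + d + 1 = CARD('n) \<and>
        (\<forall>i<k. proj_holomorphic_on (f i) N) \<and>
        A \<inter> N = {x \<in> N. \<forall>i<k. f i x = 0} \<and>
        (\<forall>v\<in>affine_cone {p}. \<forall>c.
           (\<forall>w. (\<Sum>i<k. c i * frechet_derivative (pullback (f i)) (at v) w) = 0) \<longrightarrow>
           (\<forall>i<k. c i = (0::complex))))"

definition regular_locus :: "(complex ^ 'n) set set \<Rightarrow> (complex ^ 'n) set set" where
  "regular_locus A = {p. \<exists>d. regular_point d A p}"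

text \<open>Global irreducibility: the irreducible components of an analytic set are the closures of
  the connected components of its regular locus.\<close>

definition irreducible_analytic :: "(complex ^ 'n) set set \<Rightarrow> (complex ^ 'n) set set \<Rightarrow> bool" where
  "irreducible_analytic X A \<longleftrightarrow>
     analytic_subset X A \<and> A \<noteq> {} \<and> connectedin proj_topology (regular_locus A)"

definition analytic_dim :: "(complex ^ 'n) set set \<Rightarrow> nat" where
  "analytic_dim A = Max {d. \<exists>p. regular_point d A p}"

text \<open>The similarity locus is a countable union of analytic subsets of the period domain and need not
  be analytic itself, so components are defined for arbitrary subsets \<open>S\<close> of \<open>X\<close>.\<close>

definition irreducible_component ::
    "(complex ^ 'n) set set \<Rightarrow> (complex ^ 'n) set set \<Rightarrow> (complex ^ 'n) set set \<Rightarrow> bool" where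
  "irreducible_component X S Z \<longleftrightarrow>
     irreducible_analytic X Z \<and> Z \<subseteq> S \<and>
     (\<forall>W. irreducible_analytic X W \<and> W \<subseteq> S \<and> Z \<subseteq> W \<longrightarrow> W = Z)"

end

theory Submission
  imports Defs "HOL-Complex_Analysis.Conformal_Mappings"
begin

text \<open>A similarity of multiplier 3 fixed by the Rosati involution squares to 3, so the line of type
  \<open>(2, 0)\<close> lies in one of its eigenspaces for \<open>\<plusminus>sqrt 3\<close>. The similarity locus is therefore contained
  in a countable union of linear sections of the period domain, one for each pair of a rational
  matrix and a sign. By Baire's theorem, the identity theorem and the density of the regular points,
  an irreducible analytic set contained in the locus lies in a single such section. For an explicit
  similarity \<open>psi0\<close>, the section is an open subset of a quadric surface in a projective 3-space, with
  two connected components, each a product of two discs. Such a component \<open>Z\<close> is maximal: a rational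
  matrix having the span of \<open>Z\<close> inside its eigenspace agrees with \<open>psi0\<close> up to sign, as \<open>sqrt 3\<close> is
  irrational, so an irreducible set in the locus containing \<open>Z\<close> lies in the section of \<open>psi0\<close>, and
  connectedness of its regular locus forces it to be \<open>Z\<close>.\<close>


section \<open>Holomorphic functions of several variables\<close>

text \<open>The numbers come from a dimension count. A self-adjoint map with square 3 makes the
  rational space a 4-dimensional space over Q(sqrt 3) whose quadratic form has trace q, so the
  signature (2, 6) is divided between the eigenspaces for sqrt 3 and - sqrt 3. For
  \<open>psi0\<close>, each copy of U has a positive sqrt 3-eigenline and a negative other one,
  while the two copies of A2 together give (0, 2) to both sides: the result is (2, 2) and (0, 4).
  Only the former contains periods, and an isotropic line in a 4-dimensional space has 4 - 1 - 1 = 2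
  parameters. What shapes the proof is maximality. It concerns every irreducible analytic
  \<open>W\<close> in the locus, possibly singular, and irreducibility is only connectedness of the
  regular locus. So regular points must be shown dense, and vanishing must be spread along the
  regular locus. Both are done on affine cones in the vector space, by restriction to complex lines
  in straightened coordinates, where one-variable function theory applies. The price is a
  translation of regular points, with their dimensions, between cones and projective space.\<close>

definition holo_on :: "(complex ^ 'n \<Rightarrow> complex) \<Rightarrow> (complex ^ 'n) set \<Rightarrow> bool" where
  "holo_on f S \<longleftrightarrow>
     (\<forall>v\<in>S. \<exists>D. (f has_derivative D) (at v) \<and> (\<forall>c w. D (c *s w) = c * D w))"

definition holo_map :: "(complex ^ 'n \<Rightarrow> complex ^ 'm) \<Rightarrow> (complex ^ 'n) set \<Rightarrow> bool" where
  "holo_map \<Phi> S \<longleftrightarrow>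
     (\<forall>v\<in>S. \<exists>D. (\<Phi> has_derivative D) (at v) \<and> (\<forall>c w. D (c *s w) = c *s D w))"

abbreviation fder :: "('a::real_normed_vector \<Rightarrow> 'b::real_normed_vector) \<Rightarrow> 'a \<Rightarrow> 'a \<Rightarrow> 'b" where
  "fder f v \<equiv> frechet_derivative f (at v)"

lemma norm_vec_smult: "norm (c *s (x :: complex ^ 'n)) = norm c * norm x"
  by (simp add: norm_vec_def L2_set_def norm_mult power_mult_distrib
      flip: sum_distrib_left) (simp add: real_sqrt_mult)

lemma scaleR_eq_smult: "r *\<^sub>R (x :: complex ^ 'n) = complex_of_real r *s x"
  by (simp add: vec_eq_iff) (simp add: scaleR_conv_of_real)

lemma bounded_bilinear_smult: "bounded_bilinear (\<lambda>c (x :: complex ^ 'n). c *s x)"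
proof
  show "\<exists>K. \<forall>a (b :: complex ^ 'n). norm (a *s b) \<le> norm a * norm b * K"
    by (rule exI [of _ 1]) (simp add: norm_vec_smult)
qed (simp_all add: vec_eq_iff algebra_simps)

lemmas has_derivative_smult = bounded_bilinear.FDERIV [OF bounded_bilinear_smult]
lemmas continuous_on_smult [continuous_intros] =
  bounded_bilinear.continuous_on [OF bounded_bilinear_smult]
lemmas bounded_linear_smult_left = bounded_bilinear.bounded_linear_left [OF bounded_bilinear_smult]

lemma holo_on_has_derivative:
  assumes "holo_on f S" "v \<in> S"
  shows "(f has_derivative fder f v) (at v)"
  using assms by (metis differentiableI frechet_derivative_works holo_on_def)

lemma holo_on_fder_smult:
  assumes "holo_on f S" "v \<in> S"
  shows "fder f v (c *s w) = c * fder f v w"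
  using assms by (metis frechet_derivative_at holo_on_def)

lemma holo_on_fder_linear:
  assumes "holo_on f S" "v \<in> S"
  shows "linear (fder f v)"
  using holo_on_has_derivative [OF assms] has_derivative_linear by blast

lemma holo_map_has_derivative:
  assumes "holo_map f S" "v \<in> S"
  shows "(f has_derivative fder f v) (at v)"
  using assms by (metis differentiableI frechet_derivative_works holo_map_def)

lemma holo_map_fder_smult:
  assumes "holo_map f S" "v \<in> S"
  shows "fder f v (c *s w) = c *s fder f v w"
  using assms by (metis frechet_derivative_at holo_map_def)

lemma holo_on_subset: "holo_on f S \<Longrightarrow> T \<subseteq> S \<Longrightarrow> holo_on f T"
  by (auto simp: holo_on_def)

lemma holo_map_subset: "holo_map f S \<Longrightarrow> T \<subseteq> S \<Longrightarrow> holo_map f T"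
  by (auto simp: holo_map_def)

lemma holo_on_continuous: "holo_on f S \<Longrightarrow> continuous_on S f"
  by (meson continuous_at_imp_continuous_on has_derivative_continuous holo_on_has_derivative)

lemma holo_map_continuous: "holo_map f S \<Longrightarrow> continuous_on S f"
  by (meson continuous_at_imp_continuous_on has_derivative_continuous holo_map_has_derivative)

lemma has_derivative_holo_comp:
  assumes "holo_map \<Phi> S" "holo_on f T" "v \<in> S" "\<Phi> v \<in> T"
  shows "((\<lambda>x. f (\<Phi> x)) has_derivative (\<lambda>w. fder f (\<Phi> v) (fder \<Phi> v w))) (at v)"
  using diff_chain_at [OF holo_map_has_derivative [OF assms(1,3)]
      holo_on_has_derivative [OF assms(2,4)]]
  by (simp add: o_def)

lemma holo_on_comp:
  assumes "holo_map \<Phi> S" "holo_on f T" "\<And>x. x \<in> S \<Longrightarrow> \<Phi> x \<in> T"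
  shows "holo_on (\<lambda>x. f (\<Phi> x)) S"
  unfolding holo_on_def
proof
  fix v assume v: "v \<in> S"
  then show "\<exists>D. ((\<lambda>x. f (\<Phi> x)) has_derivative D) (at v) \<and> (\<forall>c w. D (c *s w) = c * D w)"
    using has_derivative_holo_comp [OF assms(1,2) v assms(3)] assms v
    by (intro exI conjI) (auto simp: holo_map_fder_smult holo_on_fder_smult)
qed

lemma fder_holo_comp:
  assumes "holo_map \<Phi> S" "holo_on f T" "v \<in> S" "\<Phi> v \<in> T"
  shows "fder (\<lambda>x. f (\<Phi> x)) v = (\<lambda>w. fder f (\<Phi> v) (fder \<Phi> v w))"
  using frechet_derivative_at [OF has_derivative_holo_comp [OF assms]] by simp

section \<open>Restriction to complex lines and Cauchy's formula\<close>

lemma has_field_derivative_line: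
  assumes "holo_on f S" "x + z *s u \<in> S"
  shows "((\<lambda>z. f (x + z *s u)) has_field_derivative fder f (x + z *s u) u) (at z)"
proof -
  have "((\<lambda>z. x + z *s u) has_derivative (\<lambda>z. z *s u)) (at z)"
    using bounded_linear_imp_has_derivative [OF bounded_linear_smult_left [of u]]
    by (auto intro!: derivative_eq_intros)
  from diff_chain_at [OF this holo_on_has_derivative [OF assms]]
  have "((\<lambda>z. f (x + z *s u)) has_derivative (\<lambda>z'. fder f (x + z *s u) (z' *s u))) (at z)"
    by (simp add: o_def)
  then show ?thesis
    by (simp add: has_field_derivative_def holo_on_fder_smult [OF assms] mult_commute_abs)
qed

text \<open>Cauchy's formula for the first derivative of the restriction to a complex line. It
  expresses the directional derivative by values of \<open>f\<close> alone, so regularity in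
  \<open>x\<close> can pass under an integral over a fixed interval.\<close>

lemma fder_circle_integral:
  assumes f: "holo_on f S" and "r > 0" and S: "\<And>z. norm z \<le> r \<Longrightarrow> x + z *s u \<in> S"
  shows "fder f x u = integral (cbox 0 1)
           (\<lambda>t::real. f (x + (of_real r * exp (2 * of_real pi * \<i> * t)) *s u)
              / (of_real r * exp (2 * of_real pi * \<i> * t)))"
proof -
  let ?\<phi> = "\<lambda>z. f (x + z *s u)"
  have der: "(?\<phi> has_field_derivative fder f (x + z *s u) u) (at z)" if "norm z \<le> r" for z
    using has_field_derivative_line [OF f S [OF that]] .
  have cont: "continuous_on (cball 0 r) ?\<phi>"
    using DERIV_isCont [OF der] by (intro continuous_at_imp_continuous_on) auto
  have hol: "?\<phi> holomorphic_on ball 0 r"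
    using der by (subst holomorphic_on_open) (auto, meson less_imp_le)
  have "(?\<phi> has_field_derivative (1 / (2 * of_real pi * \<i>) *
          contour_integral (circlepath 0 r) (\<lambda>z. ?\<phi> z / (z - 0)\<^sup>2))) (at 0)"
    using Cauchy_derivative_integral_circlepath(2) [OF cont hol, of 0] \<open>r > 0\<close> by simp
  moreover have "(?\<phi> has_field_derivative fder f x u) (at 0)"
    using der [of 0] \<open>r > 0\<close> by simp
  ultimately have "fder f x u = 1 / (2 * of_real pi * \<i>) *
          contour_integral (circlepath 0 r) (\<lambda>z. ?\<phi> z / (z - 0)\<^sup>2)"
    using DERIV_unique by blast
  also have "\<dots> = 1 / (2 * of_real pi * \<i>) * integral {0..1}
     (\<lambda>t. ?\<phi> (circlepath 0 r t) / (circlepath 0 r t)\<^sup>2 * vector_derivative (circlepath 0 r) (at t))"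
    by (simp add: contour_integral_integral)
  also have "\<dots> = integral {0..1}
     (\<lambda>t. 1 / (2 * of_real pi * \<i>) * (?\<phi> (circlepath 0 r t) / (circlepath 0 r t)\<^sup>2 * vector_derivative (circlepath 0 r) (at t)))"
    by (rule integral_mult_right [symmetric])
  also have "\<dots> = integral {0..1} (\<lambda>t::real. f (x + (of_real r * exp (2 * of_real pi * \<i> * t)) *s u)
              / (of_real r * exp (2 * of_real pi * \<i> * t)))"
    \<comment> \<open>The speed \<open>2 pi i z\<close> of the circle cancels the prefactor and one
      factor of the squared denominator.\<close>
    unfolding vector_derivative_circlepath
    by (intro integral_cong) (use \<open>r > 0\<close> in \<open>simp add: circlepath power2_eq_square field_simps\<close>)
  finally show ?thesis
    by simp
qed

text \<open>The radius is common to all base points near \<open>x0\<close>, so that one circle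
  serves in the integral while \<open>x\<close> varies.\<close>

lemma locally_uniform_line:
  assumes "open S" "x0 \<in> (S :: (complex ^ 'n) set)"
  obtains \<epsilon> r :: real where "\<epsilon> > 0" "r > 0"
    "\<And>x z. x \<in> ball x0 \<epsilon> \<Longrightarrow> cmod z \<le> r \<Longrightarrow> x + z *s u \<in> S"
proof -
  obtain e where e: "e > 0" "ball x0 e \<subseteq> S"
    using assms open_contains_ball by blast
  \<comment> \<open>Dividing by \<open>1 + norm u\<close> instead of \<open>norm u\<close> covers
    \<open>u = 0\<close>.\<close>
  have pos: "1 + norm u > 0"
    by (simp add: add_pos_nonneg)
  show ?thesis
  proof
    show "e / 2 > 0" "e / 2 / (1 + norm u) > 0"
      using e pos by auto
    fix x z assume x: "x \<in> ball x0 (e / 2)" and z: "cmod z \<le> e / 2 / (1 + norm u)"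
    have "norm (z *s u) \<le> e / 2 / (1 + norm u) * norm u"
      unfolding norm_vec_smult by (rule mult_right_mono [OF z]) simp
    also have "\<dots> \<le> e / 2"
      using e pos by (simp add: field_simps)
    finally have "dist x0 (x + z *s u) < e"
      using x norm_triangle_ineq4 [of "x0 - x" "z *s u"]
      by (auto simp: dist_norm algebra_simps)
    then show "x + z *s u \<in> S"
      using e by auto
  qed
qed

text \<open>\<open>holo_on\<close> asks for a complex-linear differential at each point only; its
  continuity is a consequence of Cauchy's formula, whose integrand is jointly continuous. Both the
  Leibniz rule in \<open>holo_on_fder\<close> and the inverse function theorem in
  \<open>straightening\<close> rely on it.\<close>

lemma holo_on_continuous_fder:
  assumes f: "holo_on f S" and S: "open S"
  shows "continuous_on S (\<lambda>x. fder f x u)"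
proof (rule continuous_at_imp_continuous_on, rule ballI)
  fix x0 assume "x0 \<in> S"
  then obtain \<epsilon> r where *: "\<epsilon> > 0" "r > 0"
    "\<And>x z. x \<in> ball x0 \<epsilon> \<Longrightarrow> norm z \<le> r \<Longrightarrow> x + z *s u \<in> S"
    using locally_uniform_line S by metis
  define c where "c = (\<lambda>t::real. complex_of_real r * exp (2 * of_real pi * \<i> * t))"
  have c: "norm (c t) \<le> r" "c t \<noteq> 0" for t
    using \<open>r > 0\<close> by (auto simp: c_def norm_mult)
  have contc: "continuous_on A (\<lambda>x. c (snd x))" for A :: "((complex ^ 'a) \<times> real) set"
    unfolding c_def by (intro continuous_intros)
  have "continuous_on (ball x0 \<epsilon>) (\<lambda>x. integral (cbox 0 1) (\<lambda>t. f (x + c t *s u) / c t))"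
  proof (rule integral_continuous_on_param)
    have "continuous_on (ball x0 \<epsilon> \<times> cbox 0 1) (\<lambda>x. f (fst x + c (snd x) *s u))"
      by (rule continuous_on_compose2 [OF holo_on_continuous [OF f]])
        (auto intro!: continuous_intros contc * c)
    then show "continuous_on (ball x0 \<epsilon> \<times> cbox 0 1) (\<lambda>(x, t). f (x + c t *s u) / c t)"
      unfolding case_prod_unfold by (intro continuous_intros contc) (auto simp: c)
  qed
  moreover have "fder f x u = integral (cbox 0 1) (\<lambda>t. f (x + c t *s u) / c t)"
    if "x \<in> ball x0 \<epsilon>" for x
    unfolding c_def using fder_circle_integral [OF f \<open>r > 0\<close>] * that by blast
  ultimately have "continuous_on (ball x0 \<epsilon>) (\<lambda>x. fder f x u)"
    by (metis (no_types, lifting) continuous_on_cong)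
  then show "isCont (\<lambda>x. fder f x u) x0"
    using \<open>\<epsilon> > 0\<close> by (simp add: continuous_on_eq_continuous_at)
qed

text \<open>Differentiation under the Cauchy integral. Iterating it gives the derivatives of all
  orders that \<open>exists_regular_at\<close> needs for a Taylor argument.\<close>

lemma holo_on_fder:
  assumes f: "holo_on f S" and S: "open S"
  shows "holo_on (\<lambda>x. fder f x u) S"
  unfolding holo_on_def
proof
  fix x0 assume "x0 \<in> S"
  then obtain \<epsilon> r where *: "\<epsilon> > 0" "r > 0"
    "\<And>x z. x \<in> ball x0 \<epsilon> \<Longrightarrow> norm z \<le> r \<Longrightarrow> x + z *s u \<in> S"
    using locally_uniform_line S by metis
  define c where "c = (\<lambda>t::real. complex_of_real r * exp (2 * of_real pi * \<i> * t))"
  have c: "norm (c t) \<le> r" "c t \<noteq> 0" for t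
    using \<open>r > 0\<close> by (auto simp: c_def norm_mult)
  have contc: "continuous_on A (\<lambda>x. c (snd x))" for A :: "((complex ^ 'a) \<times> real) set"
    unfolding c_def by (intro continuous_intros)
  have contc': "continuous_on A c" for A
    unfolding c_def by (intro continuous_intros)
  \<comment> \<open>The differential in \<open>x\<close> of the integrand, as a bounded linear map
    depending on \<open>x\<close> and \<open>t\<close>, which is the form that the Leibniz rule
    expects.\<close>
  define F' where "F' = (\<lambda>x t. Blinfun (\<lambda>w. w / c t) o\<^sub>L Blinfun (fder f (x + c t *s u)))"
  have bl: "bounded_linear (\<lambda>w. w / c t)" for t
    by (rule bounded_linear_divide)
  have F'_apply: "blinfun_apply (F' x t) w = fder f (x + c t *s u) w / c t" 
    if "x \<in> ball x0 \<epsilon>" for x t w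
    using has_derivative_bounded_linear [OF holo_on_has_derivative [OF f *(3) [OF that c(1)]]] bl
    by (simp add: F'_def bounded_linear_Blinfun_apply)
  have contF': "continuous_on (ball x0 \<epsilon> \<times> cbox 0 1) (\<lambda>(x, t). F' x t)"
    unfolding case_prod_unfold
  proof (rule continuous_on_blinfun_componentwise)
    fix w :: "complex ^ 'a"
    have "continuous_on (ball x0 \<epsilon> \<times> cbox 0 1) (\<lambda>x. fder f (fst x + c (snd x) *s u) w)"
      by (rule continuous_on_compose2 [OF holo_on_continuous_fder [OF f S]])
        (auto intro!: continuous_intros contc * c)
    then have "continuous_on (ball x0 \<epsilon> \<times> cbox 0 1) (\<lambda>x. fder f (fst x + c (snd x) *s u) w / c (snd x))"
      by (intro continuous_intros contc) (auto simp: c)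
    then show "continuous_on (ball x0 \<epsilon> \<times> cbox 0 1) (\<lambda>x. blinfun_apply (F' (fst x) (snd x)) w)"
      by (rule continuous_on_eq) (auto simp: F'_apply)
  qed
  have der: "((\<lambda>x. integral (cbox 0 1) (\<lambda>t. f (x + c t *s u) / c t)) has_derivative
      integral (cbox 0 1) (F' x0)) (at x0 within ball x0 \<epsilon>)"
  proof (rule leibniz_rule [OF _ _ contF'])
    fix x t assume x: "x \<in> ball x0 \<epsilon>"
    have "((\<lambda>x. f (x + c t *s u)) has_derivative fder f (x + c t *s u)) (at x)"
    proof -
      have "((\<lambda>x. x + c t *s u) has_derivative (\<lambda>x. x)) (at x)"
        by (auto intro!: derivative_eq_intros)
      from diff_chain_at [OF this holo_on_has_derivative [OF f *(3) [OF x c(1)]]] show ?thesis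
        by (simp add: o_def)
    qed
    then have "((\<lambda>x. f (x + c t *s u) / c t) has_derivative (\<lambda>w. fder f (x + c t *s u) w / c t)) (at x)"
      using bounded_linear.has_derivative [OF bl] by blast
    then show "((\<lambda>x. f (x + c t *s u) / c t) has_derivative blinfun_apply (F' x t)) (at x within ball x0 \<epsilon>)"
      using F'_apply [OF x] by (metis (no_types, lifting) ext has_derivative_at_withinI)
  next
    fix x assume x: "x \<in> ball x0 \<epsilon>"
    have "continuous_on (cbox 0 1) (\<lambda>t. f (x + c t *s u))"
      by (rule continuous_on_compose2 [OF holo_on_continuous [OF f]])
        (use x in \<open>auto intro!: continuous_intros contc' * c\<close>)
    then show "(\<lambda>t. f (x + c t *s u) / c t) integrable_on cbox 0 1"
      by (intro integrable_continuous continuous_intros contc') (auto simp: c)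
  qed (use \<open>\<epsilon> > 0\<close> in auto)
  have eq: "fder f x u = integral (cbox 0 1) (\<lambda>t. f (x + c t *s u) / c t)"
    if "x \<in> ball x0 \<epsilon>" for x
    unfolding c_def using fder_circle_integral [OF f \<open>r > 0\<close>] * that by blast
  have int: "F' x0 integrable_on cbox 0 1"
    by (rule integrable_continuous, rule continuous_on_compose2 [OF contF', where f = "Pair x0", simplified])
      (use \<open>\<epsilon> > 0\<close> in \<open>auto intro!: continuous_intros\<close>)
  have app: "blinfun_apply (integral (cbox 0 1) (F' x0)) w
      = integral (cbox 0 1) (\<lambda>t. fder f (x0 + c t *s u) w / c t)" for w
    using \<open>\<epsilon> > 0\<close> F'_apply [of x0] blinfun_apply_integral [OF int, of w] by simp
  \<comment> \<open>The Leibniz rule yields a real-linear differential; its complex linearity is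
    inherited from the integrand at each \<open>t\<close>.\<close>
  have "blinfun_apply (integral (cbox 0 1) (F' x0)) (a *s w)
      = a * blinfun_apply (integral (cbox 0 1) (F' x0)) w" for a w
    unfolding app integral_mult_right [symmetric]
    using \<open>\<epsilon> > 0\<close> by (intro integral_cong) (simp add: holo_on_fder_smult [OF f *(3) [OF _ c(1)]])
  moreover have "((\<lambda>x. fder f x u) has_derivative integral (cbox 0 1) (F' x0)) (at x0)"
    using der eq \<open>\<epsilon> > 0\<close>
    by (metis (no_types, lifting) at_within_open centre_in_ball has_derivative_transform_within_open open_ball)
  ultimately show "\<exists>D. ((\<lambda>x. fder f x u) has_derivative D) (at x0) \<and> (\<forall>c w. D (c *s w) = c * D w)"
    by blast
qed


section \<open>Straightening independent holomorphic functions\<close>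

definition clin :: "(complex ^ 'n \<Rightarrow> complex) \<Rightarrow> bool" where
  "clin D \<longleftrightarrow> (\<forall>v w. D (v + w) = D v + D w) \<and> (\<forall>c w. D (c *s w) = c * D w)"

definition indep_funs :: "nat \<Rightarrow> (nat \<Rightarrow> complex ^ 'n \<Rightarrow> complex) \<Rightarrow> bool" where
  "indep_funs k D \<longleftrightarrow> (\<forall>c. (\<forall>w. (\<Sum>i<k. c i * D i w) = 0) \<longrightarrow> (\<forall>i<k. c i = 0))"

lemma clin_add: "clin D \<Longrightarrow> D (v + w) = D v + D w"
  and clin_smult: "clin D \<Longrightarrow> D (c *s w) = c * D w"
  by (auto simp: clin_def)

lemma clin_0: "clin D \<Longrightarrow> D 0 = 0"
  using clin_smult [of D 0 0] by simp

lemma clin_diff: "clin D \<Longrightarrow> D (v - w) = D v - D w"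
proof -
  assume "clin D"
  have "v - w = v + (-1) *s w"
    by (simp add: vec_eq_iff)
  then show ?thesis
    using \<open>clin D\<close> by (simp only: clin_add clin_smult) simp
qed

lemma clin_sum: "clin D \<Longrightarrow> D (\<Sum>i\<in>I. f i) = (\<Sum>i\<in>I. D (f i))"
  by (induction I rule: infinite_finite_induct) (auto simp: clin_0 clin_add)

lemma clin_bounded_linear:
  assumes "clin (D :: complex ^ 'n \<Rightarrow> complex)"
  shows "bounded_linear D"
proof -
  have "linear D"
    by (rule linearI) (use assms in \<open>auto simp: clin_add scaleR_eq_smult clin_smult scaleR_conv_of_real\<close>)
  then show ?thesis
    using linear_conv_bounded_linear by blast
qed

lemma clin_has_derivative: "clin D \<Longrightarrow> (D has_derivative D) (at x)"
  by (intro bounded_linear_imp_has_derivative clin_bounded_linear)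

lemma clin_holo_on: "clin D \<Longrightarrow> holo_on D S"
  unfolding holo_on_def using clin_has_derivative [of D] clin_smult [of D] by blast

lemma fder_clin: "clin D \<Longrightarrow> fder D x = D"
  using frechet_derivative_at [OF clin_has_derivative] by metis

lemma clin_fder: "holo_on f S \<Longrightarrow> v \<in> S \<Longrightarrow> clin (fder f v)"
  unfolding clin_def using holo_on_fder_smult [of f S v] linear_add [OF holo_on_fder_linear, of f S v] by auto

lemma subspace_clin_ker: "clin D \<Longrightarrow> vec.subspace {x. D x = 0}"
  by (auto simp: vec.subspace_def clin_0 clin_add clin_smult)

lemma indep_funs_mono:
  assumes "indep_funs k D" "r \<le> k"
  shows "indep_funs r D"
  unfolding indep_funs_def
proof (intro allI impI)
  fix c i assume *: "\<forall>w. (\<Sum>i<r. c i * D i w) = 0" and i: "i < r"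
  have "(\<Sum>i<k. (if i < r then c i else 0) * D i w) = (\<Sum>i<r. c i * D i w)" for w
    using assms(2) by (intro sum.mono_neutral_cong_right) auto
  then have "\<forall>w. (\<Sum>i<k. (if i < r then c i else 0) * D i w) = 0"
    by (simp only: *) simp
  then have "\<forall>i<k. (if i < r then c i else 0) = 0"
    using assms(1) [unfolded indep_funs_def, THEN spec, of "\<lambda>i. if i < r then c i else 0"] by blast
  then show "c i = 0"
    using i assms(2) by (metis order_less_le_trans)
qed

text \<open>Elimination by induction: the new functional, reduced by the earlier ones, is still
  nonzero, and a vector detecting it can be moved into the kernel of the earlier ones.\<close>

lemma indep_funs_dual:
  assumes "indep_funs k D" "\<And>i. i < k \<Longrightarrow> clin (D i)"
  shows "\<exists>e. \<forall>i<k. \<forall>j<k. D i (e j) = (if i = j then 1 else 0)"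
  using assms
proof (induction k)
  case 0
  then show ?case by simp
next
  case (Suc k)
  obtain e where e: "D i (e j) = (if i = j then 1 else 0)" if "i < k" "j < k" for i j
    using Suc.IH [OF indep_funs_mono [OF Suc.prems(1)]] Suc.prems(2) by auto
  have clin: "clin (D i)" if "i \<le> k" for i
    using Suc.prems(2) that by simp
  \<comment> \<open>The coefficients of \<open>D k\<close> minus the sum of the
    \<open>D k (e i) * D i\<close>, a functional that is nonzero by independence.\<close>
  let ?c = "\<lambda>i. if i = k then 1 else - D k (e i)"
  obtain w where w: "(\<Sum>i<Suc k. ?c i * D i w) \<noteq> 0"
    using Suc.prems(1) [unfolded indep_funs_def, THEN spec, of ?c] by auto
  define w' where "w' = w - (\<Sum>i<k. D i w *s e i)"
  have Dw': "D i w' = 0" if "i < k" for i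
  proof -
    have "D i (\<Sum>j<k. D j w *s e j) = (\<Sum>j<k. if j = i then D i w else 0)"
      unfolding clin_sum [OF clin [OF less_imp_le [OF that]]] clin_smult [OF clin [OF less_imp_le [OF that]]]
      using that e by (intro sum.cong) auto
    then show ?thesis
      using that clin [of i] by (simp add: w'_def clin_diff)
  qed
  have "D k w' = (\<Sum>i<Suc k. ?c i * D i w)"
  proof -
    have "(\<Sum>i<k. ?c i * D i w) = - (\<Sum>i<k. D i w * D k (e i))"
      unfolding sum_negf [symmetric] by (intro sum.cong) auto
    moreover have "D k w' = D k w - (\<Sum>i<k. D i w * D k (e i))"
      unfolding w'_def clin_diff [OF clin [OF order_refl]] clin_sum [OF clin [OF order_refl]]
        clin_smult [OF clin [OF order_refl]] ..
    ultimately show ?thesis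
      by simp
  qed
  with w have nz: "D k w' \<noteq> 0"
    by simp
  define e' where "e' = inverse (D k w') *s w'"
  have e': "D k e' = 1" "\<And>i. i < k \<Longrightarrow> D i e' = 0"
    using nz clin Dw' by (auto simp: e'_def clin_smult)
  \<comment> \<open>The new dual vector is \<open>e'\<close>; subtracting multiples of it from the
    old ones makes \<open>D k\<close> vanish on them and changes no earlier value.\<close>
  have "\<forall>i<Suc k. \<forall>j<Suc k. D i (if j = k then e' else e j - D k (e j) *s e') = (if i = j then 1 else 0)"
  proof (intro allI impI)
    fix i j assume ij: "i < Suc k" "j < Suc k"
    have "D i (e j - D k (e j) *s e') = D i (e j) - D k (e j) * D i e'"
      using ij clin [of i] by (simp add: clin_diff clin_smult)
    then show "D i (if j = k then e' else e j - D k (e j) *s e') = (if i = j then 1 else 0)"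
      using e' e [of i j] ij by (cases "i = k"; cases "j = k") (simp_all add: less_Suc_eq)
  qed
  then show ?case
    by (rule exI [of _ "\<lambda>j. if j = k then e' else e j - D k (e j) *s e'"])
qed

text \<open>\<open>D j\<close> kills the span of the other vectors but not
  \<open>e j\<close>.\<close>

lemma dual_vectors_independent:
  fixes e :: "nat \<Rightarrow> complex ^ 'n"
  assumes clin: "\<And>i. i < k \<Longrightarrow> clin (D i)"
    and e: "\<And>i j. i < k \<Longrightarrow> j < k \<Longrightarrow> D i (e j) = (if i = j then 1 else 0)"
  shows "vec.independent (e ` {..<k})" and "inj_on e {..<k}"
proof -
  show "vec.independent (e ` {..<k})"
    unfolding vec.dependent_def
  proof clarsimp
    fix j assume j: "j < k" and sp: "e j \<in> vec.span (e ` {..<k} - {e j})"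
    have "vec.span (e ` {..<k} - {e j}) \<subseteq> {x. D j x = 0}"
      by (rule vec.span_minimal [OF _ subspace_clin_ker]) (use e j clin in auto)
    then show False
      using sp e [OF j j] by auto
  qed
  show "inj_on e {..<k}"
  proof (rule inj_onI)
    fix i j assume "i \<in> {..<k}" "j \<in> {..<k}" "e i = e j"
    then show "i = j"
      using e [of i i] e [of i j] by (auto split: if_splits)
  qed
qed

text \<open>This bound is what allows a maximal number of independent differentials to be chosen in
  \<open>exists_regular_at\<close>.\<close>

lemma indep_funs_le_card:
  fixes D :: "nat \<Rightarrow> complex ^ 'n \<Rightarrow> complex"
  assumes "indep_funs k D" "\<And>i. i < k \<Longrightarrow> clin (D i)"
  shows "k \<le> CARD('n)"
proof -
  obtain e where e: "\<And>i j. i < k \<Longrightarrow> j < k \<Longrightarrow> D i (e j) = (if i = j then 1 else 0)"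
    using indep_funs_dual [OF assms] by auto
  have "card (e ` {..<k}) \<le> vec.dim (UNIV :: (complex ^ 'n) set)"
    by (rule vec.independent_card_le_dim) (use dual_vectors_independent(1) assms(2) e in auto)
  then show ?thesis
    using dual_vectors_independent(2) [of k D e] assms(2) e by (simp add: card_image vec_dim_card card_cart_basis)
qed

text \<open>Every \<open>x\<close> in the span of the dual vectors is the sum of the
  \<open>D i x *s e i\<close>, so a nonzero common zero lies outside this span. For a cone,
  \<open>v\<close> is the radial direction, and the codimension stays below the dimension of the
  vector space.\<close>

lemma indep_funs_less_card:
  fixes D :: "nat \<Rightarrow> complex ^ 'n \<Rightarrow> complex"
  assumes "indep_funs k D" "\<And>i. i < k \<Longrightarrow> clin (D i)" "v \<noteq> 0" "\<And>i. i < k \<Longrightarrow> D i v = 0"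
  shows "k < CARD('n)"
proof -
  obtain e where e: "\<And>i j. i < k \<Longrightarrow> j < k \<Longrightarrow> D i (e j) = (if i = j then 1 else 0)"
    using indep_funs_dual [OF assms(1,2)] by auto
  have "vec.span (e ` {..<k}) \<subseteq> {x. x = (\<Sum>i<k. D i x *s e i)}"
  proof (rule vec.span_minimal)
    show "e ` {..<k} \<subseteq> {x. x = (\<Sum>i<k. D i x *s e i)}"
    proof clarsimp
      fix j assume j: "j < k"
      have "(\<Sum>i<k. D i (e j) *s e i) = (\<Sum>i<k. if i = j then e j else 0)"
        using e j by (intro sum.cong) auto
      then show "e j = (\<Sum>i<k. D i (e j) *s e i)"
        using j by simp
    qed
    show "vec.subspace {x. x = (\<Sum>i<k. D i x *s e i)}"
    proof (rule vec.subspaceI)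
      fix c x assume x: "x \<in> {x. x = (\<Sum>i<k. D i x *s e i)}"
      have "(\<Sum>i<k. D i (c *s x) *s e i) = c *s (\<Sum>i<k. D i x *s e i)"
        using assms(2) by (simp add: clin_smult vec.scale_sum_right)
      then show "c *s x \<in> {x. x = (\<Sum>i<k. D i x *s e i)}"
        using x by (metis (mono_tags) mem_Collect_eq)
    next
      fix x y assume xy: "x \<in> {x. x = (\<Sum>i<k. D i x *s e i)}" "y \<in> {x. x = (\<Sum>i<k. D i x *s e i)}"
      have "(\<Sum>i<k. D i (x + y) *s e i) = (\<Sum>i<k. D i x *s e i) + (\<Sum>i<k. D i y *s e i)"
        using assms(2) by (simp add: clin_add vec.scale_left_distrib sum.distrib)
      then show "x + y \<in> {x. x = (\<Sum>i<k. D i x *s e i)}"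
        using xy by (metis (mono_tags) mem_Collect_eq)
    qed (use assms(2) in \<open>simp add: clin_0\<close>)
  qed
  then have "v \<notin> vec.span (e ` {..<k})"
    using assms(3,4) by auto
  then have "vec.independent (insert v (e ` {..<k}))" "v \<notin> e ` {..<k}"
    using dual_vectors_independent(1) [of k D e] assms(2) e by (auto simp: vec.independent_insert vec.span_base)
  then have "card (insert v (e ` {..<k})) \<le> vec.dim (UNIV :: (complex ^ 'n) set)"
    by (intro vec.independent_card_le_dim) auto
  then show ?thesis
    using dual_vectors_independent(2) [of k D e] assms(2) e \<open>v \<notin> e ` {..<k}\<close>
    by (simp add: card_image vec_dim_card card_cart_basis)
qed

text \<open>A larger kernel has smaller codimension: by \<open>ker\<close>, each \<open>D i\<close>
  factors through the projection \<open>p\<close> onto the span of the \<open>l\<close> vectors dual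
  to \<open>F\<close>, so the images under \<open>p\<close> of the \<open>k\<close> vectors dual to
  \<open>D\<close> are independent in that span.\<close>

lemma indep_funs_card_le:
  fixes D :: "nat \<Rightarrow> complex ^ 'n \<Rightarrow> complex"
  assumes "indep_funs k D" "\<And>i. i < k \<Longrightarrow> clin (D i)"
    and "indep_funs l F" "\<And>i. i < l \<Longrightarrow> clin (F i)"
    and ker: "\<And>w i. (\<And>j. j < l \<Longrightarrow> F j w = 0) \<Longrightarrow> i < k \<Longrightarrow> D i w = 0"
  shows "k \<le> l"
proof -
  obtain e where e: "\<And>i j. i < k \<Longrightarrow> j < k \<Longrightarrow> D i (e j) = (if i = j then 1 else 0)"
    using indep_funs_dual [OF assms(1,2)] by auto
  obtain b where b: "\<And>i j. i < l \<Longrightarrow> j < l \<Longrightarrow> F i (b j) = (if i = j then 1 else 0)"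
    using indep_funs_dual [OF assms(3,4)] by auto
  define p where "p w = (\<Sum>i<l. F i w *s b i)" for w
  have Fp: "F j (p w) = F j w" if "j < l" for j w
  proof -
    have "F j (p w) = (\<Sum>i<l. if i = j then F j w else 0)"
      unfolding p_def clin_sum [OF assms(4) [OF that]] clin_smult [OF assms(4) [OF that]]
      using that b by (intro sum.cong) auto
    then show ?thesis
      using that by simp
  qed
  have Dp: "D i (p w) = D i w" if "i < k" for i w
    using ker [of "p w - w" i] Fp that assms(2,4) by (simp add: clin_diff)
  have *: "D i (p (e j)) = (if i = j then 1 else 0)" if "i < k" "j < k" for i j
    using Dp e that by simp
  have "vec.independent ((\<lambda>j. p (e j)) ` {..<k})"
    using dual_vectors_independent(1) [of k D "\<lambda>j. p (e j)"] assms(2) * by blast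
  moreover have "p w \<in> vec.span (b ` {..<l})" for w
    unfolding p_def by (intro vec.span_sum vec.span_scale vec.span_base) auto
  ultimately have "card ((\<lambda>j. p (e j)) ` {..<k}) \<le> card (b ` {..<l})"
    using vec.independent_span_bound [of "b ` {..<l}" "(\<lambda>j. p (e j)) ` {..<k}"] by blast
  also have "\<dots> \<le> l"
    using card_image_le [of "{..<l}" b] by simp
  finally show ?thesis
    using dual_vectors_independent(2) [of k D "\<lambda>j. p (e j)"] assms(2) * by (simp add: card_image)
qed

text \<open>With vectors \<open>e i\<close> dual to the differentials at \<open>v\<close>, the map
  \<open>\<Psi> x = x + (\<Sum>i. (g i x - dg i x) *s e i)\<close> has differential the identity at \<open>v\<close> and transforms
  each \<open>g i\<close> into its differential.\<close>

lemma straightening: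
  fixes g :: "nat \<Rightarrow> complex ^ 'n \<Rightarrow> complex"
  assumes N: "open N" "v \<in> N" and g: "\<And>i. i < k \<Longrightarrow> holo_on (g i) N"
    and ind: "indep_funs k (\<lambda>i. fder (g i) v)"
  obtains M R \<Psi> \<Phi> where "open M" "v \<in> M" "M \<subseteq> N" "R > 0"
    "holo_map \<Psi> M" "holo_map \<Phi> (ball (\<Psi> v) R)"
    "\<And>x. x \<in> M \<Longrightarrow> \<Psi> x \<in> ball (\<Psi> v) R" "\<And>y. y \<in> ball (\<Psi> v) R \<Longrightarrow> \<Phi> y \<in> M"
    "\<And>x. x \<in> M \<Longrightarrow> \<Phi> (\<Psi> x) = x" "\<And>y. y \<in> ball (\<Psi> v) R \<Longrightarrow> \<Psi> (\<Phi> y) = y"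
    "\<And>x i. x \<in> M \<Longrightarrow> i < k \<Longrightarrow> fder (g i) v (\<Psi> x) = g i x"
    "fder \<Phi> (\<Psi> v) = (\<lambda>w. w)"
proof -
  have clin: "clin (fder (g i) x)" if "i < k" "x \<in> N" for i x
    using clin_fder g that by blast
  obtain e where e: "\<And>i j. i < k \<Longrightarrow> j < k \<Longrightarrow> fder (g i) v (e j) = (if i = j then 1 else 0)"
    using indep_funs_dual [OF ind] clin N by blast
  define \<Psi> where "\<Psi> x = x + (\<Sum>i<k. (g i x - fder (g i) v x) *s e i)" for x
  define D where "D x w = w + (\<Sum>i<k. (fder (g i) x w - fder (g i) v w) *s e i)" for x w
  have derD: "(\<Psi> has_derivative D x) (at x)" if "x \<in> N" for x
  proof -
    have "((\<lambda>x. (g i x - fder (g i) v x) *s e i) has_derivative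
        (\<lambda>w. (fder (g i) x w - fder (g i) v w) *s e i)) (at x)" if "i < k" for i
      using holo_on_has_derivative [OF g [OF that] \<open>x \<in> N\<close>] clin_has_derivative [OF clin [OF that \<open>v \<in> N\<close>]]
      by (auto intro!: bounded_linear.has_derivative [OF bounded_linear_smult_left] has_derivative_diff)
    then show ?thesis
      unfolding \<Psi>_def [abs_def] D_def [abs_def] by (auto intro!: has_derivative_add has_derivative_sum)
  qed
  have Dsmult: "D x (c *s w) = c *s D x w" if "x \<in> N" for x c w
    using clin [OF _ that] clin [OF _ \<open>v \<in> N\<close>]
    by (simp add: D_def clin_smult vec.scale_right_distrib vec.scale_sum_right right_diff_distrib
        vec.scale_left_diff_distrib vec.scale_right_diff_distrib)
  have bl: "bounded_linear (D x)" if "x \<in> N" for x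
    using derD [OF that] has_derivative_bounded_linear by blast
  \<comment> \<open>The inverse function theorem needs a continuous differential in operator norm;
    in finite dimension this reduces to continuity at each fixed \<open>w\<close>.\<close>
  have cont: "continuous_on N (\<lambda>x. Blinfun (D x))"
  proof (rule continuous_on_blinfun_componentwise)
    fix w :: "complex ^ 'n"
    have "continuous_on N (\<lambda>x. D x w)"
      unfolding D_def using g N by (auto intro!: continuous_intros holo_on_continuous_fder)
    then show "continuous_on N (\<lambda>x. blinfun_apply (Blinfun (D x)) w)"
      by (rule continuous_on_eq) (simp add: bl bounded_linear_Blinfun_apply)
  qed
  have Dv: "D v = (\<lambda>w. w)"
    by (simp add: D_def fun_eq_iff)
  then have "Blinfun (D v) = id_blinfun"
    by (simp add: id_blinfun_def id_def)
  then have inv: "id_blinfun o\<^sub>L Blinfun (D v) = id_blinfun"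
    by (intro blinfun_eqI) simp
  obtain U V \<Phi> \<Phi>' where UV: "open U" "U \<subseteq> N" "v \<in> U" "open V" "\<Psi> v \<in> V" "homeomorphism U V \<Psi> \<Phi>"
    and \<Phi>: "\<And>y. y \<in> V \<Longrightarrow> (\<Phi> has_derivative (\<Phi>' y)) (at y)"
    and \<Phi>': "\<And>y. y \<in> V \<Longrightarrow> \<Phi>' y = inv (blinfun_apply (Blinfun (D (\<Phi> y))))"
      "\<And>y. y \<in> V \<Longrightarrow> bij (blinfun_apply (Blinfun (D (\<Phi> y))))"
  proof (rule inverse_function_theorem [OF \<open>open N\<close> _ cont \<open>v \<in> N\<close> inv, of \<Psi>])
    show "(\<Psi> has_derivative blinfun_apply (Blinfun (D x))) (at x)" if "x \<in> N" for x
      using derD [OF that] bl [OF that] by (simp add: bounded_linear_Blinfun_apply)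
  qed (rule that)
  have \<Phi>U: "\<Phi> y \<in> U" "\<Psi> (\<Phi> y) = y" if "y \<in> V" for y
    using UV(6) that by (auto simp: homeomorphism_def)
  have \<Phi>'_eq: "\<Phi>' y = inv (D (\<Phi> y))" "bij (D (\<Phi> y))" if "y \<in> V" for y
    using \<Phi>' [OF that] bounded_linear_Blinfun_apply [OF bl [OF subsetD [OF UV(2) \<Phi>U(1) [OF that]]]]
    by simp_all
  \<comment> \<open>The inverse function theorem used is real; the differential of the inverse is
    complex linear as the inverse of a complex-linear bijection.\<close>
  have \<Phi>'_smult: "\<Phi>' y (c *s w) = c *s \<Phi>' y w" if "y \<in> V" for y c w
  proof -
    have "D (\<Phi> y) (c *s \<Phi>' y w) = c *s w"
      unfolding \<Phi>'_eq(1) [OF that] Dsmult [OF subsetD [OF UV(2) \<Phi>U(1) [OF that]]]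
        surj_f_inv_f [OF bij_is_surj [OF \<Phi>'_eq(2) [OF that]]] ..
    then have "inv (D (\<Phi> y)) (c *s w) = c *s \<Phi>' y w"
      using inv_f_f [OF bij_is_inj [OF \<Phi>'_eq(2) [OF that]]] by metis
    then show ?thesis
      unfolding \<Phi>'_eq(1) [OF that] .
  qed
  obtain R where R: "R > 0" "ball (\<Psi> v) R \<subseteq> V"
    using UV open_contains_ball by blast
  \<comment> \<open>With a ball as the straightened image, every complex line meets it in a
    connected set.\<close>
  define M where "M = U \<inter> \<Psi> -` ball (\<Psi> v) R"
  have "continuous_on U \<Psi>"
    using UV(6) by (simp add: homeomorphism_def)
  show ?thesis
  proof
    show "open M"
      unfolding M_def using \<open>continuous_on U \<Psi>\<close> \<open>open U\<close> by (intro continuous_open_preimage) auto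
    show "v \<in> M" "M \<subseteq> N" "R > 0"
      using UV R by (auto simp: M_def)
    show "holo_map \<Psi> M"
      unfolding holo_map_def using derD Dsmult \<open>M \<subseteq> N\<close> by blast
    show "holo_map \<Phi> (ball (\<Psi> v) R)"
      unfolding holo_map_def using \<Phi> \<Phi>'_smult R by blast
    show "\<Psi> x \<in> ball (\<Psi> v) R" if "x \<in> M" for x
      using that by (simp add: M_def)
    show "\<Phi> y \<in> M" "\<Psi> (\<Phi> y) = y" if "y \<in> ball (\<Psi> v) R" for y
      using that \<Phi>U R(2) by (auto simp: M_def subset_iff)
    show "\<Phi> (\<Psi> x) = x" if "x \<in> M" for x
      using that UV(6) by (simp add: M_def homeomorphism_def)
    show "fder (g i) v (\<Psi> x) = g i x" if "x \<in> M" "i < k" for x i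
    proof -
      have "fder (g i) v (\<Sum>j<k. (g j x - fder (g j) v x) *s e j)
          = (\<Sum>j<k. if j = i then g i x - fder (g i) v x else 0)"
        unfolding clin_sum [OF clin [OF that(2) \<open>v \<in> N\<close>]] clin_smult [OF clin [OF that(2) \<open>v \<in> N\<close>]]
        using e that by (intro sum.cong) auto
      then show ?thesis
        using clin [OF that(2) \<open>v \<in> N\<close>] that by (simp add: \<Psi>_def clin_add)
    qed
    have "\<Phi> (\<Psi> v) = v"
      using UV(3,6) by (simp add: homeomorphism_def)
    then have "\<Phi>' (\<Psi> v) = (\<lambda>w. w)"
      using \<Phi>'_eq(1) [OF UV(5)] Dv inv_id [unfolded id_def] by simp
    then show "fder \<Phi> (\<Psi> v) = (\<lambda>w. w)"
      using frechet_derivative_at [OF \<Phi> [OF UV(5)]] by simp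
  qed
qed


section \<open>Regular points of analytic sets\<close>

text \<open>The counterpart of \<open>regular_point\<close> in the vector space, indexed by the
  codimension \<open>k\<close> instead of the dimension.\<close>

definition regular_at :: "nat \<Rightarrow> (complex ^ 'n) set \<Rightarrow> complex ^ 'n \<Rightarrow> bool" where
  "regular_at k A v \<longleftrightarrow> v \<in> A \<and>
     (\<exists>N g. open N \<and> v \<in> N \<and> (\<forall>i<k. holo_on (g i) N) \<and>
        A \<inter> N = {x \<in> N. \<forall>i<k. g i x = 0} \<and> indep_funs k (\<lambda>i. fder (g i) v))"

lemma regular_atE:
  assumes "regular_at k A v"
  obtains N g where "v \<in> A" "open N" "v \<in> N" "\<And>i. i < k \<Longrightarrow> holo_on (g i) N"
    "A \<inter> N = {x \<in> N. \<forall>i<k. g i x = 0}" "indep_funs k (\<lambda>i. fder (g i) v)"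
  using assms unfolding regular_at_def by blast

lemma line_preimage_ball:
  fixes u :: "complex ^ 'n"
  shows "open {z. x + z *s u \<in> ball y R}" "connected {z. x + z *s u \<in> ball y R}"
proof -
  have eq: "{z. x + z *s u \<in> ball y R} = (\<lambda>z. z *s u) -` ball (y - x) R"
    by (auto simp: dist_norm algebra_simps)
  have bl: "bounded_linear (\<lambda>z. z *s u)"
    by (rule bounded_linear_smult_left)
  show "open {z. x + z *s u \<in> ball y R}"
    unfolding eq by (intro open_vimage open_ball linear_continuous_on bl)
  show "connected {z. x + z *s u \<in> ball y R}"
    unfolding eq
    by (intro convex_connected convex_linear_vimage convex_ball bounded_linear.linear bl)
qed

lemma holomorphic_on_line:
  assumes "holo_on f S" "\<And>z. z \<in> T \<Longrightarrow> x + z *s u \<in> S"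
  shows "(\<lambda>z. f (x + z *s u)) holomorphic_on T"
  unfolding holomorphic_on_def field_differentiable_def
  using has_field_derivative_line [OF assms(1) assms(2)] has_field_derivative_at_within by blast

text \<open>In straightened coordinates the zero set is a linear slice of a ball, so it contains the
  part inside the ball of the complex line through any two of its points, and the one-variable
  identity theorem applies there. \<open>M\<close> is chosen before \<open>h\<close> and
  \<open>T\<close>, hence serves all of them.\<close>

lemma zero_set_identity:
  assumes N: "open N" "v \<in> N" and g: "\<And>i. i < k \<Longrightarrow> holo_on (g i) N"
    and A: "A \<inter> N = {x \<in> N. \<forall>i<k. g i x = 0}" and ind: "indep_funs k (\<lambda>i. fder (g i) v)"
  obtains M where "open M" "v \<in> M" "M \<subseteq> N"
    "\<And>h T x. holo_on h M \<Longrightarrow> open T \<Longrightarrow> A \<inter> M \<inter> T \<noteq> {} \<Longrightarrow>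
       \<forall>y\<in>A \<inter> M \<inter> T. h y = 0 \<Longrightarrow> x \<in> A \<inter> M \<Longrightarrow> h x = 0"
proof -
  obtain M R \<Psi> \<Phi> where M: "open M" "v \<in> M" "M \<subseteq> N" "R > 0"
    and \<Psi>: "holo_map \<Psi> M" and \<Phi>: "holo_map \<Phi> (ball (\<Psi> v) R)"
    and \<Psi>M: "\<And>x. x \<in> M \<Longrightarrow> \<Psi> x \<in> ball (\<Psi> v) R"
    and \<Phi>B: "\<And>y. y \<in> ball (\<Psi> v) R \<Longrightarrow> \<Phi> y \<in> M"
    and \<Phi>\<Psi>: "\<And>x. x \<in> M \<Longrightarrow> \<Phi> (\<Psi> x) = x" and \<Psi>\<Phi>: "\<And>y. y \<in> ball (\<Psi> v) R \<Longrightarrow> \<Psi> (\<Phi> y) = y"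
    and D: "\<And>x i. x \<in> M \<Longrightarrow> i < k \<Longrightarrow> fder (g i) v (\<Psi> x) = g i x"
    and "fder \<Phi> (\<Psi> v) = (\<lambda>w. w)"
    by (rule straightening [OF N _ ind]) (erule g, rule that)
  have clin: "clin (fder (g i) v)" if "i < k" for i
    using clin_fder g that N by blast
  show ?thesis
  proof (rule that [OF M(1-3)])
    fix h T x
    assume h: "holo_on h M" and T: "open T" and ne: "A \<inter> M \<inter> T \<noteq> {}"
      and h0: "\<forall>y\<in>A \<inter> M \<inter> T. h y = 0" and x: "x \<in> A \<inter> M"
    obtain a where a: "a \<in> A" "a \<in> M" "a \<in> T"
      using ne by blast
    \<comment> \<open>The line passes through \<open>a\<close> at parameter 0, near which
      \<open>h\<close> vanishes, and through \<open>x\<close> at parameter 1.\<close>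
    define u where "u = \<Psi> x - \<Psi> a"
    let ?S = "{z. \<Psi> a + z *s u \<in> ball (\<Psi> v) R}"
    have Du: "fder (g i) v (\<Psi> a + z *s u) = 0" if "i < k" for i z
    proof -
      have "g i x = 0" "g i a = 0"
        using A a x that M(3) by auto
      then show ?thesis
        using clin [OF that] D a x that by (simp add: u_def clin_add clin_smult clin_diff)
    qed
    have inA: "\<Phi> (\<Psi> a + z *s u) \<in> A \<inter> M" if "z \<in> ?S" for z
    proof -
      have m: "\<Phi> (\<Psi> a + z *s u) \<in> M"
        using that \<Phi>B by simp
      moreover have "g i (\<Phi> (\<Psi> a + z *s u)) = 0" if "i < k" for i
        using D [OF m that] Du [OF that] \<Psi>\<Phi> \<open>z \<in> ?S\<close> by simp
      ultimately show ?thesis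
        using A M(3) by blast
    qed
    have hol: "holo_on (\<lambda>y. h (\<Phi> y)) (ball (\<Psi> v) R)"
      using holo_on_comp [OF \<Phi> h] \<Phi>B by blast
    have holl: "(\<lambda>z. h (\<Phi> (\<Psi> a + z *s u))) holomorphic_on ?S"
      by (rule holomorphic_on_line [OF hol]) simp
    have cont: "continuous_on ?S (\<lambda>z. \<Phi> (\<Psi> a + z *s u))"
      by (rule continuous_on_compose2 [OF holo_map_continuous [OF \<Phi>]]) (auto intro!: continuous_intros)
    have S01: "0 \<in> ?S" "1 \<in> ?S"
      using \<Psi>M a x by (auto simp: u_def)
    let ?Q = "?S \<inter> (\<lambda>z. \<Phi> (\<Psi> a + z *s u)) -` T"
    have "0 \<in> ?Q"
      using S01(1) a \<Phi>\<Psi> by simp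
    moreover have "open ?Q"
      by (rule continuous_open_preimage [OF cont line_preimage_ball(1) T])
    moreover have "h (\<Phi> (\<Psi> a + z *s u)) = 0" if "z \<in> ?Q" for z
      using inA [of z] h0 that by blast
    ultimately have "h (\<Phi> (\<Psi> a + 1 *s u)) = 0"
      using analytic_continuation_open [of ?Q ?S "\<lambda>z. h (\<Phi> (\<Psi> a + z *s u))" "\<lambda>_. 0" 1]
        line_preimage_ball [of "\<Psi> a" u "\<Psi> v" R] holl S01(2) holomorphic_on_const by blast
    then show "h x = 0"
      using x \<Phi>\<Psi> by (simp add: u_def)
  qed
qed

text \<open>The chain rule for the identity on \<open>B\<close>. It lets differentials at
  \<open>\<Phi> y\<close> be tested on vectors \<open>fder \<Phi> y w\<close>, which
  \<open>fder \<Psi>\<close> returns to \<open>w\<close>.\<close>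

lemma fder_inverse_maps:
  assumes "open M" "open B" "holo_map \<Psi> M" "holo_map \<Phi> B" "\<And>y. y \<in> B \<Longrightarrow> \<Phi> y \<in> M"
    "\<And>y. y \<in> B \<Longrightarrow> \<Psi> (\<Phi> y) = y" "y \<in> B"
  shows "fder \<Psi> (\<Phi> y) (fder \<Phi> y w) = w"
proof -
  have "((\<lambda>y. \<Psi> (\<Phi> y)) has_derivative (\<lambda>w. fder \<Psi> (\<Phi> y) (fder \<Phi> y w))) (at y)"
    using diff_chain_at [OF holo_map_has_derivative [OF assms(4,7)]
        holo_map_has_derivative [OF assms(3) assms(5) [OF assms(7)]]]
    by (simp add: o_def)
  then have "((\<lambda>y. y) has_derivative (\<lambda>w. fder \<Psi> (\<Phi> y) (fder \<Phi> y w))) (at y)"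
    by (rule has_derivative_transform_within_open) (use assms in auto)
  then show ?thesis
    using has_derivative_ident has_derivative_unique by metis
qed

text \<open>The number of functions is taken maximal. Then the derivative along the zero set of a function
  vanishing on \<open>A\<close> vanishes on \<open>A\<close> again, so all derivatives of the equations of \<open>A\<close> vanish.\<close>

lemma exists_regular_at:
  fixes A :: "(complex ^ 'n) set"
  assumes U: "open U" and f: "\<And>i. i < (l::nat) \<Longrightarrow> holo_on (f i) U"
    and A: "A \<inter> U = {x \<in> U. \<forall>i<l. f i x = 0}" and ne: "A \<inter> U \<noteq> {}"
  obtains k v where "v \<in> A \<inter> U" "regular_at k A v"
proof -
  \<comment> \<open>The \<open>r\<close> functions are only required to vanish on \<open>A\<close>;
    that they cut it out near \<open>v\<close> is what maximality will yield.\<close>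
  define P where "P r \<longleftrightarrow> (\<exists>v N g. v \<in> A \<and> v \<in> N \<and> N \<subseteq> U \<and> open N \<and> (\<forall>i<r. holo_on (g i) N) \<and>
     (\<forall>x\<in>A \<inter> N. \<forall>i<r. g i x = 0) \<and> indep_funs r (\<lambda>i. fder (g i) v))" for r
  have "P 0"
  proof -
    obtain v where "v \<in> A" "v \<in> U"
      using ne by auto
    then show ?thesis
      unfolding P_def using U
      by (intro exI [of _ v] exI [of _ U] exI [of _ undefined]) (simp add: indep_funs_def)
  qed
  moreover have bound: "r \<le> CARD('n)" if r: "P r" for r
  proof -
    obtain v N and g :: "nat \<Rightarrow> complex ^ 'n \<Rightarrow> complex"
      where "v \<in> N" and g: "\<forall>i<r. holo_on (g i) N" and ind: "indep_funs r (\<lambda>i. fder (g i) v)"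
      using r unfolding P_def by (elim exE conjE) (rule that)
    have "clin (fder (g i) v)" if "i < r" for i
      using clin_fder g \<open>v \<in> N\<close> that by blast
    then show ?thesis
      by (rule indep_funs_le_card [OF ind])
  qed
  ultimately have Pr: "P (Greatest P)"
    using GreatestI_nat [of P 0 "CARD('n)"] by blast
  define r where "r = Greatest P"
  have maximal: "\<not> P (Suc r)"
  proof
    assume "P (Suc r)"
    then have "Suc r \<le> Greatest P"
      by (rule Greatest_le_nat) (rule bound)
    then show False
      by (simp add: r_def)
  qed
  have "P r"
    using Pr by (simp add: r_def)
  then obtain v N and g :: "nat \<Rightarrow> complex ^ 'n \<Rightarrow> complex"
    where v: "v \<in> A" "v \<in> N" "N \<subseteq> U" "open N" and g': "\<forall>i<r. holo_on (g i) N"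
      and g0': "\<forall>x\<in>A \<inter> N. \<forall>i<r. g i x = 0" and ind: "indep_funs r (\<lambda>i. fder (g i) v)"
    unfolding P_def by (elim exE conjE) (rule that)
  have g: "holo_on (g i) N" if "i < r" for i
    using g' that by blast
  have g0: "g i x = 0" if "x \<in> A \<inter> N" "i < r" for i x
    using g0' that by blast
  obtain M R \<Psi> \<Phi> where M: "open M" "v \<in> M" "M \<subseteq> N" "R > 0"
    and \<Psi>: "holo_map \<Psi> M" and \<Phi>: "holo_map \<Phi> (ball (\<Psi> v) R)"
    and \<Psi>M: "\<And>x. x \<in> M \<Longrightarrow> \<Psi> x \<in> ball (\<Psi> v) R"
    and \<Phi>B: "\<And>y. y \<in> ball (\<Psi> v) R \<Longrightarrow> \<Phi> y \<in> M"
    and \<Phi>\<Psi>: "\<And>x. x \<in> M \<Longrightarrow> \<Phi> (\<Psi> x) = x" and \<Psi>\<Phi>: "\<And>y. y \<in> ball (\<Psi> v) R \<Longrightarrow> \<Psi> (\<Phi> y) = y"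
    and D: "\<And>x i. x \<in> M \<Longrightarrow> i < r \<Longrightarrow> fder (g i) v (\<Psi> x) = g i x"
    and "fder \<Phi> (\<Psi> v) = (\<lambda>w. w)"
    by (rule straightening [OF v(4,2) _ ind]) (erule g, rule that)
  let ?B = "ball (\<Psi> v) R"
  define d where "d i = fder (g i) v" for i
  have clin: "clin (d i)" if "i < r" for i
    unfolding d_def using clin_fder g that v by blast
  have step: "fder h y u = 0"
    if h: "holo_on h ?B" "\<And>y. y \<in> ?B \<Longrightarrow> \<Phi> y \<in> A \<Longrightarrow> h y = 0" and u: "\<And>i. i < r \<Longrightarrow> d i u = 0"
      and y: "y \<in> ?B" "\<Phi> y \<in> A" for h y u
  proof (rule ccontr)
    assume nz: "fder h y u \<noteq> 0"
    \<comment> \<open>The old functions together with \<open>h\<close>, carried back by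
      \<open>\<Psi>\<close>. In straightened coordinates the old ones are linear, so their
      independence at \<open>v\<close> persists at \<open>\<Phi> y\<close>.\<close>
    define G where "G i x = (if i < r then d i (\<Psi> x) else h (\<Psi> x))" for i x
    define H where "H i = (if i < r then d i else h)" for i
    have G_eq: "G i = (\<lambda>x. H i (\<Psi> x))" for i
      by (auto simp: G_def H_def fun_eq_iff)
    have H: "holo_on (H i) ?B" for i
      using h(1) clin_holo_on [OF clin] by (simp add: H_def)
    have fderG: "fder (G i) (\<Phi> y) (fder \<Phi> y w) = fder (H i) y w" for i w
      unfolding G_eq using fder_holo_comp [OF \<Psi> H \<Phi>B [OF y(1)]] \<Psi>\<Phi> [OF y(1)] y(1)
        fder_inverse_maps [OF M(1) open_ball \<Psi> \<Phi> \<Phi>B \<Psi>\<Phi> y(1)] by simp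
    have "P (Suc r)"
      unfolding P_def
    proof (intro exI conjI allI impI ballI)
      show "\<Phi> y \<in> A" "\<Phi> y \<in> M" "M \<subseteq> U" "open M"
        using y \<Phi>B M v by auto
      show "holo_on (G i) M" for i
        unfolding G_eq by (rule holo_on_comp [OF \<Psi> H \<Psi>M])
      show "G i x = 0" if "x \<in> A \<inter> M" for i x
        using that g0 [of x i] D [of x i] h(2) [OF \<Psi>M] \<Phi>\<Psi> M(3) by (auto simp: G_def d_def)
      show "indep_funs (Suc r) (\<lambda>i. fder (G i) (\<Phi> y))"
        unfolding indep_funs_def
      proof (intro allI impI)
        fix c i assume c: "\<forall>w. (\<Sum>i<Suc r. c i * fder (G i) (\<Phi> y) w) = 0" and i: "i < Suc r"
        have "(\<Sum>i<Suc r. c i * fder (H i) y w) = 0" for w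
          using c [rule_format, of "fder \<Phi> y w"] fderG by simp
        moreover have "(\<Sum>i<r. c i * fder (H i) y w) = (\<Sum>i<r. c i * d i w)" for w
          by (rule sum.cong) (simp_all add: H_def fder_clin [OF clin])
        ultimately have *: "(\<Sum>i<r. c i * d i w) + c r * fder h y w = 0" for w
          by (simp add: H_def)
        \<comment> \<open>The vector \<open>u\<close> is killed by all \<open>d i\<close> but not by
          the differential of \<open>h\<close>.\<close>
        then have "c r = 0"
          using * [of u] u nz by simp
        then have "\<forall>i<r. c i = 0"
          using * ind unfolding indep_funs_def d_def by simp
        then show "c i = 0"
          using \<open>c r = 0\<close> i less_Suc_eq by auto
      qed
    qed
    then show False
      using maximal by blast
  qed
  \<comment> \<open>The original equations hold on the whole linear slice: along the line from
    \<open>\<Psi> v\<close> to \<open>y\<close>, all derivatives of \<open>f j\<close> composed with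
    \<open>\<Phi>\<close> vanish at the point over \<open>v\<close>, by repeated use of
    \<open>step\<close>, so the restriction is zero.\<close>
  have vanish: "f j (\<Phi> y) = 0" if j: "j < l" and y: "y \<in> ?B" "\<And>i. i < r \<Longrightarrow> d i y = 0" for j y
  proof -
    define u where "u = y - \<Psi> v"
    have u: "d i u = 0" if "i < r" for i
      using clin [OF that] y(2) [OF that] D [OF M(2) that] g0 [of v i] v that
      by (simp add: u_def clin_diff d_def)
    define h where "h m = ((\<lambda>h x. fder h x u) ^^ m) (\<lambda>y. f j (\<Phi> y))" for m
    have h_Suc: "h (Suc m) x = fder (h m) x u" for m x
      by (simp add: h_def)
    have fU: "holo_on (f j) M"
      using f [OF j] holo_on_subset M v by blast
    have h: "holo_on (h m) ?B \<and> (\<forall>y\<in>?B. \<Phi> y \<in> A \<longrightarrow> h m y = 0)" for m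
    proof (induction m)
      case 0
      have "f j (\<Phi> y) = 0" if "y \<in> ?B" "\<Phi> y \<in> A" for y
        using A that \<Phi>B M(3) v(3) j by blast
      then show ?case
        using holo_on_comp [OF \<Phi> fU \<Phi>B] by (simp add: h_def)
    next
      case (Suc m)
      have "holo_on (\<lambda>x. fder (h m) x u) ?B"
        using Suc holo_on_fder by blast
      moreover have "fder (h m) y u = 0" if "y \<in> ?B" "\<Phi> y \<in> A" for y
        by (rule step) (use Suc u that in auto)
      ultimately show ?case
        using h_Suc by presburger
    qed
    let ?S = "{z. \<Psi> v + z *s u \<in> ?B}"
    have deriv: "(deriv ^^ m) (\<lambda>z. h 0 (\<Psi> v + z *s u)) z = h m (\<Psi> v + z *s u)" if "z \<in> ?S" for m z
      using that
    proof (induction m arbitrary: z)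
      case (Suc m)
      have "deriv ((deriv ^^ m) (\<lambda>z. h 0 (\<Psi> v + z *s u))) z = deriv (\<lambda>z. h m (\<Psi> v + z *s u)) z"
      proof (rule deriv_cong_ev)
        show "\<forall>\<^sub>F x in nhds z. (deriv ^^ m) (\<lambda>z. h 0 (\<Psi> v + z *s u)) x = h m (\<Psi> v + x *s u)"
          using Suc eventually_nhds_in_open [OF line_preimage_ball(1), of z "\<Psi> v" u "\<Psi> v" R]
          by (auto elim: eventually_mono)
      qed simp
      also have "\<dots> = h (Suc m) (\<Psi> v + z *s u)"
        unfolding h_Suc using h Suc.prems by (intro DERIV_imp_deriv has_field_derivative_line) auto
      finally show ?case
        by simp
    qed simp
    have "h 0 (\<Psi> v + 1 *s u) = 0"
    proof (rule holomorphic_fun_eq_0_on_connected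
        [where S = ?S and z = 0 and f = "\<lambda>z. h 0 (\<Psi> v + z *s u)"])
      show "(\<lambda>z. h 0 (\<Psi> v + z *s u)) holomorphic_on ?S"
        using h by (intro holomorphic_on_line [where S = ?B]) auto
      show "(deriv ^^ n) (\<lambda>z. h 0 (\<Psi> v + z *s u)) 0 = 0" for n
        using deriv [of 0 n] h [of n] M(4) \<Phi>\<Psi> [OF M(2)] v(1) by simp
      show "open ?S" "connected ?S"
        by (rule line_preimage_ball)+
    qed (use M(4) y in \<open>auto simp: u_def\<close>)
    then show ?thesis
      by (simp add: h_def u_def)
  qed
  have eq: "A \<inter> M = {x \<in> M. \<forall>i<r. g i x = 0}"
  proof safe
    fix x assume x: "x \<in> M" and gx: "\<forall>i<r. g i x = 0"
    have "f j x = 0" if "j < l" for j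
      using vanish [OF that \<Psi>M [OF x]] D [OF x] gx \<Phi>\<Psi> [OF x] by (simp add: d_def)
    then show "x \<in> A"
      using A x M(3) v(3) by blast
  qed (use g0 M(3) in auto)
  have "regular_at r A v"
    unfolding regular_at_def
    by (intro conjI exI [of _ M] exI [of _ g] allI impI v M eq ind holo_on_subset [OF g M(3)])
  moreover have "v \<in> A \<inter> U"
    using v by blast
  ultimately show ?thesis
    using that by blast
qed

text \<open>The tangent space is intrinsic: a vector \<open>w\<close> killed by the differentials of
  the \<open>f j\<close> is the velocity at 0 of the curve \<open>\<Phi> (\<Psi> v + z *s w)\<close>
  in \<open>A\<close>, since the differential of \<open>\<Phi>\<close> at \<open>\<Psi> v\<close> is
  the identity. The \<open>g i\<close> vanish along this curve, so their differentials kill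
  \<open>w\<close> too.\<close>

lemma regular_at_codim_le:
  assumes "regular_at k A v" "regular_at l A v"
  shows "k \<le> l"
proof -
  obtain N g where v: "v \<in> A" and N: "open N" "v \<in> N" and g: "\<And>i. i < k \<Longrightarrow> holo_on (g i) N"
    and A: "A \<inter> N = {x \<in> N. \<forall>i<k. g i x = 0}" and ind: "indep_funs k (\<lambda>i. fder (g i) v)"
    by (rule regular_atE [OF assms(1)]) (rule that)
  obtain N' f where "v \<in> A" and N': "open N'" "v \<in> N'" and f: "\<And>i. i < l \<Longrightarrow> holo_on (f i) N'"
    and A': "A \<inter> N' = {x \<in> N'. \<forall>i<l. f i x = 0}" and ind': "indep_funs l (\<lambda>i. fder (f i) v)"
    by (rule regular_atE [OF assms(2)]) (rule that)
  obtain M R \<Psi> \<Phi> where M: "open M" "v \<in> M" "M \<subseteq> N'" "R > 0"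
    and \<Psi>: "holo_map \<Psi> M" and \<Phi>: "holo_map \<Phi> (ball (\<Psi> v) R)"
    and \<Psi>M: "\<And>x. x \<in> M \<Longrightarrow> \<Psi> x \<in> ball (\<Psi> v) R"
    and \<Phi>B: "\<And>y. y \<in> ball (\<Psi> v) R \<Longrightarrow> \<Phi> y \<in> M"
    and \<Phi>\<Psi>: "\<And>x. x \<in> M \<Longrightarrow> \<Phi> (\<Psi> x) = x" and \<Psi>\<Phi>: "\<And>y. y \<in> ball (\<Psi> v) R \<Longrightarrow> \<Psi> (\<Phi> y) = y"
    and D: "\<And>x i. x \<in> M \<Longrightarrow> i < l \<Longrightarrow> fder (f i) v (\<Psi> x) = f i x"
    and id: "fder \<Phi> (\<Psi> v) = (\<lambda>w. w)"
    by (rule straightening [OF N' _ ind']) (erule f, rule that)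
  have clin: "clin (fder (f i) v)" if "i < l" for i
    using clin_fder f that N' by blast
  show ?thesis
  proof (rule indep_funs_card_le [OF ind _ ind'])
    show "clin (fder (g i) v)" if "i < k" for i
      using clin_fder g that N by blast
    fix w i assume w: "\<And>j. j < l \<Longrightarrow> fder (f j) v w = 0" and i: "i < k"
    let ?S = "{z. \<Psi> v + z *s w \<in> ball (\<Psi> v) R}"
    have inA: "\<Phi> (\<Psi> v + z *s w) \<in> A" if "z \<in> ?S" for z
    proof -
      have m: "\<Phi> (\<Psi> v + z *s w) \<in> M"
        using that \<Phi>B by simp
      have "f j (\<Phi> (\<Psi> v + z *s w)) = 0" if "j < l" for j
      proof -
        have "f j v = 0"
          using v A' that N' by blast
        then show ?thesis
          using D [OF m that] D [OF M(2) that] \<Psi>\<Phi> \<open>z \<in> ?S\<close> w [OF that] clin [OF that]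
          by (simp add: clin_add clin_smult)
      qed
      then show ?thesis
        using A' m M(3) by blast
    qed
    have cont: "continuous_on ?S (\<lambda>z. \<Phi> (\<Psi> v + z *s w))"
      by (rule continuous_on_compose2 [OF holo_map_continuous [OF \<Phi>]]) (auto intro!: continuous_intros)
    let ?Q = "?S \<inter> (\<lambda>z. \<Phi> (\<Psi> v + z *s w)) -` N"
    have S0: "open ?Q" "0 \<in> ?Q"
      using continuous_open_preimage [OF cont line_preimage_ball(1) N(1)] M \<Phi>\<Psi> N by auto
    have "((\<lambda>z. \<Psi> v + z *s w) has_derivative (\<lambda>z. z *s w)) (at 0)"
      using bounded_linear_imp_has_derivative [OF bounded_linear_smult_left [of w]]
      by (auto intro!: derivative_eq_intros)
    moreover have "(\<Phi> has_derivative (\<lambda>w. w)) (at (\<Psi> v + 0 *s w))"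
      using holo_map_has_derivative [OF \<Phi>, of "\<Psi> v"] M(4) id by simp
    ultimately have "((\<lambda>z. \<Phi> (\<Psi> v + z *s w)) has_derivative (\<lambda>z. z *s w)) (at 0)"
      using diff_chain_at by (fastforce simp: o_def)
    moreover have "(g i has_derivative fder (g i) v) (at (\<Phi> (\<Psi> v + 0 *s w)))"
      using holo_on_has_derivative [OF g [OF i] N(2)] \<Phi>\<Psi> [OF M(2)] by simp
    ultimately have "((\<lambda>z. g i (\<Phi> (\<Psi> v + z *s w))) has_derivative (\<lambda>z. fder (g i) v (z *s w))) (at 0)"
      using diff_chain_at by (fastforce simp: o_def)
    then have "((\<lambda>z. 0) has_derivative (\<lambda>z. fder (g i) v (z *s w))) (at 0)"
      by (rule has_derivative_transform_within_open [OF _ S0]) (use inA A i in blast)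
    then have "(\<lambda>z. fder (g i) v (z *s w)) = (\<lambda>z. 0)"
      using has_derivative_const has_derivative_unique by blast
    then have "fder (g i) v (1 *s w) = 0"
      by metis
    then show "fder (g i) v w = 0"
      by simp
  qed (use clin in auto)
qed


section \<open>Cones over subsets of projective space\<close>

lemma span_singleton_vec: "vec.span {v} = range (\<lambda>c. c *s (v :: complex ^ 'n))"
  by (auto simp: vec.span_singleton)

lemma span_singleton_smult:
  assumes "c \<noteq> 0"
  shows "vec.span {c *s v} = vec.span {v :: complex ^ 'n}"
proof -
  have "v = inverse c *s (c *s v)"
    using assms by (simp add: vec.scale_scale)
  then have "v \<in> vec.span {c *s v}"
    by (metis insertI1 vec.span_base vec.span_scale)
  moreover have "c *s v \<in> vec.span {v}"
    by (simp add: vec.span_base vec.span_scale)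
  ultimately show ?thesis
    by (simp add: vec.span_minimal subset_antisym)
qed

lemma span_singleton_eqD:
  assumes "vec.span {v} = vec.span {w :: complex ^ 'n}" "v \<noteq> 0"
  obtains c where "c \<noteq> 0" "v = c *s w"
proof -
  have "v \<in> vec.span {w}"
    using assms(1) vec.span_base by blast
  then obtain c where "v = c *s w"
    by (auto simp: span_singleton_vec)
  with that assms(2) show ?thesis
    by (metis vec.scale_zero_left)
qed

lemma span_singleton_subset_iff:
  assumes "vec.subspace E"
  shows "vec.span {v} \<subseteq> E \<longleftrightarrow> (v :: complex ^ 'n) \<in> E"
  using assms vec.span_minimal [of "{v}" E] vec.span_base [of v "{v}"] by auto

lemma affine_cone_smult:
  assumes "c \<noteq> 0"
  shows "c *s v \<in> affine_cone W \<longleftrightarrow> v \<in> affine_cone W"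
  using assms by (simp add: affine_cone_def span_singleton_smult)

text \<open>The quotient map is open: the cone over the image of \<open>U\<close> is the union of
  the preimages of \<open>U - {0}\<close> under all nonzero scalings.\<close>

lemma openin_proj_image:
  assumes "open U"
  shows "openin proj_topology ((\<lambda>v :: complex ^ 'n. vec.span {v}) ` (U - {0}))"
proof -
  have "affine_cone ((\<lambda>v. vec.span {v}) ` (U - {0})) = (\<Union>c\<in>-{0}. (\<lambda>x. c *s x) -` (U - {0}))"
  proof (intro equalityI subsetI)
    fix x assume "x \<in> affine_cone ((\<lambda>v. vec.span {v}) ` (U - {0}))"
    then obtain y where "x \<noteq> 0" "y \<in> U" "y \<noteq> 0" "vec.span {y} = vec.span {x}"
      by (auto simp: affine_cone_def)
    then show "x \<in> (\<Union>c\<in>-{0}. (\<lambda>x. c *s x) -` (U - {0}))"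
      by (auto elim!: span_singleton_eqD)
  next
    fix x assume "x \<in> (\<Union>c\<in>-{0}. (\<lambda>x. c *s x) -` (U - {0}))"
    then obtain c where c: "c \<noteq> 0" "c *s x \<in> U - {0}"
      by auto
    then have "vec.span {x} \<in> (\<lambda>v. vec.span {v}) ` (U - {0})"
      using span_singleton_smult [OF c(1), of x] by (metis image_eqI)
    then show "x \<in> affine_cone ((\<lambda>v. vec.span {v}) ` (U - {0}))"
      using c by (auto simp: affine_cone_def)
  qed
  moreover have "open (\<Union>c\<in>-{0}. (\<lambda>x. c *s x) -` (U - {0}))"
    using assms by (intro open_UN ballI open_vimage open_delete continuous_intros) auto
  ultimately show ?thesis
    by (auto simp: openin_proj_topology proj_space_def)
qed

lemma continuous_map_span_singleton:
  assumes "0 \<notin> S"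
  shows "continuous_map (top_of_set S) proj_topology (\<lambda>v :: complex ^ 'n. vec.span {v})"
proof -
  have "openin (top_of_set S) {x \<in> S. vec.span {x} \<in> N}" if "openin proj_topology N" for N
  proof -
    have "{x \<in> S. vec.span {x} \<in> N} = S \<inter> affine_cone N"
      using assms by (auto simp: affine_cone_def)
    then show ?thesis
      using that by (metis openin_open_Int openin_proj_topology)
  qed
  then show ?thesis
    using assms by (auto simp: continuous_map topspace_proj_topology proj_space_def)
qed

text \<open>Pullbacks of local equations are local equations of the cone. The codimension is
  unchanged; the summand 1 accounts for the radial direction.\<close>

lemma regular_point_imp_regular_at:
  assumes "regular_point d W p" "v \<noteq> 0" "vec.span {v} = p"
  obtains k where "k + d + 1 = CARD('n)" "regular_at k (affine_cone W) (v :: complex ^ 'n)"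
proof -
  obtain N k f where p: "p \<in> W" and N: "openin proj_topology N" "p \<in> N" "k + d + 1 = CARD('n)"
    and f: "\<forall>i<k. proj_holomorphic_on (f i) N" and W: "W \<inter> N = {x \<in> N. \<forall>i<k. f i x = 0}"
    and ind: "\<forall>v\<in>affine_cone {p}. \<forall>c. (\<forall>w. (\<Sum>i<k. c i * fder (pullback (f i)) v w) = 0) \<longrightarrow>
           (\<forall>i<k. c i = (0::complex))"
    using assms(1) unfolding regular_point_def by (elim exE conjE) (rule that)
  have v: "v \<in> affine_cone {p}"
    using assms by (simp add: affine_cone_def)
  have "affine_cone W \<inter> affine_cone N = {x \<in> affine_cone N. \<forall>i<k. pullback (f i) x = 0}"
  proof (intro equalityI subsetI)
    fix x assume "x \<in> affine_cone W \<inter> affine_cone N"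
    then have "x \<noteq> 0" "vec.span {x} \<in> W \<inter> N"
      by (auto simp: affine_cone_def)
    then show "x \<in> {x \<in> affine_cone N. \<forall>i<k. pullback (f i) x = 0}"
      unfolding W by (auto simp: affine_cone_def pullback_def)
  next
    fix x assume x: "x \<in> {x \<in> affine_cone N. \<forall>i<k. pullback (f i) x = 0}"
    then have "vec.span {x} \<in> {x \<in> N. \<forall>i<k. f i x = 0}"
      by (auto simp: affine_cone_def pullback_def)
    then have "vec.span {x} \<in> W \<inter> N"
      unfolding W .
    with x show "x \<in> affine_cone W \<inter> affine_cone N"
      by (auto simp: affine_cone_def)
  qed
  moreover have "v \<in> affine_cone W" "open (affine_cone N)" "v \<in> affine_cone N"
    using N p assms by (auto simp: openin_proj_topology affine_cone_def)
  moreover have "\<forall>i<k. holo_on (pullback (f i)) (affine_cone N)"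
    using f by (simp add: holo_on_def proj_holomorphic_on_def)
  moreover have "indep_funs k (\<lambda>i. fder (pullback (f i)) v)"
    using ind v by (simp add: indep_funs_def)
  ultimately have "regular_at k (affine_cone W) v"
    unfolding regular_at_def
    by (intro conjI exI [of _ "affine_cone N"] exI [of _ "\<lambda>i. pullback (f i)"])
  then show ?thesis
    using that N(3) by blast
qed

text \<open>Two applications of \<open>regular_at_codim_le\<close> on the cone. This is how the
  dimension of \<open>Zset\<close> is pinned to a single value.\<close>

lemma regular_point_dim_unique:
  assumes "regular_point d W p" "regular_point d' W p" "p \<in> proj_space"
  shows "d = d'"
proof -
  obtain v where v: "v \<noteq> 0" "vec.span {v} = p"
    using assms(3) by (auto simp: proj_space_def)
  obtain k where k: "k + d + 1 = CARD('a)" "regular_at k (affine_cone W) v"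
    by (rule regular_point_imp_regular_at [OF assms(1) v])
  obtain k' where k': "k' + d' + 1 = CARD('a)" "regular_at k' (affine_cone W) v"
    by (rule regular_point_imp_regular_at [OF assms(2) v])
  have "k = k'"
    using regular_at_codim_le [OF k(2) k'(2)] regular_at_codim_le [OF k'(2) k(2)] by simp
  then show ?thesis
    using k(1) k'(1) by simp
qed

lemma holo_on_cong_open:
  assumes "holo_on f S" "open S" "\<And>x. x \<in> S \<Longrightarrow> f x = g x"
  shows "holo_on g S" "v \<in> S \<Longrightarrow> fder g v = fder f v"
proof -
  have der: "(g has_derivative fder f v) (at v)" if "v \<in> S" for v
    using holo_on_has_derivative [OF assms(1) that]
    by (rule has_derivative_transform_within_open) (use assms that in auto)
  then show "v \<in> S \<Longrightarrow> fder g v = fder f v"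
    using frechet_derivative_at by metis
  show "holo_on g S"
    unfolding holo_on_def using der holo_on_fder_smult [OF assms(1)] by blast
qed

text \<open>Functions near a vector \<open>v\<close> become functions on projective space by restricting to the affine
  chart through \<open>v\<close>. This does not change the kernel of their differentials at \<open>v\<close>, since
  these vanish on the line through \<open>v\<close>.\<close>

lemma regular_at_imp_regular_point:
  fixes v :: "complex ^ 'n"
  assumes "regular_at k (affine_cone W) v"
  shows "k < CARD('n)" "regular_point (CARD('n) - 1 - k) W (vec.span {v})"
proof -
  obtain N g where vW: "v \<in> affine_cone W" and N: "open N" "v \<in> N" and g: "\<And>i. i < k \<Longrightarrow> holo_on (g i) N"
    and W: "affine_cone W \<inter> N = {x \<in> N. \<forall>i<k. g i x = 0}" and ind: "indep_funs k (\<lambda>i. fder (g i) v)"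
    by (rule regular_atE [OF assms]) (rule that)
  have clin: "clin (fder (g i) v)" if "i < k" for i
    using clin_fder g that N by blast
  have "v \<noteq> 0"
    using vW by (simp add: affine_cone_def)
  have radial: "fder (g i) v v = 0" if i: "i < k" for i
  proof -
    have "open ((\<lambda>z. v + z *s v) -` N)"
      using N by (intro open_vimage continuous_intros) auto
    \<comment> \<open>At \<open>z = -1\<close> the point \<open>v + z *s v\<close> is 0, which no
      cone contains.\<close>
    then have op: "open ((\<lambda>z. v + z *s v) -` N - {-1})"
      by (rule open_delete)
    have d: "((\<lambda>z. g i (v + z *s v)) has_field_derivative fder (g i) (v + 0 *s v) v) (at 0)"
      by (rule has_field_derivative_line [OF g [OF i]]) (use N in simp)
    have zero: "g i (v + z *s v) = 0" if "z \<in> (\<lambda>z. v + z *s v) -` N - {-1}" for z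
    proof -
      have "v + z *s v = (1 + z) *s v" "1 + z \<noteq> 0"
        using that by (auto simp: vec.scale_left_distrib add_eq_0_iff)
      then have "v + z *s v \<in> affine_cone W"
        using vW affine_cone_smult [of "1 + z" v W] by metis
      then have "v + z *s v \<in> affine_cone W \<inter> N"
        using that by simp
      then show ?thesis
        unfolding W using i by simp
    qed
    have "((\<lambda>z. 0) has_field_derivative fder (g i) (v + 0 *s v) v) (at 0)"
      by (rule has_field_derivative_transform_within_open [OF d op]) (use N zero in auto)
    from DERIV_unique [OF this DERIV_const] show ?thesis
      by simp
  qed
  show k: "k < CARD('n)"
    using indep_funs_less_card [OF ind _ \<open>v \<noteq> 0\<close>] clin radial by blast
  obtain j where j: "v $ j \<noteq> 0"
    using \<open>v \<noteq> 0\<close> by (auto simp: vec_eq_iff)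
  \<comment> \<open>The affine chart is \<open>ell = 1\<close>, normalized to contain
    \<open>v\<close>, and \<open>s\<close> moves a vector along its line into the chart.\<close>
  define ell where "ell x = x $ j / v $ j" for x :: "complex ^ 'n"
  define s where "s x = inverse (ell x) *s x" for x
  have ell: "ell (c *s x) = c * ell x" "ell v = 1" for c x
    using j by (auto simp: ell_def)
  have "bounded_linear ell"
    unfolding ell_def [abs_def]
    by (intro bounded_linear_compose [OF bounded_linear_divide bounded_linear_vec_nth])
  then have ell_der: "(ell has_derivative ell) (at x)" for x
    by (rule bounded_linear_imp_has_derivative)
  define C where "C = {x. ell x \<noteq> 0 \<and> s x \<in> N}"
  have s_der: "(s has_derivative (\<lambda>w. inverse (ell x) *s w + (- (ell w / (ell x)\<^sup>2)) *s x)) (at x)"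
    if "ell x \<noteq> 0" for x
  proof -
    have "((\<lambda>x. inverse (ell x)) has_derivative (\<lambda>w. - (ell w / (ell x)\<^sup>2))) (at x)"
      using Deriv.has_derivative_inverse [OF that ell_der] that
      by (simp add: power2_eq_square inverse_eq_divide)
    from has_derivative_smult [OF this has_derivative_ident] show ?thesis
      unfolding s_def [abs_def] .
  qed
  have holo_s: "holo_map s {x. ell x \<noteq> 0}"
    unfolding holo_map_def
  proof
    fix x assume "x \<in> {x. ell x \<noteq> 0}"
    then have "(s has_derivative (\<lambda>w. inverse (ell x) *s w + (- (ell w / (ell x)\<^sup>2)) *s x)) (at x)"
      using s_der by simp
    moreover have "inverse (ell x) *s (c *s w) + (- (ell (c *s w) / (ell x)\<^sup>2)) *s x
        = c *s (inverse (ell x) *s w + (- (ell w / (ell x)\<^sup>2)) *s x)" for c w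
      unfolding ell by (simp add: vec_eq_iff right_diff_distrib mult_ac)
    ultimately show "\<exists>D. (s has_derivative D) (at x) \<and> (\<forall>c w. D (c *s w) = c *s D w)"
      by blast
  qed
  have open_ell: "open {x. ell x \<noteq> 0}"
  proof -
    have "open (ell -` (-{0}))"
      using \<open>bounded_linear ell\<close> by (intro open_vimage linear_continuous_on) auto
    then show ?thesis
      by (simp add: vimage_def Compl_eq)
  qed
  have openC: "open C"
    using continuous_open_preimage [OF holo_map_continuous [OF holo_s] open_ell N(1)]
    by (simp add: C_def Int_def vimage_def)
  \<comment> \<open>Evaluates \<open>g i\<close> at the representative of the line in the
    chart.\<close>
  define f where "f i p = g i (THE y. y \<in> p \<and> ell y = 1)" for i p
  have pull: "pullback (f i) x = g i (s x)" if "ell x \<noteq> 0" for i x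
  proof -
    have "(THE y. y \<in> vec.span {x} \<and> ell y = 1) = s x"
    proof (rule the_equality)
      show "s x \<in> vec.span {x} \<and> ell (s x) = 1"
        using that by (simp add: s_def ell vec.span_base vec.span_scale)
      fix y assume y: "y \<in> vec.span {x} \<and> ell y = 1"
      then obtain c where c: "y = c *s x"
        by (auto simp: span_singleton_vec)
      with y that have "c = inverse (ell x)"
        by (simp add: ell inverse_eq_divide eq_divide_eq)
      with c show "y = s x"
        by (simp add: s_def)
    qed
    then show ?thesis
      by (simp add: pullback_def f_def)
  qed
  define N' where "N' = (\<lambda>x. vec.span {x}) ` C"
  have s_smult: "s (c *s x) = s x" if "c \<noteq> 0" for c x
  proof -
    have "inverse (ell (c *s x)) * c = inverse (ell x)"
      using that by (simp add: ell mult.commute [of "inverse c"] mult.assoc)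
    then show ?thesis
      unfolding s_def vec.scale_scale by simp
  qed
  have C_smult: "c *s x \<in> C \<longleftrightarrow> x \<in> C" if "c \<noteq> 0" for c x
    using that by (simp add: C_def s_smult ell)
  have C0: "x \<noteq> 0" if "x \<in> C" for x
    using that by (auto simp: C_def ell_def)
  have coneN': "affine_cone N' = C"
  proof (intro equalityI subsetI)
    fix x assume "x \<in> affine_cone N'"
    then obtain y where xy: "x \<noteq> 0" "y \<in> C" "vec.span {x} = vec.span {y}"
      by (auto simp: affine_cone_def N'_def)
    obtain c where "c \<noteq> 0" "x = c *s y"
      by (rule span_singleton_eqD [OF xy(3,1)])
    then show "x \<in> C"
      using C_smult xy(2) by simp
  next
    fix x assume "x \<in> C"
    then show "x \<in> affine_cone N'"
      using C0 by (simp add: affine_cone_def N'_def)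
  qed
  have C_ell: "ell x \<noteq> 0" "s x \<in> N" if "x \<in> C" for x
    using that by (auto simp: C_def)
  have holo_gs: "holo_on (\<lambda>x. g i (s x)) C" if "i < k" for i
  proof (rule holo_on_comp [OF _ g [OF that]])
    show "holo_map s C"
      using holo_map_subset [OF holo_s, of C] C_ell(1) by blast
  qed (rule C_ell)
  have holo_f: "holo_on (pullback (f i)) C" "fder (pullback (f i)) x = fder (\<lambda>x. g i (s x)) x"
    if "i < k" "x \<in> C" for i x
  proof -
    have eq: "g i (s x) = pullback (f i) x" if "x \<in> C" for x
      using pull [OF C_ell(1) [OF that]] by simp
    show "holo_on (pullback (f i)) C" "fder (pullback (f i)) x = fder (\<lambda>x. g i (s x)) x"
      using holo_on_cong_open [OF holo_gs [OF that(1)] openC eq] that(2) by blast+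
  qed
  have eqW: "W \<inter> N' = {p \<in> N'. \<forall>i<k. f i p = 0}"
  proof -
    have "vec.span {x} \<in> W \<longleftrightarrow> (\<forall>i<k. f i (vec.span {x}) = 0)" if "x \<in> C" for x
    proof -
      have "vec.span {x} \<in> W \<longleftrightarrow> s x \<in> affine_cone W \<inter> N"
        using C_ell [OF that] C0 [OF that] affine_cone_smult [of "inverse (ell x)" x W]
        by (simp add: s_def affine_cone_def)
      also have "\<dots> \<longleftrightarrow> (\<forall>i<k. g i (s x) = 0)"
        unfolding W using C_ell [OF that] by simp
      finally show ?thesis
        using pull [OF C_ell(1) [OF that]] by (simp add: pullback_def)
    qed
    then show ?thesis
      by (auto simp: N'_def)
  qed
  have opN': "openin proj_topology N'"
    unfolding openin_proj_topology coneN' using openC C0 by (auto simp: N'_def proj_space_def)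
  have vC: "v \<in> C"
    using N by (simp add: C_def ell s_def)
  then have vN': "vec.span {v} \<in> N'"
    by (simp add: N'_def)
  have holN': "\<forall>i<k. proj_holomorphic_on (f i) N'"
    unfolding proj_holomorphic_on_def coneN' using holo_f(1) [OF _ vC] by (simp add: holo_on_def)
  have indN': "c i = 0" if v': "v' \<in> affine_cone {vec.span {v}}"
    and c: "\<forall>w. (\<Sum>i<k. c i * fder (pullback (f i)) v' w) = 0" and i: "i < k" for v' c i
  proof -
    obtain a where a: "a \<noteq> 0" "v' = a *s v"
      using v' by (auto simp: affine_cone_def elim!: span_singleton_eqD)
    then have v'C: "v' \<in> C"
      using vC C_smult by blast
    have sv': "s v' = v"
      using a s_smult [of a v] by (simp add: s_def ell)
    have ell_v': "ell v' = a"
      using a by (simp add: ell)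
    \<comment> \<open>The differential of \<open>s\<close> at \<open>a *s v\<close> is division by
      \<open>a\<close> up to a multiple of \<open>v\<close>, and \<open>radial\<close> makes that
      multiple invisible to \<open>g i\<close>.\<close>
    have "fder (pullback (f i)) v' w = inverse a * fder (g i) v w" if "i < k" for i w
    proof -
      have "fder s v' w = inverse a *s w + (- (ell w / a\<^sup>2)) *s v'"
      proof -
        have "(\<lambda>w. inverse (ell v') *s w + (- (ell w / (ell v')\<^sup>2)) *s v') = fder s v'"
          using frechet_derivative_at [OF s_der [of v']] ell_v' a(1) by blast
        then show ?thesis
          unfolding ell_v' by metis
      qed
      also have "\<dots> = inverse a *s w + (- (ell w / a)) *s v"
        using a by (simp add: vec.scale_scale power2_eq_square)
      finally have "fder s v' w = inverse a *s w + (- (ell w / a)) *s v" .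
      then show ?thesis
        using holo_f(2) [OF that v'C] fder_holo_comp [OF holo_s g [OF that], of v'] C_ell [OF v'C] sv'
          clin [OF that] radial [OF that] N
        by (simp add: clin_add clin_smult del: vec.scale_minus_left)
    qed
    then have "(\<Sum>i<k. c i * fder (pullback (f i)) v' w) = inverse a * (\<Sum>i<k. c i * fder (g i) v w)" for w
      by (simp add: sum_distrib_left mult.left_commute)
    then have "\<forall>w. (\<Sum>i<k. c i * fder (g i) v w) = 0"
      using c a by simp
    then show ?thesis
      using ind i unfolding indep_funs_def by blast
  qed
  have vW': "vec.span {v} \<in> W" "k + (CARD('n) - 1 - k) + 1 = CARD('n)"
    using vW k by (auto simp: affine_cone_def)
  show "regular_point (CARD('n) - 1 - k) W (vec.span {v})"
    unfolding regular_point_def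
  proof (intro conjI exI [of _ N'] exI [of _ k] exI [of _ f] ballI allI impI)
    fix v' c i
    assume "v' \<in> affine_cone {vec.span {v}}" "\<forall>w. (\<Sum>i<k. c i * fder (pullback (f i)) v' w) = 0" "i < k"
    then show "c i = 0"
      by (rule indN')
  qed (use eqW opN' vN' holN' vW' in \<open>simp_all\<close>)
qed

definition locally_analytic :: "(complex ^ 'n) set \<Rightarrow> bool" where
  "locally_analytic A \<longleftrightarrow> (\<forall>v\<in>A. \<exists>U (l::nat) f. open U \<and> v \<in> U \<and> (\<forall>i<l. holo_on (f i) U) \<and>
     A \<inter> U = {x \<in> U. \<forall>i<l. f i x = 0})"

text \<open>\<open>exists_regular_at\<close> applied to the cone, with the local equations
  restricted to the open cone over \<open>N\<close>.\<close>

lemma regular_locus_dense: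
  assumes "locally_analytic (affine_cone W)" "W \<subseteq> proj_space" "openin proj_topology N" "W \<inter> N \<noteq> {}"
  shows "regular_locus W \<inter> N \<noteq> {}"
proof -
  obtain p where p: "p \<in> W" "p \<in> N"
    using assms(4) by blast
  then obtain v where "v \<noteq> 0" "p = vec.span {v}"
    using assms(2) by (auto simp: proj_space_def)
  with p have v: "v \<in> affine_cone W" "v \<in> affine_cone N"
    by (simp_all add: affine_cone_def)
  obtain U f and l :: nat where U: "open U" "v \<in> U" and f: "\<forall>i<l. holo_on (f i) U"
    and W: "affine_cone W \<inter> U = {x \<in> U. \<forall>i<l. f i x = 0}"
    using bspec [OF assms(1) [unfolded locally_analytic_def] v(1)] by (elim exE conjE) (rule that)
  have eq: "affine_cone W \<inter> (U \<inter> affine_cone N) = {x \<in> U \<inter> affine_cone N. \<forall>i<l. f i x = 0}"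
    using W by blast
  have op: "open (U \<inter> affine_cone N)"
    using U assms(3) by (simp add: openin_proj_topology open_Int)
  have holo: "holo_on (f i) (U \<inter> affine_cone N)" if "i < l" for i
    using holo_on_subset [of "f i" U] f that by simp
  have ne: "affine_cone W \<inter> (U \<inter> affine_cone N) \<noteq> {}"
    using U v by blast
  obtain k w where w: "w \<in> affine_cone W \<inter> (U \<inter> affine_cone N)" "regular_at k (affine_cone W) w"
    by (rule exists_regular_at [OF op _ eq ne]) (erule holo, rule that)
  have "vec.span {w} \<in> regular_locus W"
    using regular_at_imp_regular_point(2) [OF w(2)] unfolding regular_locus_def by blast
  moreover have "vec.span {w} \<in> N"
    using w(1) by (simp add: affine_cone_def)
  ultimately show ?thesis
    by blast
qed


section \<open>Irreducible analytic sets in countable unions of linear subspaces\<close>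

lemma clin_matrix_row: "clin (\<lambda>x. (A *v x) $ j)"
  by (simp add: clin_def matrix_vector_right_distrib vec.scale)

lemma closed_kernel: "closed {x. A *v x = (0 :: complex ^ 'm)}"
proof -
  have "{x. A *v x = 0} = (\<Inter>j. {x. (A *v x) $ j = 0})"
    by (auto simp: vec_eq_iff)
  moreover have "closed {x. (A *v x) $ j = 0}" for j
    by (intro closed_Collect_eq continuous_on_const holo_on_continuous clin_holo_on clin_matrix_row)
  ultimately show ?thesis
    by auto
qed

lemma subspace_kernel: "vec.subspace {x. A *v x = (0 :: complex ^ 'm)}"
  by (auto simp: vec.subspace_def matrix_vector_right_distrib vec.scale)

text \<open>Each coordinate of \<open>B *v x\<close> is holomorphic in \<open>x\<close>. The
  neighbourhood \<open>U\<close> is fixed before \<open>B\<close> and \<open>T\<close>, so it can be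
  used for all members of a countable family at once.\<close>

lemma regular_at_kernel_identity:
  assumes "regular_at k A v"
  obtains U where "open U" "v \<in> U"
    "\<And>(B :: complex ^ 'n ^ 'm) T x. open T \<Longrightarrow> A \<inter> U \<inter> T \<noteq> {} \<Longrightarrow>
       \<forall>y\<in>A \<inter> U \<inter> T. B *v y = 0 \<Longrightarrow> x \<in> A \<inter> U \<Longrightarrow> B *v x = 0"
proof -
  obtain N g where "v \<in> A" and N: "open N" "v \<in> N" and g: "\<And>i. i < k \<Longrightarrow> holo_on (g i) N"
    and A: "A \<inter> N = {x \<in> N. \<forall>i<k. g i x = 0}" and ind: "indep_funs k (\<lambda>i. fder (g i) v)"
    by (rule regular_atE [OF assms]) (rule that)
  obtain M where M: "open M" "v \<in> M" "M \<subseteq> N"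
    and id: "\<And>h T x. holo_on h M \<Longrightarrow> open T \<Longrightarrow> A \<inter> M \<inter> T \<noteq> {} \<Longrightarrow>
       \<forall>y\<in>A \<inter> M \<inter> T. h y = 0 \<Longrightarrow> x \<in> A \<inter> M \<Longrightarrow> h x = 0"
    by (rule zero_set_identity [OF N _ A ind]) (erule g, rule that)
  show ?thesis
  proof (rule that [OF M(1,2)])
    fix B :: "complex ^ 'n ^ 'm" and T x
    assume T: "open T" "A \<inter> M \<inter> T \<noteq> {}" and B: "\<forall>y\<in>A \<inter> M \<inter> T. B *v y = 0" and x: "x \<in> A \<inter> M"
    have "(B *v x) $ j = 0" for j
      by (rule id [OF clin_holo_on [OF clin_matrix_row] T _ x]) (use B in simp)
    then show "B *v x = 0"
      by (simp add: vec_eq_iff)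
  qed
qed

lemma regular_at_Baire:
  assumes reg: "regular_at k A v" and U: "open U" "v \<in> U"
    and E: "countable I" "\<And>i. i \<in> I \<Longrightarrow> closed (E i)" "A \<subseteq> (\<Union>i\<in>I. E i)"
  obtains i T where "i \<in> I" "open T" "A \<inter> U \<inter> T \<noteq> {}" "A \<inter> U \<inter> T \<subseteq> E i"
proof -
  obtain N g where v: "v \<in> A" and N: "open N" "v \<in> N" and g: "\<And>i. i < k \<Longrightarrow> holo_on (g i) N"
    and A: "A \<inter> N = {x \<in> N. \<forall>i<k. g i x = 0}" and ind: "indep_funs k (\<lambda>i. fder (g i) v)"
    by (rule regular_atE [OF reg]) (rule that)
  obtain r where r: "r > 0" "cball v r \<subseteq> U \<inter> N"
    using open_contains_cball [of "U \<inter> N"] U N by blast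
  \<comment> \<open>Baire's theorem needs a closed set. Near a regular point \<open>A\<close> is the
    zero set of continuous functions, so this closure remains inside \<open>A\<close>.\<close>
  define S where "S = closure (A \<inter> ball v r)"
  have closed: "closed (A \<inter> cball v r)"
  proof -
    have eq: "A \<inter> cball v r = cball v r \<inter> (\<Inter>i\<in>{..<k}. {x \<in> cball v r. g i x = 0})"
    proof (intro equalityI subsetI)
      fix x assume x: "x \<in> A \<inter> cball v r"
      then have "x \<in> A \<inter> N"
        using r(2) by blast
      then show "x \<in> cball v r \<inter> (\<Inter>i\<in>{..<k}. {x \<in> cball v r. g i x = 0})"
        unfolding A using x by simp
    next
      fix x assume x: "x \<in> cball v r \<inter> (\<Inter>i\<in>{..<k}. {x \<in> cball v r. g i x = 0})"
      then have "x \<in> {x \<in> N. \<forall>i<k. g i x = 0}"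
        using r(2) by auto
      then show "x \<in> A \<inter> cball v r"
        unfolding A [symmetric] using x by simp
    qed
    have "closed {x \<in> cball v r. g i x = 0}" if "i < k" for i
    proof (rule continuous_closed_preimage_constant)
      show "continuous_on (cball v r) (g i)"
        using holo_on_continuous [OF g [OF that]] continuous_on_subset r(2) by blast
    qed simp
    then show ?thesis
      unfolding eq by (intro closed_Int closed_cball closed_INT ballI) simp
  qed
  have SA: "S \<subseteq> A \<inter> cball v r"
    unfolding S_def by (intro closure_minimal closed) auto
  have vS: "v \<in> S"
    unfolding S_def using closure_subset v r(1) by fastforce
  \<comment> \<open>Otherwise the sets \<open>S - E i\<close> would be open and dense in
    \<open>S\<close>, although their intersection is empty because the \<open>E i\<close> cover
    \<open>A\<close>.\<close>
  have "\<exists>i\<in>I. \<not> S \<subseteq> closure (S - E i)"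
  proof (rule ccontr)
    assume "\<not> ?thesis"
    then have dense: "S \<subseteq> closure (S - E i)" if "i \<in> I" for i
      using that by blast
    have "S \<subseteq> closure (\<Inter>((\<lambda>i. S - E i) ` I))"
    proof (rule Baire)
      fix T assume "T \<in> (\<lambda>i. S - E i) ` I"
      then obtain i where i: "i \<in> I" "T = S - E i"
        by blast
      then show "openin (top_of_set S) T \<and> S \<subseteq> closure T"
        using dense E(2) openin_open_Int [of "- E i" S] by (simp add: open_Compl Diff_eq)
    qed (use E S_def in auto)
    moreover have "I \<noteq> {}"
      using E(3) v by blast
    then have "\<Inter>((\<lambda>i. S - E i) ` I) = {}"
      using SA E(3) by blast
    ultimately show False
      using vS by simp
  qed
  then obtain i where i: "i \<in> I" "\<not> S \<subseteq> closure (S - E i)"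
    by blast
  then obtain x where x: "x \<in> S" "x \<notin> closure (S - E i)"
    by blast
  define T where "T = ball v r - closure (S - E i)"
  \<comment> \<open>The witness \<open>x\<close> lies only in the closure of
    \<open>A \<inter> ball v r\<close>; an open set meeting the closure also meets the set.\<close>
  have "A \<inter> ball v r \<inter> - closure (S - E i) \<noteq> {}"
  proof
    assume "A \<inter> ball v r \<inter> - closure (S - E i) = {}"
    then have "- closure (S - E i) \<inter> closure (A \<inter> ball v r) = {}"
      by (subst open_Int_closure_eq_empty) auto
    then show False
      using x unfolding S_def [symmetric] by blast
  qed
  moreover have AS: "A \<inter> ball v r \<subseteq> S"
    unfolding S_def by (rule closure_subset)
  moreover have "ball v r \<subseteq> U"
    using r(2) ball_subset_cball [of v r] by blast
  ultimately have "A \<inter> U \<inter> T \<noteq> {}"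
    unfolding T_def by blast
  moreover have "A \<inter> U \<inter> T \<subseteq> E i"
    unfolding T_def using AS closure_subset [of "S - E i"] by blast
  moreover have "open T"
    unfolding T_def by (intro open_Diff) auto
  ultimately show ?thesis
    using that i(1) by blast
qed

text \<open>The set of regular points near which a given subspace contains \<open>W\<close> is open
  by construction and relatively closed by the identity principle. Baire makes it nonempty for some
  subspace, and connectedness makes it everything.\<close>

theorem irreducible_in_countable_union:
  fixes B :: "'i \<Rightarrow> complex ^ 'n ^ 'm"
  assumes W: "locally_analytic (affine_cone W)" "W \<subseteq> proj_space" "W \<noteq> {}"
    and conn: "connectedin proj_topology (regular_locus W)"
    and I: "countable I" "\<And>p. p \<in> W \<Longrightarrow> \<exists>i\<in>I. p \<subseteq> {x. B i *v x = 0}"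
  shows "\<exists>i\<in>I. \<forall>p\<in>W. p \<subseteq> {x. B i *v x = 0}"
proof -
  define E where "E i = {x. B i *v x = 0}" for i
  have sub: "vec.subspace (E i)" and closedE: "closed (E i)" for i
    unfolding E_def by (rule subspace_kernel, rule closed_kernel)
  have cone_sub: "affine_cone W \<subseteq> (\<Union>i\<in>I. E i)"
  proof
    fix x assume "x \<in> affine_cone W"
    then have "vec.span {x} \<in> W"
      by (simp add: affine_cone_def)
    then obtain i where "i \<in> I" "vec.span {x} \<subseteq> E i"
      using I(2) unfolding E_def by blast
    then show "x \<in> (\<Union>i\<in>I. E i)"
      using span_singleton_subset_iff [OF sub] by auto
  qed
  have regW: "p \<in> W" if "p \<in> regular_locus W" for p
    using that by (auto simp: regular_locus_def regular_point_def)
  \<comment> \<open>The largest open set on which \<open>W\<close> lies in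
    \<open>E i\<close>.\<close>
  define G where "G i = \<Union>{N. openin proj_topology N \<and> (\<forall>p\<in>W \<inter> N. p \<subseteq> E i)}" for i
  have openG: "openin proj_topology (G i)" for i
    unfolding G_def by (intro openin_Union) auto
  have GE: "p \<subseteq> E i" if "p \<in> W" "p \<in> G i" for p i
    using that unfolding G_def by blast
  have local: "\<exists>U. open U \<and> v \<in> U \<and>
      (\<forall>i T. open T \<longrightarrow> affine_cone W \<inter> U \<inter> T \<noteq> {} \<longrightarrow> affine_cone W \<inter> U \<inter> T \<subseteq> E i \<longrightarrow> affine_cone W \<inter> U \<subseteq> E i) \<and>
      (\<exists>i\<in>I. affine_cone W \<inter> U \<subseteq> E i)"
    if v: "v \<noteq> 0" "vec.span {v} \<in> regular_locus W" for v
  proof -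
    obtain d where "regular_point d W (vec.span {v})"
      using v by (auto simp: regular_locus_def)
    then obtain k where reg: "regular_at k (affine_cone W) v"
      using regular_point_imp_regular_at [OF _ v(1) refl] by blast
    obtain U where U: "open U" "v \<in> U"
      and id: "\<And>(B :: complex ^ 'n ^ 'm) T x. open T \<Longrightarrow> affine_cone W \<inter> U \<inter> T \<noteq> {} \<Longrightarrow>
       \<forall>y\<in>affine_cone W \<inter> U \<inter> T. B *v y = 0 \<Longrightarrow> x \<in> affine_cone W \<inter> U \<Longrightarrow> B *v x = 0"
      by (rule regular_at_kernel_identity [OF reg]) (rule that)
    have id': "affine_cone W \<inter> U \<subseteq> E i"
      if T: "open T" "affine_cone W \<inter> U \<inter> T \<noteq> {}" "affine_cone W \<inter> U \<inter> T \<subseteq> E i" for i T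
    proof
      fix x assume "x \<in> affine_cone W \<inter> U"
      then have "B i *v x = 0"
        by (rule id [OF T(1,2), rotated]) (use T(3) in \<open>auto simp: E_def\<close>)
      then show "x \<in> E i"
        by (simp add: E_def)
    qed
    obtain i T where i: "i \<in> I" and T: "open T" "affine_cone W \<inter> U \<inter> T \<noteq> {}" "affine_cone W \<inter> U \<inter> T \<subseteq> E i"
      by (rule regular_at_Baire [OF reg U I(1) closedE cone_sub]) (rule that)
    show ?thesis
    proof (intro exI [of _ U] conjI allI impI)
      show "\<exists>i\<in>I. affine_cone W \<inter> U \<subseteq> E i"
        using id' [OF T] i by blast
    qed (use U id' in blast)+
  qed
  have nbhd: "openin proj_topology ((\<lambda>v. vec.span {v}) ` (U - {0}))"
    "vec.span {v} \<in> (\<lambda>v. vec.span {v}) ` (U - {0})" if "open U" "v \<in> U" "v \<noteq> 0" for U and v :: "complex ^ 'n"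
    using openin_proj_image that by auto
  have inG: "vec.span {v} \<in> G i"
    if "open U" "v \<in> U" "v \<noteq> 0" "affine_cone W \<inter> U \<subseteq> E i" for U v i
  proof -
    have "p \<subseteq> E i" if "p \<in> W \<inter> (\<lambda>v. vec.span {v}) ` (U - {0})" for p
    proof -
      obtain x where x: "x \<in> U" "x \<noteq> 0" "p = vec.span {x}" "p \<in> W"
        using \<open>p \<in> W \<inter> _\<close> by blast
      then have "x \<in> affine_cone W \<inter> U"
        by (simp add: affine_cone_def)
      then show ?thesis
        using span_singleton_subset_iff [OF sub] \<open>affine_cone W \<inter> U \<subseteq> E i\<close> x(3) by blast
    qed
    then show ?thesis
      unfolding G_def using nbhd [OF that(1-3)] by blast
  qed
  have gen: "\<exists>v. v \<noteq> 0 \<and> p = vec.span {v}" if "p \<in> W" for p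
    using W(2) that by (auto simp: proj_space_def)
  obtain p0 where p0: "p0 \<in> regular_locus W"
  proof -
    have "openin proj_topology (proj_space :: (complex ^ 'n) set set)"
      using openin_topspace [of proj_topology] topspace_proj_topology by metis
    then have "regular_locus W \<inter> proj_space \<noteq> {}"
      by (rule regular_locus_dense [OF W(1,2)]) (use W(2,3) in blast)
    then show ?thesis
      using that by blast
  qed
  obtain v0 where v0: "v0 \<noteq> 0" "p0 = vec.span {v0}"
    using gen regW [OF p0] by blast
  obtain U0 i where i: "i \<in> I" "open U0" "v0 \<in> U0" "affine_cone W \<inter> U0 \<subseteq> E i"
    using local [of v0] v0 p0 by blast
  have p0G: "p0 \<in> G i"
    using inG [OF i(2,3) v0(1) i(4)] v0(2) by simp
  \<comment> \<open>The exterior of \<open>G i \<inter> W\<close>; with \<open>G i\<close> it will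
    separate the regular locus.\<close>
  define G' where "G' = \<Union>{N. openin proj_topology N \<and> N \<inter> G i \<inter> W = {}}"
  have openG': "openin proj_topology G'"
    unfolding G'_def by (intro openin_Union) auto
  \<comment> \<open>No regular point lies on the boundary: if its neighbourhood meets
    \<open>G i\<close> inside \<open>W\<close>, the identity principle puts the whole piece of
    \<open>W\<close> into \<open>E i\<close>.\<close>
  have cover: "p \<in> G i \<union> G'" if p: "p \<in> regular_locus W" for p
  proof -
    obtain v where v: "v \<noteq> 0" "p = vec.span {v}"
      using gen regW [OF p] by blast
    obtain U where U: "open U" "v \<in> U"
      and id: "\<And>i T. open T \<Longrightarrow> affine_cone W \<inter> U \<inter> T \<noteq> {} \<Longrightarrow> affine_cone W \<inter> U \<inter> T \<subseteq> E i \<Longrightarrow> affine_cone W \<inter> U \<subseteq> E i"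
      using local [of v] v p by blast
    let ?N = "(\<lambda>v. vec.span {v}) ` (U - {0})"
    show ?thesis
    proof (cases "?N \<inter> G i \<inter> W = {}")
      case True
      then have "p \<in> G'"
        unfolding G'_def using nbhd [OF U v(1)] v(2) by blast
      then show ?thesis ..
    next
      case False
      then obtain x where x: "x \<in> U" "x \<noteq> 0" "vec.span {x} \<in> G i" "vec.span {x} \<in> W"
        by blast
      have "open (affine_cone (G i))"
        using openG by (simp add: openin_proj_topology)
      moreover have "x \<in> affine_cone W \<inter> U \<inter> affine_cone (G i)"
        using x by (simp add: affine_cone_def)
      moreover have "affine_cone W \<inter> U \<inter> affine_cone (G i) \<subseteq> E i"
      proof
        fix y assume "y \<in> affine_cone W \<inter> U \<inter> affine_cone (G i)"
        then have "vec.span {y} \<subseteq> E i"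
          by (intro GE) (simp_all add: affine_cone_def)
        then show "y \<in> E i"
          using span_singleton_subset_iff [OF sub] by blast
      qed
      ultimately have "affine_cone W \<inter> U \<subseteq> E i"
        by (intro id) auto
      then have "p \<in> G i"
        using inG [OF U v(1)] v(2) by simp
      then show ?thesis ..
    qed
  qed
  have disj: "G i \<inter> G' \<inter> regular_locus W = {}"
    using regW unfolding G'_def by blast
  have regG: "regular_locus W \<subseteq> G i"
  proof (rule ccontr)
    assume "\<not> regular_locus W \<subseteq> G i"
    then have "G' \<inter> regular_locus W \<noteq> {}"
      using cover by blast
    moreover have "G i \<inter> regular_locus W \<noteq> {}"
      using p0 p0G by blast
    moreover have "regular_locus W \<subseteq> G i \<union> G'"
      using cover by blast
    ultimately show False
      using conn openG openG' disj unfolding connectedin by blast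
  qed
  \<comment> \<open>Singular points follow from density of the regular ones, as the complement of
    \<open>E i\<close> is open.\<close>
  have "p \<subseteq> E i" if p: "p \<in> W" for p
  proof (rule ccontr)
    assume "\<not> p \<subseteq> E i"
    obtain v where v: "v \<noteq> 0" "p = vec.span {v}"
      using gen p by blast
    with \<open>\<not> p \<subseteq> E i\<close> have "v \<in> - E i"
      using span_singleton_subset_iff [OF sub] by blast
    moreover have "open (- E i)"
      using closedE by (simp add: open_Compl)
    ultimately have "openin proj_topology ((\<lambda>v. vec.span {v}) ` (- E i - {0}))"
      "p \<in> (\<lambda>v. vec.span {v}) ` (- E i - {0})"
      using nbhd v by auto
    then obtain q where q: "q \<in> regular_locus W" "q \<in> (\<lambda>v. vec.span {v}) ` (- E i - {0})"
      using regular_locus_dense [OF W(1,2)] p by blast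
    then have "q \<subseteq> E i"
      using GE regG regW by blast
    then show False
      using q(2) span_singleton_subset_iff [OF sub] by blast
  qed
  then show ?thesis
    using i(1) unfolding E_def by blast
qed


section \<open>Forms, period domains and Hodge structures\<close>

lemma form_add_left: "form G (x + y) w = form G x w + form G y w"
  by (simp add: form_def sum.distrib algebra_simps)

lemma form_add_right: "form G w (x + y) = form G w x + form G w y"
  by (simp add: form_def sum.distrib algebra_simps)

lemma form_smult_left: "form G (c *s x) w = c * form G x w"
  by (simp add: form_def sum_distrib_left algebra_simps)

lemma form_smult_right: "form G w (c *s x) = c * form G w x"
  by (simp add: form_def sum_distrib_left algebra_simps)

lemma form_diff_left: "form G (x - y) w = form G x w - form G y w"
  by (simp add: form_def sum_subtractf algebra_simps)

lemma form_zero_left [simp]: "form G 0 w = 0" and form_zero_right [simp]: "form G w 0 = 0"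
  by (simp_all add: form_def)

lemma form_sym:
  assumes "\<And>i j. G $ i $ j = G $ j $ i"
  shows "form G x y = form G y x"
  unfolding form_def by (subst sum.swap) (simp add: assms [symmetric] mult_ac)

lemma vcnj_vcnj [simp]: "vcnj (vcnj v) = v"
  by (simp add: vcnj_def vec_eq_iff)

lemma vcnj_smult: "vcnj (c *s v) = cnj c *s vcnj v"
  by (simp add: vcnj_def vec_eq_iff)

lemma vcnj_add: "vcnj (v + w) = vcnj v + vcnj w"
  by (simp add: vcnj_def vec_eq_iff)

lemma vcnj_real_to_complex [simp]: "vcnj (real_to_complex v) = real_to_complex v"
  by (simp add: vcnj_def real_to_complex_def vec_eq_iff)

lemma form_vcnj: "form G (vcnj x) (vcnj y) = cnj (form G x y)"
  by (simp add: form_def vcnj_def)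

lemma form_real_to_complex: "form G (real_to_complex v) (real_to_complex w) = complex_of_real (form G v w)"
  by (simp add: form_def real_to_complex_def)

lemma has_derivative_form_diag:
  "((\<lambda>x :: complex ^ 'n. form G x x) has_derivative (\<lambda>w. form G x w + form G w x)) (at x)"
proof -
  have "((\<lambda>x :: complex ^ 'n. x $ i) has_derivative (\<lambda>w. w $ i)) (at x)" for i
    by (intro bounded_linear_imp_has_derivative bounded_linear_vec_nth)
  then have "((\<lambda>x :: complex ^ 'n. of_int (G $ i $ j) * x $ i * x $ j) has_derivative
      (\<lambda>w. of_int (G $ i $ j) * x $ i * w $ j + of_int (G $ i $ j) * w $ i * x $ j)) (at x)" for i j
    by (intro has_derivative_mult has_derivative_mult_right)
  then show ?thesis
    unfolding form_def sum.distrib [symmetric] by (intro has_derivative_sum)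
qed

lemma holo_on_form_diag:
  fixes S :: "(complex ^ 'n) set"
  shows "holo_on (\<lambda>x. form G x x) S"
  unfolding holo_on_def
proof
  fix v :: "complex ^ 'n"
  show "\<exists>D. ((\<lambda>x. form G x x) has_derivative D) (at v) \<and> (\<forall>c w. D (c *s w) = c * D w)"
    using has_derivative_form_diag [of G v]
    by (intro exI [of _ "\<lambda>w. form G v w + form G w v"] conjI)
      (simp_all add: form_smult_left form_smult_right distrib_left)
qed

lemma open_form_pos: "open {v. Re (form G v (vcnj v)) > 0}"
  unfolding form_def vcnj_def
  by (intro open_Collect_less continuous_intros continuous_on_Re)

text \<open>The conditions do not depend on the representative: scaling by \<open>c\<close>
  multiplies the two values by \<open>c^2\<close> and by \<open>|c|^2\<close>.\<close>

lemma span_in_period_domain: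
  "vec.span {v} \<in> period_domain G \<longleftrightarrow> form G v v = 0 \<and> Re (form G v (vcnj v)) > 0"
proof
  assume "vec.span {v} \<in> period_domain G"
  then obtain w where w: "vec.span {v} = vec.span {w}" "form G w w = 0" "Re (form G w (vcnj w)) > 0"
    by (auto simp: period_domain_def)
  then have "w \<noteq> 0"
    by auto
  then obtain c where c: "c \<noteq> 0" "w = c *s v"
    by (rule span_singleton_eqD [OF w(1) [symmetric]])
  have "form G w w = c * c * form G v v" "form G w (vcnj w) = c * cnj c * form G v (vcnj v)"
    by (simp_all add: c(2) vcnj_smult form_smult_left form_smult_right)
  moreover have "Re (c * cnj c * form G v (vcnj v)) = (cmod c)\<^sup>2 * Re (form G v (vcnj v))"
    unfolding complex_norm_square [symmetric] by simp
  ultimately have "form G v v = 0" "(cmod c)\<^sup>2 * Re (form G v (vcnj v)) > 0"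
    using w(2,3) c(1) by (simp, metis)
  then show "form G v v = 0 \<and> Re (form G v (vcnj v)) > 0"
    by (simp add: zero_less_mult_iff)
qed (auto simp: period_domain_def)

lemma period_domain_subset_proj_space: "period_domain G \<subseteq> proj_space"
proof
  fix p assume "p \<in> period_domain G"
  then obtain v where v: "p = vec.span {v}" "Re (form G v (vcnj v)) > 0"
    by (auto simp: period_domain_def)
  then have "v \<noteq> 0"
    by auto
  then show "p \<in> proj_space"
    using v by (auto simp: proj_space_def)
qed

text \<open>The period domain is not open in projective space. Its positivity condition is absorbed
  into the open set \<open>U\<close>, and isotropy becomes one more equation.\<close>

lemma locally_analytic_period_domain:
  assumes "analytic_subset (period_domain G) W"
  shows "locally_analytic (affine_cone W)"
  unfolding locally_analytic_def
proof
  fix v assume v: "v \<in> affine_cone W"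
  have sub: "W \<subseteq> period_domain G"
    using assms by (simp add: analytic_subset_def)
  have "vec.span {v} \<in> period_domain G"
    using v sub by (auto simp: affine_cone_def)
  from bspec [OF conjunct2 [OF assms [unfolded analytic_subset_def]] this]
  obtain N f and k :: nat where N: "openin proj_topology N" "vec.span {v} \<in> N"
    and f: "\<forall>i<k. proj_holomorphic_on (f i) N"
    and W: "W \<inter> N = {x \<in> period_domain G \<inter> N. \<forall>i<k. f i x = 0}"
    by (elim exE conjE) (rule that)
  define U where "U = affine_cone N \<inter> {v. Re (form G v (vcnj v)) > 0}"
  \<comment> \<open>The quadric has index \<open>k\<close>, hence \<open>Suc k\<close> equations
    below.\<close>
  define g where "g i = (if i < k then pullback (f i) else (\<lambda>x. form G x x))" for i
  have "open U"
    using N open_form_pos by (auto simp: U_def openin_proj_topology)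
  moreover have "v \<in> U"
    using v N \<open>vec.span {v} \<in> period_domain G\<close> by (simp add: U_def affine_cone_def span_in_period_domain)
  moreover have "holo_on (g i) U" for i
  proof (cases "i < k")
    case True
    then have "holo_on (pullback (f i)) (affine_cone N)"
      using f by (simp add: holo_on_def proj_holomorphic_on_def)
    with True show ?thesis
      using holo_on_subset [of "pullback (f i)" "affine_cone N" U] by (simp add: g_def U_def)
  qed (simp add: g_def holo_on_form_diag)
  moreover have "x \<in> affine_cone W \<longleftrightarrow> (\<forall>i<Suc k. g i x = 0)" if x: "x \<in> U" for x
  proof -
    have "x \<in> affine_cone W \<longleftrightarrow> vec.span {x} \<in> W \<inter> N"
      using x by (auto simp: affine_cone_def U_def)
    also have "\<dots> \<longleftrightarrow> form G x x = 0 \<and> (\<forall>i<k. pullback (f i) x = 0)"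
      unfolding W using x by (auto simp: U_def affine_cone_def span_in_period_domain pullback_def)
    also have "\<dots> \<longleftrightarrow> (\<forall>i<Suc k. g i x = 0)"
      by (auto simp: g_def less_Suc_eq)
    finally show ?thesis .
  qed
  then have "affine_cone W \<inter> U = {x \<in> U. \<forall>i<Suc k. g i x = 0}"
    by blast
  ultimately show "\<exists>U (l::nat) f. open U \<and> v \<in> U \<and> (\<forall>i<l. holo_on (f i) U) \<and>
     affine_cone W \<inter> U = {x \<in> U. \<forall>i<l. f i x = 0}"
    by (intro exI [of _ U] exI [of _ "Suc k"] exI [of _ g] conjI allI impI)
qed

section \<open>The Hodge structure of K3 type with a given period\<close>

definition hodge_of :: "int ^ 'n ^ 'n \<Rightarrow> complex ^ 'n \<Rightarrow> int \<Rightarrow> int \<Rightarrow> (complex ^ 'n) set" where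
  "hodge_of G \<omega> a b =
     (if a = 2 \<and> b = 0 then vec.span {\<omega>} else if a = 0 \<and> b = 2 then vec.span {vcnj \<omega>}
      else if a = 1 \<and> b = 1 then {x. form G x \<omega> = 0 \<and> form G x (vcnj \<omega>) = 0} else {0})"

lemma hodge_of_simps [simp]:
  "hodge_of G \<omega> 2 0 = vec.span {\<omega>}" "hodge_of G \<omega> 0 2 = vec.span {vcnj \<omega>}"
  "hodge_of G \<omega> 1 1 = {x. form G x \<omega> = 0 \<and> form G x (vcnj \<omega>) = 0}"
  by (simp_all add: hodge_of_def)

lemma hodge_of_cases:
  assumes "x \<in> hodge_of G \<omega> a b"
  obtains c where "a = 2" "b = 0" "x = c *s \<omega>" | c where "a = 0" "b = 2" "x = c *s vcnj \<omega>"
    | "a = 1" "b = 1" "form G x \<omega> = 0" "form G x (vcnj \<omega>) = 0" | "x = 0"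
  using assms by (auto simp: hodge_of_def span_singleton_vec split: if_splits)

context
  fixes G :: "int ^ 'n ^ 'n" and \<omega> :: "complex ^ 'n"
  assumes sym: "\<And>i j. G $ i $ j = G $ j $ i"
    and isotropic: "form G \<omega> \<omega> = 0" and positive: "Re (form G \<omega> (vcnj \<omega>)) > 0"
begin

lemma form_omega:
  "form G (vcnj \<omega>) (vcnj \<omega>) = 0" "form G \<omega> (vcnj \<omega>) \<noteq> 0"
  "form G (vcnj \<omega>) \<omega> = form G \<omega> (vcnj \<omega>)" "cnj (form G \<omega> (vcnj \<omega>)) = form G \<omega> (vcnj \<omega>)"
proof -
  show "form G (vcnj \<omega>) (vcnj \<omega>) = 0"
    by (simp add: form_vcnj isotropic)
  show "form G \<omega> (vcnj \<omega>) \<noteq> 0"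
    using positive by auto
  show *: "form G (vcnj \<omega>) \<omega> = form G \<omega> (vcnj \<omega>)"
    by (rule form_sym [OF sym])
  show "cnj (form G \<omega> (vcnj \<omega>)) = form G \<omega> (vcnj \<omega>)"
    using form_vcnj [of G \<omega> "vcnj \<omega>"] * by simp
qed

text \<open>The type (1, 1) part is the orthogonal complement of the other two, so pairing with
  \<open>\<omega>\<close> and its conjugate reads off the outer components of a vector; the
  denominator is \<open>form G \<omega> (vcnj \<omega>)\<close>, nonzero by positivity.\<close>

lemma hodge_structure_hodge_of: "hodge_structure 2 (hodge_of G \<omega>)"
  unfolding hodge_structure_def
proof (intro conjI allI impI)
  let ?c = "form G \<omega> (vcnj \<omega>)"
  show "vec.subspace (hodge_of G \<omega> a b)" for a b
    by (auto simp: hodge_of_def vec.subspace_def form_add_left form_smult_left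
        vec.span_zero vec.span_add vec.span_scale)
  show "hodge_of G \<omega> a b = {0}" if "a + b \<noteq> 2" for a b
    using that by (auto simp: hodge_of_def)
  have sum: "(\<Sum>a | f a \<noteq> 0. f a) = f 0 + f 1 + f 2" if "\<And>a. f a \<in> hodge_of G \<omega> a (2 - a)" for f
  proof -
    have "f a = 0" if "a \<notin> {0, 1, 2}" for a
      using \<open>\<And>a. f a \<in> hodge_of G \<omega> a (2 - a)\<close> [of a] that by (simp add: hodge_of_def)
    then have "(\<Sum>a | f a \<noteq> 0. f a) = sum f {0, 1, 2}"
      by (intro sum.mono_neutral_cong_left) auto
    then show ?thesis
      by (simp add: add.assoc)
  qed
  have coeffs: "f 2 = (form G v (vcnj \<omega>) / ?c) *s \<omega>" "f 0 = (form G v \<omega> / ?c) *s vcnj \<omega>"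
    "f 1 = v - f 2 - f 0" "a \<notin> {0, 1, 2} \<Longrightarrow> f a = 0"
    if f: "\<And>a. f a \<in> hodge_of G \<omega> a (2 - a)" "v = f 0 + f 1 + f 2" for f v a
  proof -
    obtain \<alpha> \<beta> where \<alpha>: "f 2 = \<alpha> *s \<omega>" and \<beta>: "f 0 = \<beta> *s vcnj \<omega>"
      using f(1) [of 2] f(1) [of 0] by (auto simp: span_singleton_vec)
    have f1: "form G (f 1) \<omega> = 0" "form G (f 1) (vcnj \<omega>) = 0"
      using f(1) [of 1] by auto
    have "form G v (vcnj \<omega>) = \<alpha> * ?c" "form G v \<omega> = \<beta> * ?c"
      unfolding f(2) \<alpha> \<beta> by (simp_all add: form_add_left form_smult_left f1 form_omega isotropic)
    then show "f 2 = (form G v (vcnj \<omega>) / ?c) *s \<omega>" "f 0 = (form G v \<omega> / ?c) *s vcnj \<omega>"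
      using form_omega(2) \<alpha> \<beta> by simp_all
    show "f 1 = v - f 2 - f 0"
      using f(2) by simp
    show "a \<notin> {0, 1, 2} \<Longrightarrow> f a = 0"
      using f(1) [of a] by (simp add: hodge_of_def)
  qed
  fix v
  define \<alpha> where "\<alpha> = form G v (vcnj \<omega>) / ?c"
  define \<beta> where "\<beta> = form G v \<omega> / ?c"
  define h where "h a = (if a = 2 then \<alpha> *s \<omega> else if a = 0 then \<beta> *s vcnj \<omega>
     else if a = 1 then v - \<alpha> *s \<omega> - \<beta> *s vcnj \<omega> else 0)" for a :: int
  show "\<exists>!f. (\<forall>a. f a \<in> hodge_of G \<omega> a (2 - a)) \<and> finite {a. f a \<noteq> 0} \<and> v = (\<Sum>a | f a \<noteq> 0. f a)"
  proof (rule ex1I [of _ h])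
    have h: "h a \<in> hodge_of G \<omega> a (2 - a)" for a
      using form_omega(2)
      by (auto simp: h_def hodge_of_def vec.span_base vec.span_scale form_diff_left form_smult_left
          isotropic form_omega \<alpha>_def \<beta>_def)
    moreover have "finite {a. h a \<noteq> 0}"
      by (rule finite_subset [of _ "{0, 1, 2}"]) (auto simp: h_def split: if_splits)
    moreover have "v = (\<Sum>a | h a \<noteq> 0. h a)"
      unfolding sum [OF h] by (simp add: h_def)
    ultimately show "(\<forall>a. h a \<in> hodge_of G \<omega> a (2 - a)) \<and> finite {a. h a \<noteq> 0} \<and> v = (\<Sum>a | h a \<noteq> 0. h a)"
      by blast
  next
    fix f assume f: "(\<forall>a. f a \<in> hodge_of G \<omega> a (2 - a)) \<and> finite {a. f a \<noteq> 0} \<and> v = (\<Sum>a | f a \<noteq> 0. f a)"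
    then have f': "\<And>a. f a \<in> hodge_of G \<omega> a (2 - a)" and v: "v = f 0 + f 1 + f 2"
      using sum [of f] by auto
    note c = coeffs [OF f' v]
    show "f = h"
    proof
      fix a
      show "f a = h a"
        using c(1,2,3) c(4) [of a] by (simp add: h_def \<alpha>_def \<beta>_def)
    qed
  qed
next
  fix a b :: int
  have inv: "vcnj ` S = T" if "\<And>x. x \<in> S \<Longrightarrow> vcnj x \<in> T" "\<And>x. x \<in> T \<Longrightarrow> vcnj x \<in> S"
    for S T :: "(complex ^ 'n) set"
    using that by (force intro: image_eqI [of _ _ "vcnj x" for x])
  have "form G (vcnj x) \<omega> = cnj (form G x (vcnj \<omega>))" "form G (vcnj x) (vcnj \<omega>) = cnj (form G x \<omega>)" for x
    using form_vcnj [of G x "vcnj \<omega>"] form_vcnj [of G x \<omega>] by simp_all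
  note form_vcnj_omega = this
  have vcnj_0: "vcnj 0 = (0 :: complex ^ 'n)"
    by (simp add: vcnj_def vec_eq_iff)
  have "vcnj x \<in> hodge_of G \<omega> b a" if "x \<in> hodge_of G \<omega> a b" for x a b
    using that
    by (cases rule: hodge_of_cases)
      (auto simp: vcnj_smult vcnj_0 vec.span_base vec.span_scale hodge_of_def vec.span_zero form_vcnj_omega)
  then show "vcnj ` hodge_of G \<omega> a b = hodge_of G \<omega> b a"
    by (intro inv)
qed

lemma K3_type_hodge_of: "K3_type G (hodge_of G \<omega>)"
  unfolding K3_type_def
proof (intro conjI allI impI ballI)
  show "hodge_structure 2 (hodge_of G \<omega>)"
    by (rule hodge_structure_hodge_of)
  have "\<omega> \<noteq> 0"
    using positive by auto
  then have "vec.independent {\<omega>}"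
    by simp
  then show "vec.dim (hodge_of G \<omega> 2 0) = 1"
    using vec.dim_span_eq_card_independent by fastforce
  show "hodge_of G \<omega> a b = {0}" if "\<bar>a - b\<bar> > 2" for a b
    using that by (auto simp: hodge_of_def)
  show "form G x y = 0" if "(a + c, b + d) \<noteq> (2, 2)" and x: "x \<in> hodge_of G \<omega> a b" and y: "y \<in> hodge_of G \<omega> c d"
    for a b c d x y
    using x
  proof (cases rule: hodge_of_cases)
    case (1 s)
    from y show ?thesis
      by (cases rule: hodge_of_cases)
        (use 1 that(1) form_sym [OF sym, of \<omega> y] in \<open>simp_all add: form_smult_left form_smult_right isotropic\<close>)
  next
    case (2 s)
    from y show ?thesis
      by (cases rule: hodge_of_cases)
        (use 2 that(1) form_sym [OF sym, of "vcnj \<omega>" y] in \<open>simp_all add: form_smult_left form_smult_right form_omega\<close>)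
  next
    case 3
    from y show ?thesis
      by (cases rule: hodge_of_cases)
        (use 3 that(1) in \<open>simp_all add: form_smult_left form_smult_right\<close>)
  qed simp
  fix v :: "real ^ 'n"
  assume "v \<noteq> 0" and "\<exists>x\<in>hodge_of G \<omega> 2 0. \<exists>y\<in>hodge_of G \<omega> 0 2. real_to_complex v = x + y"
  then obtain a b where v: "real_to_complex v = a *s \<omega> + b *s vcnj \<omega>"
    by (auto simp: span_singleton_vec)
  let ?c = "form G \<omega> (vcnj \<omega>)"
  have "vcnj (real_to_complex v) = cnj b *s \<omega> + cnj a *s vcnj \<omega>"
    unfolding v by (simp add: vcnj_add vcnj_smult add.commute)
  then have v': "real_to_complex v = cnj b *s \<omega> + cnj a *s vcnj \<omega>"
    by simp
  \<comment> \<open>A real vector equals its own conjugate; comparing the coefficients of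
    \<open>\<omega>\<close> in the two expressions forces \<open>b = cnj a\<close>.\<close>
  have "a * ?c = form G (real_to_complex v) (vcnj \<omega>)"
    unfolding v by (simp add: form_add_left form_smult_left form_omega)
  also have "\<dots> = cnj b * ?c"
    unfolding v' by (simp add: form_add_left form_smult_left form_omega)
  finally have b: "b = cnj a"
    using form_omega(2) by auto
  have "a \<noteq> 0"
  proof
    assume "a = 0"
    then have "real_to_complex v = 0"
      using v b by simp
    then show False
      using \<open>v \<noteq> 0\<close> by (simp add: real_to_complex_def vec_eq_iff)
  qed
  have "complex_of_real (form G v v) = form G (real_to_complex v) (real_to_complex v)"
    by (rule form_real_to_complex [symmetric])
  also have "\<dots> = 2 * (a * cnj a) * ?c"
    unfolding v b by (simp add: form_add_left form_smult_left form_add_right form_smult_right form_omega isotropic)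
  also have "\<dots> = of_real (2 * (cmod a)\<^sup>2) * ?c"
    unfolding complex_norm_square [symmetric] by simp
  finally have "form G v v = Re (of_real (2 * (cmod a)\<^sup>2) * ?c)"
    by (metis Re_complex_of_real)
  then have "form G v v = 2 * (cmod a)\<^sup>2 * Re ?c"
    by simp
  then show "form G v v > 0"
    using positive \<open>a \<noteq> 0\<close> by simp
qed

end


section \<open>The lattice and a self-adjoint similarity\<close>

type_synonym idx8 = "(2 + 2) + (2 + 2)"

abbreviation (input) "i1 \<equiv> Inl (Inl 1) :: idx8"
abbreviation (input) "i2 \<equiv> Inl (Inl 2) :: idx8"
abbreviation (input) "i3 \<equiv> Inl (Inr 1) :: idx8"
abbreviation (input) "i4 \<equiv> Inl (Inr 2) :: idx8"
abbreviation (input) "i5 \<equiv> Inr (Inl 1) :: idx8"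
abbreviation (input) "i6 \<equiv> Inr (Inl 2) :: idx8"
abbreviation (input) "i7 \<equiv> Inr (Inr 1) :: idx8"
abbreviation (input) "i8 \<equiv> Inr (Inr 2) :: idx8"

lemma forall_idx8: "(\<forall>i :: idx8. P i) \<longleftrightarrow> P i1 \<and> P i2 \<and> P i3 \<and> P i4 \<and> P i5 \<and> P i6 \<and> P i7 \<and> P i8"
  by (simp add: split_sum_all forall_2)

lemma sum_idx8: "sum f (UNIV :: idx8 set) = f i1 + f i2 + f i3 + f i4 + f i5 + f i6 + f i7 + f i8"
  by (simp add: UNIV_Plus_UNIV [symmetric] sum.Plus sum_2 add.assoc del: UNIV_Plus_UNIV)

definition mk8 :: "'a \<Rightarrow> 'a \<Rightarrow> 'a \<Rightarrow> 'a \<Rightarrow> 'a \<Rightarrow> 'a \<Rightarrow> 'a \<Rightarrow> 'a \<Rightarrow> 'a ^ idx8" where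
  "mk8 a1 a2 a3 a4 a5 a6 a7 a8 = (\<chi> i. case i of
      Inl j \<Rightarrow> (case j of Inl k \<Rightarrow> if k = 1 then a1 else a2 | Inr k \<Rightarrow> if k = 1 then a3 else a4)
    | Inr j \<Rightarrow> (case j of Inl k \<Rightarrow> if k = 1 then a5 else a6 | Inr k \<Rightarrow> if k = 1 then a7 else a8))"

lemma mk8_nth [simp]:
  "mk8 a1 a2 a3 a4 a5 a6 a7 a8 $ i1 = a1" "mk8 a1 a2 a3 a4 a5 a6 a7 a8 $ i2 = a2"
  "mk8 a1 a2 a3 a4 a5 a6 a7 a8 $ i3 = a3" "mk8 a1 a2 a3 a4 a5 a6 a7 a8 $ i4 = a4"
  "mk8 a1 a2 a3 a4 a5 a6 a7 a8 $ i5 = a5" "mk8 a1 a2 a3 a4 a5 a6 a7 a8 $ i6 = a6"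
  "mk8 a1 a2 a3 a4 a5 a6 a7 a8 $ i7 = a7" "mk8 a1 a2 a3 a4 a5 a6 a7 a8 $ i8 = a8"
  by (simp_all add: mk8_def)

lemma vec8_eq_iff: "v = w \<longleftrightarrow> v $ i1 = w $ i1 \<and> v $ i2 = w $ i2 \<and> v $ i3 = w $ i3 \<and> v $ i4 = w $ i4 \<and>
    v $ i5 = w $ i5 \<and> v $ i6 = w $ i6 \<and> v $ i7 = w $ i7 \<and> v $ i8 = w $ i8"
  unfolding vec_eq_iff by (rule forall_idx8)

lemma form_Gamma:
  "form Gamma_lat v w = v $ i1 * w $ i2 + v $ i2 * w $ i1 + v $ i3 * w $ i4 + v $ i4 * w $ i3
     - 2 * v $ i5 * w $ i5 + v $ i5 * w $ i6 + v $ i6 * w $ i5 - 2 * v $ i6 * w $ i6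
     - 2 * v $ i7 * w $ i7 + v $ i7 * w $ i8 + v $ i8 * w $ i7 - 2 * v $ i8 * w $ i8"
  by (simp add: form_def sum_idx8 Gamma_lat_def orth_sum_def U_lat_def A2_lat_def vector_2)

lemma Gamma_sym: "Gamma_lat $ i $ j = Gamma_lat $ j $ i"
proof -
  have "\<forall>i j. Gamma_lat $ i $ j = Gamma_lat $ j $ i"
    by (simp add: forall_idx8 Gamma_lat_def orth_sum_def U_lat_def A2_lat_def vector_2)
  then show ?thesis
    by blast
qed

lemma form_Gamma_nondegenerate:
  fixes v :: "'a :: field_char_0 ^ idx8"
  assumes "\<And>w. form Gamma_lat v w = 0"
  shows "v = 0"
proof -
  have "v $ i1 = 0" "v $ i2 = 0" "v $ i3 = 0" "v $ i4 = 0"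
    using assms [of "axis i1 1"] assms [of "axis i2 1"] assms [of "axis i3 1"] assms [of "axis i4 1"]
    by (simp_all add: form_Gamma axis_def)
  moreover have e: "v $ i6 = 2 * v $ i5" "v $ i5 = 2 * v $ i6" "v $ i8 = 2 * v $ i7" "v $ i7 = 2 * v $ i8"
    using assms [of "axis i5 1"] assms [of "axis i6 1"] assms [of "axis i7 1"] assms [of "axis i8 1"]
    by (simp_all add: form_Gamma axis_def algebra_simps)
  then have "3 * v $ i5 = 0" "3 * v $ i7 = 0"
    by (simp_all add: algebra_simps)
  ultimately show ?thesis
    using e(1,3) by (simp add: vec8_eq_iff)
qed

text \<open>On each copy of \<open>U\<close> this is multiplication by \<open>sqrt 3\<close> for the trace form
  \<open>Tr (sqrt 3 * x * y) / 6\<close> on the field generated by \<open>sqrt 3\<close>. On the two copies of \<open>A\<^sub>2\<close> it is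
  \<open>(x, y) \<mapsto> (- T y, T x)\<close>, where \<open>T\<close> is multiplication by the square root of \<open>-3\<close> in the
  Eisenstein integers.\<close>

definition psi0 :: "'a::comm_ring_1 ^ idx8 \<Rightarrow> 'a ^ idx8" where
  "psi0 v = mk8 (3 * v $ i2) (v $ i1) (3 * v $ i4) (v $ i3)
     (2 * v $ i8 - v $ i7) (v $ i8 - 2 * v $ i7) (v $ i5 - 2 * v $ i6) (2 * v $ i5 - v $ i6)"

lemma psi0_nth [simp]:
  "psi0 v $ i1 = 3 * v $ i2" "psi0 v $ i2 = v $ i1" "psi0 v $ i3 = 3 * v $ i4" "psi0 v $ i4 = v $ i3"
  "psi0 v $ i5 = 2 * v $ i8 - v $ i7" "psi0 v $ i6 = v $ i8 - 2 * v $ i7"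
  "psi0 v $ i7 = v $ i5 - 2 * v $ i6" "psi0 v $ i8 = 2 * v $ i5 - v $ i6"
  by (simp_all add: psi0_def)

lemma psi0_psi0: "psi0 (psi0 v) = 3 *s v"
  by (simp add: vec8_eq_iff algebra_simps)

lemma psi0_selfadjoint: "form Gamma_lat (psi0 v) w = form Gamma_lat v (psi0 w)"
  by (simp add: form_Gamma algebra_simps)

lemma psi0_similarity: "form Gamma_lat (psi0 v) (psi0 w) = 3 * form Gamma_lat v w"
  by (simp add: form_Gamma algebra_simps)

lemma linear_psi0: "Vector_Spaces.linear (*s) (*s) (psi0 :: 'a::field ^ idx8 \<Rightarrow> 'a ^ idx8)"
  by unfold_locales (simp_all add: vec8_eq_iff algebra_simps)

lemma bij_psi0: "bij (psi0 :: 'a::field_char_0 ^ idx8 \<Rightarrow> 'a ^ idx8)"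
proof (rule bijI')
  show "psi0 x = psi0 y \<longleftrightarrow> x = y" for x y :: "'a ^ idx8"
  proof
    assume "psi0 x = psi0 y"
    then have "3 *s x = 3 *s y"
      by (metis psi0_psi0)
    then show "x = y"
      by (simp add: vec_eq_iff)
  qed simp
  show "\<exists>x. y = psi0 x" for y :: "'a ^ idx8"
  proof
    have "psi0 (inverse 3 *s psi0 y) = inverse 3 *s psi0 (psi0 y)"
      by (simp add: vec8_eq_iff algebra_simps)
    then show "y = psi0 (inverse 3 *s psi0 y)"
      by (simp add: psi0_psi0 vec.scale_scale)
  qed
qed

text \<open>\<open>psi0\<close> is polymorphic in the scalars: on the left stands its rational
  instance, extended through its matrix, on the right the complex one.\<close>

lemma complexify_psi0: "complexify psi0 v = psi0 v"
  by (simp add: vec8_eq_iff complexify_def matrix_vector_mult_def sum_idx8 matrix_def axis_def)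

lemma psi0_vcnj: "psi0 (vcnj v) = vcnj (psi0 v)"
  by (simp add: vec8_eq_iff vcnj_def)

text \<open>As \<open>r\<close> is real, the conjugate of \<open>\<omega>\<close> has the same
  eigenvalue; self-adjointness then preserves the orthogonal complement of both. Surjectivity on
  each summand comes from the inverse \<open>psi0 / 3\<close>.\<close>

lemma hodge_similarity_psi0:
  assumes iso: "form Gamma_lat \<omega> \<omega> = 0" and pos: "Re (form Gamma_lat \<omega> (vcnj \<omega>)) > 0"
    and eigen: "psi0 \<omega> = complex_of_real r *s \<omega>" "r \<noteq> 0"
  shows "hodge_similarity Gamma_lat (hodge_of Gamma_lat \<omega>) 3 psi0"
proof -
  have eigen': "psi0 (vcnj \<omega>) = complex_of_real r *s vcnj \<omega>"
    by (simp add: psi0_vcnj eigen vcnj_smult)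
  have smult: "psi0 (c *s v) = c *s psi0 v" for c and v :: "complex ^ idx8"
    by (simp add: vec8_eq_iff algebra_simps)
  have mem: "psi0 x \<in> hodge_of Gamma_lat \<omega> a b" if "x \<in> hodge_of Gamma_lat \<omega> a b" for x a b
    using that
  proof (cases rule: hodge_of_cases)
    case 3
    have "form Gamma_lat (psi0 x) \<omega> = 0" "form Gamma_lat (psi0 x) (vcnj \<omega>) = 0"
      using 3 unfolding psi0_selfadjoint eigen eigen' form_smult_right by simp_all
    with 3 show ?thesis
      by simp
  next
    case 4
    have "psi0 (0 :: complex ^ idx8) = 0"
      by (simp add: vec8_eq_iff)
    with 4 that show ?thesis
      by simp
  qed (simp_all add: smult eigen eigen' vec.span_base vec.span_scale)
  have "psi0 ` hodge_of Gamma_lat \<omega> a b = hodge_of Gamma_lat \<omega> a b" for a b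
  proof (intro equalityI subsetI)
    fix y assume y: "y \<in> hodge_of Gamma_lat \<omega> a b"
    have "vec.subspace (hodge_of Gamma_lat \<omega> a b)"
      using hodge_structure_hodge_of [OF Gamma_sym iso pos] by (simp add: hodge_structure_def)
    then have "inverse 3 *s psi0 y \<in> hodge_of Gamma_lat \<omega> a b"
      using mem [OF y] by (rule vec.subspace_scale)
    moreover have "y = psi0 (inverse 3 *s psi0 y)"
      by (simp add: smult psi0_psi0 vec.scale_scale)
    ultimately show "y \<in> psi0 ` hodge_of Gamma_lat \<omega> a b"
      by blast
  qed (use mem in auto)
  then show ?thesis
    unfolding hodge_similarity_def hodge_automorphism_def
    by (simp add: linear_psi0 bij_psi0 psi0_similarity complexify_psi0 [abs_def])
qed


section \<open>The similarity locus as a countable union\<close>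

text \<open>Presents an eigenspace of a rational matrix as a kernel, the shape required by
  \<open>irreducible_in_countable_union\<close>.\<close>

definition eigen_matrix :: "rat ^ 'n ^ 'n \<Rightarrow> complex \<Rightarrow> complex ^ 'n ^ 'n" where
  "eigen_matrix M l = (\<chi> i j. of_rat (M $ i $ j) - (if i = j then l else 0))"

lemma eigen_matrix_mult:
  "eigen_matrix M l *v x = (\<chi> i j. of_rat (M $ i $ j)) *v x - l *s x"
  by (simp add: vec_eq_iff eigen_matrix_def matrix_vector_mult_def left_diff_distrib sum_subtractf
      if_distrib [of "\<lambda>a. a * _"] cong: if_cong)

lemma complexify_eigen_iff: "complexify \<psi> x = l *s x \<longleftrightarrow> eigen_matrix (matrix \<psi>) l *v x = 0"
  by (simp add: eigen_matrix_mult complexify_def)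

lemma complexify_square:
  assumes lin: "Vector_Spaces.linear (*s) (*s) \<psi>" and sq: "\<And>v. \<psi> (\<psi> v) = c *s v"
  shows "complexify \<psi> (complexify \<psi> v) = of_rat c *s v"
proof -
  let ?M = "matrix \<psi>" and ?C = "(\<chi> i j. of_rat (matrix \<psi> $ i $ j)) :: complex ^ 'a ^ 'a"
  have "(?M ** ?M) *v x = mat c *v x" for x
    unfolding matrix_vector_mul_assoc [symmetric] matrix_works [OF lin] sq
    by (simp add: vec_eq_iff matrix_vector_mult_def mat_def if_distrib [of "\<lambda>a. a * _"] cong: if_cong)
  then have MM: "?M ** ?M = mat c"
    using matrix_eq by blast
  have "(?C ** ?C) $ i $ j = of_rat ((?M ** ?M) $ i $ j)" for i j
    by (simp add: matrix_matrix_mult_def of_rat_sum of_rat_mult)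
  then have "?C ** ?C = mat (of_rat c)"
    unfolding MM by (simp add: vec_eq_iff mat_def)
  then have "?C *v (?C *v v) = mat (of_rat c) *v v"
    by (simp add: matrix_vector_mul_assoc)
  then show ?thesis
    unfolding complexify_def
    by (simp add: vec_eq_iff matrix_vector_mult_def mat_def if_distrib [of "\<lambda>a. a * _"] cong: if_cong)
qed

abbreviation sqrt3 :: complex where "sqrt3 \<equiv> complex_of_real (sqrt 3)"

lemma sqrt3_square: "sqrt3 * sqrt3 = 3"
  by (simp flip: of_real_mult)

lemma similarity_locus_eigenspace:
  assumes "p \<in> similarity_locus Gamma_lat 3"
  obtains M l where "l \<in> {sqrt3, - sqrt3}" "p \<subseteq> {x. eigen_matrix M l *v x = 0}"
proof -
  obtain H \<psi> where p: "p \<in> period_domain Gamma_lat" and H: "H 2 0 = p"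
    and sim: "hodge_similarity Gamma_lat H 3 \<psi>" and ros: "rosati_fixed Gamma_lat \<psi>"
    using assms unfolding similarity_locus_def by blast
  have lin: "Vector_Spaces.linear (*s) (*s) \<psi>" and im: "complexify \<psi> ` p = p"
    and sim': "\<And>v w. form Gamma_lat (\<psi> v) (\<psi> w) = 3 * form Gamma_lat v w"
    using sim H by (auto simp: hodge_similarity_def hodge_automorphism_def)
  \<comment> \<open>Moving one \<open>\<psi>\<close> across the form turns
    \<open>q(\<psi> \<psi> v, w)\<close> into \<open>q(\<psi> v, \<psi> w)\<close>, which is
    \<open>3 q(v, w)\<close>; nondegeneracy finishes.\<close>
  have "\<psi> (\<psi> v) = 3 *s v" for v
  proof -
    have "form Gamma_lat (\<psi> (\<psi> v) - 3 *s v) w = 0" for w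
      using sim' [of v w] ros by (simp add: rosati_fixed_def form_diff_left form_smult_left)
    then show ?thesis
      using form_Gamma_nondegenerate [of "\<psi> (\<psi> v) - 3 *s v"] by simp
  qed
  from complexify_square [OF lin this] have sq: "complexify \<psi> (complexify \<psi> v) = 3 *s v" for v
    by simp
  obtain \<omega> where \<omega>: "\<omega> \<noteq> 0" "p = vec.span {\<omega>}"
    using p period_domain_subset_proj_space by (auto simp: proj_space_def)
  have scale: "complexify \<psi> (c *s v) = c *s complexify \<psi> v" for c v
    by (simp add: complexify_def vec.scale)
  have "complexify \<psi> \<omega> \<in> p"
    using im \<omega>(2) vec.span_base by blast
  then obtain l where l: "complexify \<psi> \<omega> = l *s \<omega>"
    by (auto simp: \<omega>(2) span_singleton_vec)
  have "(l * l) *s \<omega> = 3 *s \<omega>"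
    using sq [of \<omega>] by (simp add: l scale vec.scale_scale)
  then have "l * l = 3"
    using \<omega>(1) by (simp add: vec.scale_right_imp_eq)
  then have "(l - sqrt3) * (l + sqrt3) = 0"
    using sqrt3_square by (simp add: algebra_simps)
  then have "l \<in> {sqrt3, - sqrt3}"
    by (simp add: eq_neg_iff_add_eq_0)
  moreover have "p \<subseteq> {x. eigen_matrix (matrix \<psi>) l *v x = 0}"
    unfolding \<omega>(2) span_singleton_subset_iff [OF subspace_kernel] using l by (simp add: complexify_eigen_iff)
  ultimately show ?thesis
    by (rule that)
qed

section \<open>Independence of 1 and sqrt 3 over the rationals\<close>

lemma rat_square_ne_3: "(r :: rat)\<^sup>2 \<noteq> 3"
proof
  assume r: "r\<^sup>2 = 3"
  obtain a b :: int where ab: "r = of_int a / of_int b" "b > 0" "coprime a b"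
    using quotient_of_div [of r] quotient_of_coprime [of r] quotient_of_denom_pos [of r] by (cases "quotient_of r") auto
  have "(of_int (a\<^sup>2) :: rat) = of_int (3 * b\<^sup>2)"
    using r ab(1,2) by (simp add: power_divide field_simps)
  then have eq: "a\<^sup>2 = 3 * b\<^sup>2"
    by linarith
  have prime: "prime (3 :: int)"
    by simp
  have "3 dvd a\<^sup>2"
    using eq by simp
  then have "3 dvd a"
    using prime prime_dvd_power by blast
  then obtain k where k: "a = 3 * k" ..
  have "b\<^sup>2 = 3 * k\<^sup>2"
    using eq by (simp add: k power2_eq_square)
  then have "3 dvd b"
    using prime prime_dvd_power [of 3 b 2] by simp
  with \<open>3 dvd a\<close> ab(3) show False
    using not_coprimeI [of 3 a b] by simp
qed

lemma sqrt3_independent: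
  assumes "of_rat a * sqrt3 + of_rat b = 0"
  shows "a = 0" "b = 0"
proof -
  show a: "a = 0"
  proof (rule ccontr)
    assume "a \<noteq> 0"
    then have "sqrt3 = of_rat (- b / a)"
      using assms by (simp add: of_rat_divide of_rat_minus field_simps add_eq_0_iff)
    then have "(of_rat ((- b / a)\<^sup>2) :: complex) = of_rat 3"
      by (metis of_rat_mult of_rat_numeral_eq power2_eq_square sqrt3_square)
    then show False
      using rat_square_ne_3 of_rat_eq_iff by blast
  qed
  then show "b = 0"
    using assms by simp
qed

section \<open>A component of dimension two\<close>

text \<open>The eigenspace of \<open>psi0\<close> for \<open>sqrt 3\<close> has signature \<open>(2, 2)\<close>. In the coordinates \<open>s\<close>, \<open>t\<close>, \<open>u\<close>, \<open>w\<close>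
  given by the functions below, the form is \<open>2 * (sqrt 3 * s * t - 2 * u * w)\<close>. Its period domain has
  two connected components, which are distinguished by the sign of \<open>|s| - |t|\<close>.\<close>

definition sfun :: "complex ^ idx8 \<Rightarrow> complex" where "sfun v = v $ i2 + \<i> * v $ i4"
definition tfun :: "complex ^ idx8 \<Rightarrow> complex" where "tfun v = v $ i2 - \<i> * v $ i4"

definition Zcone :: "(complex ^ idx8) set" where
  "Zcone = {v. psi0 v = sqrt3 *s v \<and> form Gamma_lat v v = 0 \<and> Re (form Gamma_lat v (vcnj v)) > 0 \<and>
     cmod (tfun v) < cmod (sfun v)}"

definition Zset :: "(complex ^ idx8) set set" where
  "Zset = (\<lambda>v. vec.span {v}) ` Zcone"

text \<open>Because \<open>psi0\<close> squares to 3, four of the eight coordinate equations imply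
  the others. These four are the linear equations used in \<open>regular_at_Zcone\<close>.\<close>

lemma eigen_psi0_iff:
  "psi0 v = sqrt3 *s v \<longleftrightarrow> v $ i1 = sqrt3 * v $ i2 \<and> v $ i3 = sqrt3 * v $ i4 \<and>
     sqrt3 * v $ i7 = v $ i5 - 2 * v $ i6 \<and> sqrt3 * v $ i8 = 2 * v $ i5 - v $ i6"
proof
  assume R: "v $ i1 = sqrt3 * v $ i2 \<and> v $ i3 = sqrt3 * v $ i4 \<and>
     sqrt3 * v $ i7 = v $ i5 - 2 * v $ i6 \<and> sqrt3 * v $ i8 = 2 * v $ i5 - v $ i6"
  have "2 * v $ i8 - v $ i7 = sqrt3 * v $ i5" "v $ i8 - 2 * v $ i7 = sqrt3 * v $ i6"
    using R sqrt3_square by algebra+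
  moreover have "3 * v $ i2 = sqrt3 * v $ i1" "3 * v $ i4 = sqrt3 * v $ i3"
    using R sqrt3_square by algebra+
  ultimately show "psi0 v = sqrt3 *s v"
    using R by (simp add: vec8_eq_iff)
qed (simp add: vec8_eq_iff)

text \<open>The eigenspace as a graph over the coordinates \<open>i2\<close>, \<open>i4\<close>,
  \<open>i5\<close>, \<open>i6\<close>.\<close>

definition Evec :: "complex \<Rightarrow> complex \<Rightarrow> complex \<Rightarrow> complex \<Rightarrow> complex ^ idx8" where
  "Evec a b c d = mk8 (sqrt3 * a) a (sqrt3 * b) b c d ((c - 2 * d) / sqrt3) ((2 * c - d) / sqrt3)"

lemma Evec_nth [simp]:
  "Evec a b c d $ i1 = sqrt3 * a" "Evec a b c d $ i2 = a" "Evec a b c d $ i3 = sqrt3 * b" "Evec a b c d $ i4 = b"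
  "Evec a b c d $ i5 = c" "Evec a b c d $ i6 = d"
  "Evec a b c d $ i7 = (c - 2 * d) / sqrt3" "Evec a b c d $ i8 = (2 * c - d) / sqrt3"
  by (simp_all add: Evec_def)

lemma eigen_Evec: "psi0 (Evec a b c d) = sqrt3 *s Evec a b c d"
  by (simp add: eigen_psi0_iff)

lemma eigen_eq_Evec:
  assumes "psi0 v = sqrt3 *s v"
  shows "v = Evec (v $ i2) (v $ i4) (v $ i5) (v $ i6)"
  using assms unfolding eigen_psi0_iff by (simp add: vec8_eq_iff eq_divide_eq mult.commute)

lemma form_eigen:
  assumes "psi0 v = sqrt3 *s v" "psi0 w = sqrt3 *s w"
  shows "form Gamma_lat v w = 2 * sqrt3 * (v $ i2 * w $ i2 + v $ i4 * w $ i4)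
     - 2 * (2 * v $ i5 * w $ i5 - v $ i5 * w $ i6 - v $ i6 * w $ i5 + 2 * v $ i6 * w $ i6)"
  using assms sqrt3_square unfolding eigen_psi0_iff form_Gamma by algebra

lemma eigen_vcnj: "psi0 v = sqrt3 *s v \<Longrightarrow> psi0 (vcnj v) = sqrt3 *s vcnj v"
  by (simp add: psi0_vcnj vcnj_smult)

text \<open>The constants in \<open>ufun\<close> and \<open>wfun\<close> are the two primitive cube
  roots of unity, which split the A2 norm form: \<open>c^2 - c d + d^2\<close> is the product of the
  two functions.\<close>

definition ufun :: "complex ^ idx8 \<Rightarrow> complex" where
  "ufun v = v $ i5 + Complex (- 1 / 2) (sqrt 3 / 2) * v $ i6"
definition wfun :: "complex ^ idx8 \<Rightarrow> complex" where
  "wfun v = v $ i5 + Complex (- 1 / 2) (- sqrt 3 / 2) * v $ i6"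

lemma form_eigen_diag:
  assumes "psi0 v = sqrt3 *s v"
  shows "form Gamma_lat v v = 2 * (sqrt3 * (sfun v * tfun v) - 2 * (ufun v * wfun v))"
proof -
  have "Complex (- 1 / 2) (sqrt 3 / 2) + Complex (- 1 / 2) (- sqrt 3 / 2) = - 1"
    "Complex (- 1 / 2) (sqrt 3 / 2) * Complex (- 1 / 2) (- sqrt 3 / 2) = 1"
    by (simp_all add: complex_eq_iff)
  moreover have "\<i> * \<i> = - 1"
    by simp
  ultimately show ?thesis
    unfolding form_eigen [OF assms assms] sfun_def tfun_def ufun_def wfun_def by algebra
qed

text \<open>Conjugating \<open>v\<close> exchanges the factors:
  \<open>sfun (vcnj v) = cnj (tfun v)\<close>, and likewise for \<open>ufun\<close> and
  \<open>wfun\<close>. So polarizing \<open>form_eigen_diag\<close> gives a diagonal Hermitian form;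
  the proof verifies this in real and imaginary parts.\<close>

lemma form_eigen_vcnj:
  assumes "psi0 v = sqrt3 *s v"
  shows "Re (form Gamma_lat v (vcnj v)) = sqrt 3 * ((cmod (sfun v))\<^sup>2 + (cmod (tfun v))\<^sup>2)
     - 2 * ((cmod (ufun v))\<^sup>2 + (cmod (wfun v))\<^sup>2)"
proof -
  have "Re (form Gamma_lat v (vcnj v)) = 2 * sqrt 3 * ((cmod (v $ i2))\<^sup>2 + (cmod (v $ i4))\<^sup>2)
     - 2 * (2 * (cmod (v $ i5))\<^sup>2 - 2 * Re (v $ i5 * cnj (v $ i6)) + 2 * (cmod (v $ i6))\<^sup>2)"
    unfolding form_eigen [OF assms eigen_vcnj [OF assms]]
    by (simp add: vcnj_def cmod_power2) (simp add: power2_eq_square algebra_simps)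
  moreover have "(cmod (sfun v))\<^sup>2 + (cmod (tfun v))\<^sup>2 = 2 * ((cmod (v $ i2))\<^sup>2 + (cmod (v $ i4))\<^sup>2)"
    unfolding cmod_power2 sfun_def tfun_def by (simp add: power2_eq_square algebra_simps)
  moreover have "(cmod (ufun v))\<^sup>2 + (cmod (wfun v))\<^sup>2 =
      2 * (cmod (v $ i5))\<^sup>2 - 2 * Re (v $ i5 * cnj (v $ i6)) + 2 * (cmod (v $ i6))\<^sup>2"
  proof -
    \<comment> \<open>A polynomial identity in \<open>h\<close>; at \<open>h = sqrt 3 / 2\<close>
      the right side sees only \<open>h * h = 3 / 4\<close>.\<close>
    have "(a + (- 1 / 2 * c - h * d))\<^sup>2 + (b + (- 1 / 2 * d + h * c))\<^sup>2
        + ((a + (- 1 / 2 * c - - h * d))\<^sup>2 + (b + (- 1 / 2 * d + - h * c))\<^sup>2)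
        = 2 * (a - c / 2)\<^sup>2 + 2 * (b - d / 2)\<^sup>2 + 2 * (h * h) * (c\<^sup>2 + d\<^sup>2)" for a b c d h :: real
      by (simp add: power2_eq_square algebra_simps)
    from this [of "Re (v $ i5)" "Re (v $ i6)" "sqrt 3 / 2" "Im (v $ i6)" "Im (v $ i5)"]
    have "(cmod (ufun v))\<^sup>2 + (cmod (wfun v))\<^sup>2 = 2 * (Re (v $ i5) - Re (v $ i6) / 2)\<^sup>2
        + 2 * (Im (v $ i5) - Im (v $ i6) / 2)\<^sup>2 + 2 * (3 / 4) * ((Re (v $ i6))\<^sup>2 + (Im (v $ i6))\<^sup>2)"
      unfolding cmod_power2 ufun_def wfun_def plus_complex.sel times_complex.sel complex.sel by simp
    then show ?thesis
      unfolding cmod_power2 by (simp add: power2_eq_square algebra_simps)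
  qed
  ultimately show ?thesis
    by (simp add: algebra_simps)
qed

lemma isotropic_norms:
  assumes "psi0 v = sqrt3 *s v" "form Gamma_lat v v = 0"
  shows "sqrt 3 * (cmod (sfun v) * cmod (tfun v)) = 2 * (cmod (ufun v) * cmod (wfun v))"
proof -
  have "sqrt3 * (sfun v * tfun v) = 2 * (ufun v * wfun v)"
    using assms(2) unfolding form_eigen_diag [OF assms(1)] by algebra
  then have "cmod (sqrt3 * (sfun v * tfun v)) = cmod (2 * (ufun v * wfun v))"
    by simp
  then show ?thesis
    by (simp add: norm_mult)
qed

text \<open>If \<open>|s| = |t|\<close>, isotropy gives \<open>sqrt 3 * |s|^2 = 2 |u| |w|\<close>,
  at most \<open>|u|^2 + |w|^2\<close>, against positivity. Hence the period domain of the
  eigenspace falls apart according to which of \<open>|s|\<close>, \<open>|t|\<close> is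
  larger.\<close>

lemma eigen_cmod_ne:
  assumes "psi0 v = sqrt3 *s v" "form Gamma_lat v v = 0" "Re (form Gamma_lat v (vcnj v)) > 0"
  shows "cmod (sfun v) \<noteq> cmod (tfun v)"
proof
  assume eq: "cmod (sfun v) = cmod (tfun v)"
  have "2 * (cmod (ufun v) * cmod (wfun v)) \<le> (cmod (ufun v))\<^sup>2 + (cmod (wfun v))\<^sup>2"
    using sum_squares_bound [of "cmod (ufun v)" "cmod (wfun v)"] by (simp add: mult.assoc)
  then show False
    using assms(3) isotropic_norms [OF assms(1,2)] eq
    unfolding form_eigen_vcnj [OF assms(1)] by (simp add: power2_eq_square)
qed


section \<open>The component as a smooth, relatively closed piece of the period domain\<close>

lemma sfun_smult: "sfun (c *s v) = c * sfun v" and tfun_smult: "tfun (c *s v) = c * tfun v"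
  by (simp_all add: sfun_def tfun_def algebra_simps)

lemma continuous_on_sfun: "continuous_on S sfun" and continuous_on_tfun: "continuous_on S tfun"
  unfolding sfun_def [abs_def] tfun_def [abs_def] by (intro continuous_intros)+

lemma open_cmod_less: "open {v. cmod (tfun v) < cmod (sfun v)}" "open {v. cmod (sfun v) < cmod (tfun v)}"
  by (intro open_Collect_less continuous_on_norm continuous_on_sfun continuous_on_tfun)+

lemma psi0_smult: "psi0 (c *s v) = c *s psi0 v"
  by (simp add: vec8_eq_iff algebra_simps)

lemma Zcone_smult:
  assumes "c \<noteq> 0"
  shows "c *s v \<in> Zcone \<longleftrightarrow> v \<in> Zcone"
proof -
  have "psi0 (c *s v) = sqrt3 *s (c *s v) \<longleftrightarrow> psi0 v = sqrt3 *s v"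
    unfolding psi0_smult using assms by (simp add: vec_eq_iff)
  moreover have "form Gamma_lat (c *s v) (c *s v) = 0 \<and> Re (form Gamma_lat (c *s v) (vcnj (c *s v))) > 0
      \<longleftrightarrow> form Gamma_lat v v = 0 \<and> Re (form Gamma_lat v (vcnj v)) > 0"
    unfolding span_in_period_domain [symmetric] span_singleton_smult [OF assms] ..
  moreover have "cmod (tfun (c *s v)) < cmod (sfun (c *s v)) \<longleftrightarrow> cmod (tfun v) < cmod (sfun v)"
    using assms by (simp add: sfun_smult tfun_smult norm_mult)
  ultimately show ?thesis
    unfolding Zcone_def mem_Collect_eq by metis
qed

lemma zero_notin_Zcone: "0 \<notin> Zcone"
  by (simp add: Zcone_def)

lemma affine_cone_Zset: "affine_cone Zset = Zcone"
proof (intro equalityI subsetI)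
  fix x assume "x \<in> affine_cone Zset"
  then obtain y where xy: "x \<noteq> 0" "y \<in> Zcone" "vec.span {x} = vec.span {y}"
    by (auto simp: affine_cone_def Zset_def)
  obtain c where "c \<noteq> 0" "x = c *s y"
    by (rule span_singleton_eqD [OF xy(3,1)])
  then show "x \<in> Zcone"
    using Zcone_smult xy(2) by simp
next
  fix x assume "x \<in> Zcone"
  then show "x \<in> affine_cone Zset"
    using zero_notin_Zcone by (auto simp: affine_cone_def Zset_def)
qed

lemma Zset_subset_period_domain: "Zset \<subseteq> period_domain Gamma_lat"
  by (auto simp: Zset_def Zcone_def span_in_period_domain)

lemma Zset_subset_similarity_locus: "Zset \<subseteq> similarity_locus Gamma_lat 3"
proof
  fix p assume p: "p \<in> Zset"
  then obtain \<omega> where \<omega>: "\<omega> \<in> Zcone" "p = vec.span {\<omega>}"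
    by (auto simp: Zset_def)
  then have iso: "form Gamma_lat \<omega> \<omega> = 0" and pos: "Re (form Gamma_lat \<omega> (vcnj \<omega>)) > 0"
    and eigen: "psi0 \<omega> = sqrt3 *s \<omega>"
    by (auto simp: Zcone_def)
  have "K3_type Gamma_lat (hodge_of Gamma_lat \<omega>)"
    by (rule K3_type_hodge_of [OF Gamma_sym iso pos])
  moreover have "hodge_similarity Gamma_lat (hodge_of Gamma_lat \<omega>) 3 psi0"
    by (rule hodge_similarity_psi0 [OF iso pos eigen]) simp
  moreover have "rosati_fixed Gamma_lat psi0"
    by (simp add: rosati_fixed_def psi0_selfadjoint)
  moreover have "hodge_of Gamma_lat \<omega> 2 0 = p"
    using \<omega>(2) by simp
  ultimately show "p \<in> similarity_locus Gamma_lat 3"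
    using p Zset_subset_period_domain unfolding similarity_locus_def by blast
qed

text \<open>Four linear equations of the eigenspace and the quadric; 8 - 1 - 5 = 2 is the projective
  dimension. The remaining conditions are open.\<close>

lemma regular_at_Zcone:
  assumes v: "v \<in> Zcone"
  shows "regular_at 5 Zcone v"
proof -
  define g where "g i = (if i = 0 then (\<lambda>x. x $ i1 - sqrt3 * x $ i2)
     else if i = 1 then (\<lambda>x. x $ i3 - sqrt3 * x $ i4)
     else if i = 2 then (\<lambda>x. sqrt3 * x $ i7 - (x $ i5 - 2 * x $ i6))
     else if i = 3 then (\<lambda>x. sqrt3 * x $ i8 - (2 * x $ i5 - x $ i6))
     else (\<lambda>x. form Gamma_lat x x))" for i :: nat
  have clin: "clin (g i)" if "i < 4" for i
    using that by (auto simp: g_def clin_def algebra_simps)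
  have g4: "g 4 = (\<lambda>x. form Gamma_lat x x)"
    by (simp add: g_def)
  have all5: "(\<forall>i<5. P i) \<longleftrightarrow> P 0 \<and> P 1 \<and> P 2 \<and> P 3 \<and> P (4::nat)" for P
    by (auto simp: numeral_eq_Suc less_Suc_eq)
  have eigen: "psi0 x = sqrt3 *s x \<longleftrightarrow> g 0 x = 0 \<and> g 1 x = 0 \<and> g 2 x = 0 \<and> g 3 x = 0" for x
    by (simp add: g_def eigen_psi0_iff)
  define N where "N = {x. Re (form Gamma_lat x (vcnj x)) > 0} \<inter> {x. cmod (tfun x) < cmod (sfun x)}"
  have "open N"
    unfolding N_def by (intro open_Int open_form_pos open_cmod_less)
  moreover have "v \<in> N"
    using v by (simp add: N_def Zcone_def)
  moreover have "holo_on (g i) N" if "i < 5" for i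
  proof (cases "i = 4")
    case True
    then show ?thesis
      unfolding g4 by (simp add: g4 holo_on_form_diag)
  next
    case False
    then show ?thesis
      using that by (intro clin_holo_on clin) simp
  qed
  moreover have "Zcone \<inter> N = {x \<in> N. \<forall>i<5. g i x = 0}"
    unfolding all5 by (auto simp: N_def Zcone_def eigen g4)
  moreover have "indep_funs 5 (\<lambda>i. fder (g i) v)"
    unfolding indep_funs_def
  proof (intro allI impI)
    fix c and i :: nat
    assume c: "\<forall>w. (\<Sum>i<5. c i * fder (g i) v w) = 0" and i: "i < 5"
    have f4: "fder (g 4) v w = 2 * form Gamma_lat v w" for w
      unfolding g4 using frechet_derivative_at [OF has_derivative_form_diag [of Gamma_lat v]]
        form_sym [OF Gamma_sym, of w v] by (metis mult_2)
    have fi: "fder (g i) v w = g i w" if "i < 4" for i w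
      using fder_clin [OF clin [OF that]] by simp
    have sum: "c 0 * g 0 w + c 1 * g 1 w + c 2 * g 2 w + c 3 * g 3 w + c 4 * (2 * form Gamma_lat v w) = 0" for w
    proof -
      have "(\<Sum>i<5. F i) = F 0 + F 1 + F 2 + F 3 + F 4" for F :: "nat \<Rightarrow> complex"
        by (simp add: eval_nat_numeral)
      then show ?thesis
        using c [rule_format, of w] by (simp add: f4 fi)
    qed
    \<comment> \<open>Tested on \<open>vcnj v\<close>, the linear equations drop out, while the
      differential of the quadric is nonzero by positivity.\<close>
    have "psi0 (vcnj v) = sqrt3 *s vcnj v"
      using v by (intro eigen_vcnj) (simp add: Zcone_def)
    then have "c 4 * form Gamma_lat v (vcnj v) = 0"
      using sum [of "vcnj v"] unfolding eigen by simp
    moreover have "form Gamma_lat v (vcnj v) \<noteq> 0"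
      using v by (auto simp: Zcone_def)
    ultimately have c4: "c 4 = 0"
      by simp
    \<comment> \<open>Each of the coordinates \<open>i1\<close>, \<open>i3\<close>,
      \<open>i7\<close>, \<open>i8\<close> occurs in exactly one of the linear equations.\<close>
    have "c 0 = 0" "c 1 = 0" "c 2 = 0" "c 3 = 0"
      using sum [of "axis i1 1"] sum [of "axis i3 1"] sum [of "axis i7 1"] sum [of "axis i8 1"] c4
      by (simp_all add: g_def axis_def)
    then have "\<forall>i<5. c i = 0"
      unfolding all5 using c4 by simp
    then show "c i = 0"
      using i by simp
  qed
  ultimately show ?thesis
    unfolding regular_at_def using v by (intro conjI exI [of _ N] exI [of _ g]) simp_all
qed

lemma regular_point_Zset: "regular_point d Zset p \<longleftrightarrow> d = 2 \<and> p \<in> Zset"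
proof -
  have reg: "regular_point 2 Zset p" if p: "p \<in> Zset" for p
  proof -
    obtain v where v: "v \<in> Zcone" "p = vec.span {v}"
      using p by (auto simp: Zset_def)
    have "regular_at 5 (affine_cone Zset) v"
      unfolding affine_cone_Zset by (rule regular_at_Zcone [OF v(1)])
    from regular_at_imp_regular_point(2) [OF this] show ?thesis
      by (simp add: v(2))
  qed
  show ?thesis
  proof
    assume d: "regular_point d Zset p"
    then have p: "p \<in> Zset"
      by (simp add: regular_point_def)
    then have "p \<in> proj_space"
      using Zset_subset_period_domain period_domain_subset_proj_space by blast
    then show "d = 2 \<and> p \<in> Zset"
      using regular_point_dim_unique [OF d reg [OF p]] p by simp
  qed (use reg in auto)
qed

lemma regular_locus_Zset: "regular_locus Zset = Zset"
  by (simp add: regular_locus_def regular_point_Zset)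

text \<open>Around its own points the regular equations serve. Around the other points of the period
  domain \<open>Zset\<close> is empty, being relatively closed by
  \<open>eigen_cmod_ne\<close>.\<close>

lemma analytic_subset_Zset: "analytic_subset (period_domain Gamma_lat) Zset"
  unfolding analytic_subset_def
proof (intro conjI ballI)
  fix p assume p: "p \<in> period_domain Gamma_lat"
  show "\<exists>N (k::nat) f. openin proj_topology N \<and> p \<in> N \<and> (\<forall>i<k. proj_holomorphic_on (f i) N) \<and>
      Zset \<inter> N = {x \<in> period_domain Gamma_lat \<inter> N. \<forall>i<k. f i x = 0}"
  proof (cases "p \<in> Zset")
    case True
    then have "regular_point 2 Zset p"
      by (simp add: regular_point_Zset)
    then obtain N f and k :: nat where "openin proj_topology N" "p \<in> N" "\<forall>i<k. proj_holomorphic_on (f i) N"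
      and Z: "Zset \<inter> N = {x \<in> N. \<forall>i<k. f i x = 0}"
      unfolding regular_point_def by (elim exE conjE) (rule that)
    moreover have "Zset \<inter> N = {x \<in> period_domain Gamma_lat \<inter> N. \<forall>i<k. f i x = 0}"
      using Z Zset_subset_period_domain by blast
    ultimately show ?thesis
      by (intro exI [of _ N] exI [of _ k] exI [of _ f] conjI)
  next
    case False
    obtain v where v: "v \<noteq> 0" "p = vec.span {v}"
      using p period_domain_subset_proj_space by (auto simp: proj_space_def)
    have "v \<notin> Zcone"
      using False v(2) by (auto simp: Zset_def)
    \<comment> \<open>A point off \<open>Zset\<close> leaves the eigenspace or lies on the other
      component; both conditions are open.\<close>
    define U where "U = {x. psi0 x \<noteq> sqrt3 *s x} \<union> {x. cmod (sfun x) < cmod (tfun x)}"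
    have "closed {x. eigen_matrix (matrix psi0) sqrt3 *v x = 0}"
      by (rule closed_kernel)
    then have "closed {x. psi0 x = sqrt3 *s x}"
      by (simp flip: complexify_eigen_iff add: complexify_psi0)
    then have "open U"
      unfolding U_def by (intro open_Un open_cmod_less) (simp add: open_Collect_neg)
    have "v \<in> U"
      using \<open>v \<notin> Zcone\<close> p eigen_cmod_ne [of v] unfolding v(2) span_in_period_domain
      by (auto simp: U_def Zcone_def)
    define N where "N = (\<lambda>x. vec.span {x}) ` (U - {0})"
    have "openin proj_topology N"
      unfolding N_def by (rule openin_proj_image [OF \<open>open U\<close>])
    moreover have "p \<in> N"
      using v \<open>v \<in> U\<close> by (simp add: N_def)
    moreover have "Zset \<inter> N = {}"
    proof -
      have "x \<notin> Zcone" if "x \<in> U" for x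
        using that by (auto simp: U_def Zcone_def)
      moreover have "x \<in> Zcone" if "vec.span {x} \<in> Zset" "x \<noteq> 0" for x
        using that affine_cone_Zset by (auto simp: affine_cone_def)
      ultimately show ?thesis
        by (auto simp: N_def)
    qed
    \<comment> \<open>The constant 1 is an equation for the empty set.\<close>
    moreover have "proj_holomorphic_on (\<lambda>_. 1) N"
      unfolding proj_holomorphic_on_def pullback_def by (intro ballI exI [of _ "\<lambda>_. 0"]) simp
    ultimately show ?thesis
      by (intro exI [of _ N] exI [of _ 1] exI [of _ "\<lambda>_ _. 1"]) auto
  qed
qed (rule Zset_subset_period_domain)

text \<open>Over the eigenspace the quadric is \<open>sqrt 3 * s * t = 2 * u * w\<close>, so its points with \<open>s = 1\<close> are
  parametrized by \<open>(u, w)\<close>, and positivity amounts to \<open>(sqrt 3 - 2|u|^2) (sqrt 3 - 2|w|^2) > 0\<close>.\<close>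

definition Zpar :: "complex \<Rightarrow> complex \<Rightarrow> complex ^ idx8" where
  "Zpar u w = Evec ((1 + 2 * u * w / sqrt3) / 2) ((1 - 2 * u * w / sqrt3) / (2 * \<i>))
     (u - Complex (- 1 / 2) (sqrt 3 / 2) * ((u - w) / (\<i> * sqrt3))) ((u - w) / (\<i> * sqrt3))"

lemma Zpar_coords:
  "sfun (Zpar u w) = 1" "tfun (Zpar u w) = 2 * u * w / sqrt3" "ufun (Zpar u w) = u" "wfun (Zpar u w) = w"
proof -
  show "sfun (Zpar u w) = 1" "tfun (Zpar u w) = 2 * u * w / sqrt3" "ufun (Zpar u w) = u"
    by (simp_all add: Zpar_def sfun_def tfun_def ufun_def field_simps)
  \<comment> \<open>\<open>u - w\<close> is this difference of cube roots of unity times coordinate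
    \<open>i6\<close>, whence the denominator in \<open>Zpar\<close>.\<close>
  have "Complex (- 1 / 2) (sqrt 3 / 2) - Complex (- 1 / 2) (- sqrt 3 / 2) = \<i> * sqrt3"
    by (simp add: complex_eq_iff)
  then have "(Complex (- 1 / 2) (sqrt 3 / 2) - Complex (- 1 / 2) (- sqrt 3 / 2)) * ((u - w) / (\<i> * sqrt3)) = u - w"
    by simp
  moreover have "u - a * z + b * z = w" if "(a - b) * z = u - w" for a b z
    using that by algebra
  ultimately show "wfun (Zpar u w) = w"
    unfolding Zpar_def wfun_def Evec_nth by blast
qed

lemma eigen_Zpar: "psi0 (Zpar u w) = sqrt3 *s Zpar u w"
  unfolding Zpar_def by (rule eigen_Evec)

lemma eigen_coords_eqI:
  assumes "psi0 v = sqrt3 *s v" "psi0 v' = sqrt3 *s v'" "sfun v = sfun v'" "tfun v = tfun v'"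
    "ufun v = ufun v'" "wfun v = wfun v'"
  shows "v = v'"
proof -
  have "v $ i2 = v' $ i2" "v $ i4 = v' $ i4"
  proof -
    show "v $ i2 = v' $ i2"
      using assms(3,4) unfolding sfun_def tfun_def by algebra
    then show "v $ i4 = v' $ i4"
      using assms(3) unfolding sfun_def by simp
  qed
  moreover have "v $ i6 = v' $ i6"
  proof -
    have "(Complex (- 1 / 2) (sqrt 3 / 2) - Complex (- 1 / 2) (- sqrt 3 / 2)) * (v $ i6 - v' $ i6) = 0"
      using assms(5,6) unfolding ufun_def wfun_def by algebra
    moreover have "Complex (- 1 / 2) (sqrt 3 / 2) - Complex (- 1 / 2) (- sqrt 3 / 2) \<noteq> 0"
      by (simp add: complex_eq_iff)
    ultimately show ?thesis
      by simp
  qed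
  moreover from this have "v $ i5 = v' $ i5"
    using assms(5) unfolding ufun_def by simp
  ultimately show ?thesis
    using eigen_eq_Evec [OF assms(1)] eigen_eq_Evec [OF assms(2)] by simp
qed

lemma Zpar_in_Zcone:
  assumes "2 * (cmod u)\<^sup>2 < sqrt 3" "2 * (cmod w)\<^sup>2 < sqrt 3"
  shows "Zpar u w \<in> Zcone"
proof -
  define a where "a = (cmod u)\<^sup>2"
  define b where "b = (cmod w)\<^sup>2"
  have ab: "a \<ge> 0" "b \<ge> 0" "2 * a < sqrt 3" "2 * b < sqrt 3"
    using assms by (auto simp: a_def b_def)
  have sq: "sqrt 3 * sqrt 3 = (3::real)"
    by simp
  have t2: "(cmod (2 * u * w / sqrt3))\<^sup>2 = 4 * a * b / 3"
    by (simp add: norm_mult norm_divide power_mult_distrib power_divide a_def b_def)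
  \<comment> \<open>This gives \<open>|t| < 1 = |s|\<close>, the choice of component.\<close>
  have "(2 * a) * (2 * b) < 3"
    using mult_strict_mono' [OF ab(3,4)] ab(1,2) by simp
  then have "(cmod (2 * u * w / sqrt3))\<^sup>2 < 1\<^sup>2"
    unfolding t2 by simp
  then have "cmod (2 * u * w / sqrt3) < 1"
    by (rule power2_less_imp_less) simp
  moreover have "form Gamma_lat (Zpar u w) (Zpar u w) = 0"
    unfolding form_eigen_diag [OF eigen_Zpar] Zpar_coords by simp
  moreover have "Re (form Gamma_lat (Zpar u w) (vcnj (Zpar u w))) > 0"
  proof -
    have "(sqrt 3 - 2 * a) * (sqrt 3 - 2 * b) > 0"
      using ab by simp
    also have "(sqrt 3 - 2 * a) * (sqrt 3 - 2 * b) = sqrt 3 * (sqrt 3 * (1 + 4 * a * b / 3) - 2 * (a + b))"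
    proof -
      have "(sqrt 3 - 2 * a) * (sqrt 3 - 2 * b) = sqrt 3 * sqrt 3 - 2 * sqrt 3 * (a + b) + 4 * a * b"
        by (simp only: algebra_simps)
      moreover have "sqrt 3 * (sqrt 3 * (1 + 4 * a * b / 3) - 2 * (a + b))
          = (sqrt 3 * sqrt 3) * (1 + 4 * a * b / 3) - 2 * sqrt 3 * (a + b)"
        by (simp only: algebra_simps)
      ultimately show ?thesis
        unfolding sq by simp
    qed
    finally have "sqrt 3 * (1 + 4 * a * b / 3) - 2 * (a + b) > 0"
      by (simp add: zero_less_mult_iff)
    then show ?thesis
      unfolding form_eigen_vcnj [OF eigen_Zpar] Zpar_coords t2 by (simp add: a_def b_def)
  qed
  ultimately show ?thesis
    using eigen_Zpar by (simp add: Zcone_def Zpar_coords)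
qed

text \<open>Scaling to \<open>s = 1\<close> leaves only the bounds on \<open>u\<close> and
  \<open>w\<close> to prove. They follow from comparing two pairs of nonnegative numbers with equal
  products, \<open>x * y = a * b\<close> by isotropy, and sums \<open>a + b < x + y\<close> by
  positivity.\<close>

lemma Zcone_eq_smult_Zpar:
  assumes "v \<in> Zcone"
  obtains u w where "2 * (cmod u)\<^sup>2 < sqrt 3" "2 * (cmod w)\<^sup>2 < sqrt 3" "v = sfun v *s Zpar u w"
proof -
  have eigen: "psi0 v = sqrt3 *s v" and iso: "form Gamma_lat v v = 0" and pos: "Re (form Gamma_lat v (vcnj v)) > 0"
    and less: "cmod (tfun v) < cmod (sfun v)"
    using assms by (auto simp: Zcone_def)
  have s: "sfun v \<noteq> 0"
    using less by auto
  define x y a b where "x = sqrt 3 * (cmod (sfun v))\<^sup>2" "y = sqrt 3 * (cmod (tfun v))\<^sup>2"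
    "a = 2 * (cmod (ufun v))\<^sup>2" "b = 2 * (cmod (wfun v))\<^sup>2"
  note defs = this
  have "x * y = (sqrt 3 * (cmod (sfun v) * cmod (tfun v)))\<^sup>2"
    by (simp add: defs power_mult_distrib power2_eq_square)
  also have "\<dots> = a * b"
    unfolding isotropic_norms [OF eigen iso] by (simp add: defs power_mult_distrib power2_eq_square)
  finally have xy: "x * y = a * b" .
  have sum: "a + b < x + y"
    using pos unfolding form_eigen_vcnj [OF eigen] by (simp add: defs algebra_simps)
  have nn: "y \<ge> 0" "a \<ge> 0" "b \<ge> 0"
    by (simp_all add: defs)
  have "(cmod (tfun v))\<^sup>2 < (cmod (sfun v))\<^sup>2"
    using less by (simp add: power_strict_mono)
  then have "y < x"
    by (simp add: defs)
  \<comment> \<open>\<open>(c - x) * (c - y) = c * (c + d - x - y)\<close> by the product relation.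
    For \<open>c\<close> at least \<open>x > y\<close> the left side is nonnegative and the right
    side negative.\<close>
  have bound: "c < x" if c: "c \<ge> 0" "d \<ge> 0" "x * y = c * d" "c + d < x + y" for c d
  proof (rule ccontr)
    assume "\<not> c < x"
    then have "0 \<le> (c - x) * (c - y)"
      using \<open>y < x\<close> by (intro mult_nonneg_nonneg) auto
    moreover have "c > 0"
      using \<open>\<not> c < x\<close> \<open>y < x\<close> nn(1) by simp
    then have "c * (c + d) < c * (x + y)"
      using c(4) by (rule mult_strict_left_mono [rotated])
    ultimately show False
      using c(3) by (simp add: algebra_simps)
  qed
  have "a < x" "b < x"
    using bound [of a b] bound [of b a] nn xy sum by (simp_all add: mult.commute add.commute)
  define u where "u = ufun v / sfun v"
  define w where "w = wfun v / sfun v"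
  have "2 * (cmod u)\<^sup>2 < sqrt 3" "2 * (cmod w)\<^sup>2 < sqrt 3"
    using \<open>a < x\<close> \<open>b < x\<close> s by (simp_all add: u_def w_def defs norm_divide power_divide field_simps)
  moreover have "v = sfun v *s Zpar u w"
  proof (rule eigen_coords_eqI [OF eigen])
    show "psi0 (sfun v *s Zpar u w) = sqrt3 *s (sfun v *s Zpar u w)"
      by (simp add: psi0_smult eigen_Zpar vec.scale_scale mult.commute)
    have uw: "ufun (c *s x) = c * ufun x" "wfun (c *s x) = c * wfun x" for c x
      by (simp_all add: ufun_def wfun_def algebra_simps)
    show "sfun v = sfun (sfun v *s Zpar u w)" "ufun v = ufun (sfun v *s Zpar u w)" "wfun v = wfun (sfun v *s Zpar u w)"
      using s by (simp_all add: sfun_smult uw Zpar_coords u_def w_def)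
    have "sqrt3 * (sfun v * tfun v) = 2 * (ufun v * wfun v)"
      using iso unfolding form_eigen_diag [OF eigen] by algebra
    then show "tfun v = tfun (sfun v *s Zpar u w)"
      using s by (simp add: tfun_smult Zpar_coords u_def w_def field_simps)
  qed
  ultimately show ?thesis
    by (rule that)
qed

lemma continuous_on_Evec:
  assumes "continuous_on D a" "continuous_on D b" "continuous_on D c" "continuous_on D d"
  shows "continuous_on D (\<lambda>x. Evec (a x) (b x) (c x) (d x))"
proof -
  have "\<forall>i. continuous_on D (\<lambda>x. Evec (a x) (b x) (c x) (d x) $ i)"
    unfolding forall_idx8 Evec_nth divide_inverse using assms
    by (intro conjI continuous_on_mult continuous_on_diff continuous_on_const)
  then have "continuous_on D (\<lambda>x. \<chi> i. Evec (a x) (b x) (c x) (d x) $ i)"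
    by (intro continuous_on_vec_lambda) blast
  then show ?thesis
    unfolding vec_nth_inverse .
qed

lemma connectedin_Zset: "connectedin proj_topology Zset"
proof -
  \<comment> \<open>The radius with \<open>2 * \<rho>^2 = sqrt 3\<close>, so that the bounds on
    \<open>u\<close> and \<open>w\<close> describe discs.\<close>
  define \<rho> where "\<rho> = sqrt (sqrt 3 / 2)"
  have \<rho>: "cmod z < \<rho> \<longleftrightarrow> 2 * (cmod z)\<^sup>2 < sqrt 3" for z
  proof -
    have "cmod z < \<rho> \<longleftrightarrow> sqrt ((cmod z)\<^sup>2) < sqrt (sqrt 3 / 2)"
      by (simp add: \<rho>_def)
    also have "\<dots> \<longleftrightarrow> 2 * (cmod z)\<^sup>2 < sqrt 3"
      unfolding real_sqrt_less_iff by auto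
    finally show ?thesis .
  qed
  let ?D = "ball (0 :: complex) \<rho> \<times> ball (0 :: complex) \<rho>"
  let ?P = "\<lambda>x. Zpar (fst x) (snd x)"
  have P: "?P x \<in> Zcone" if "x \<in> ?D" for x
  proof -
    have "cmod (fst x) < \<rho>" "cmod (snd x) < \<rho>"
      using that by auto
    then show ?thesis
      unfolding \<rho> by (rule Zpar_in_Zcone)
  qed
  have cont: "continuous_on ?D ?P"
    unfolding Zpar_def divide_inverse
    by (intro continuous_on_Evec continuous_on_mult continuous_on_diff continuous_on_add
        continuous_on_const continuous_on_fst continuous_on_snd continuous_on_id)
  have conn: "connected (?P ` ?D)"
    by (intro connected_continuous_image [OF cont] connected_Times connected_ball)
  have "0 \<notin> ?P ` ?D"
  proof
    assume "0 \<in> ?P ` ?D"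
    then obtain x where "x \<in> ?D" "?P x = 0"
      by (metis (no_types, lifting) imageE)
    with P [of x] zero_notin_Zcone show False
      by metis
  qed
  then have "connectedin proj_topology ((\<lambda>v. vec.span {v}) ` ?P ` ?D)"
    by (intro connectedin_continuous_map_image [OF continuous_map_span_singleton, of "?P ` ?D"])
      (simp_all add: connectedin_subtopology conn)
  moreover have "(\<lambda>v. vec.span {v}) ` ?P ` ?D = Zset"
  proof (intro equalityI subsetI)
    fix p assume "p \<in> Zset"
    then obtain v where v: "v \<in> Zcone" "p = vec.span {v}"
      by (auto simp: Zset_def)
    obtain u w where uw: "2 * (cmod u)\<^sup>2 < sqrt 3" "2 * (cmod w)\<^sup>2 < sqrt 3" "v = sfun v *s Zpar u w"
      by (rule Zcone_eq_smult_Zpar [OF v(1)])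
    have "sfun v \<noteq> 0"
      using v(1) by (auto simp: Zcone_def)
    then have "p = vec.span {Zpar u w}"
      using span_singleton_smult uw(3) v(2) by metis
    moreover have "(u, w) \<in> ?D"
      using uw(1,2) unfolding \<rho> [symmetric] by simp
    ultimately show "p \<in> (\<lambda>v. vec.span {v}) ` ?P ` ?D"
      by (intro image_eqI [of _ _ "Zpar u w"] image_eqI [of _ _ "(u, w)"]) simp_all
  next
    fix p assume "p \<in> (\<lambda>v. vec.span {v}) ` ?P ` ?D"
    then obtain x where "x \<in> ?D" "p = vec.span {?P x}"
      by blast
    then show "p \<in> Zset"
      using P [of x] unfolding Zset_def by blast
  qed
  ultimately show ?thesis
    by simp
qed

lemma Zset_nonempty: "Zset \<noteq> {}"
  using Zpar_in_Zcone [of 0 0] by (auto simp: Zset_def)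

lemma irreducible_analytic_Zset: "irreducible_analytic (period_domain Gamma_lat) Zset"
  unfolding irreducible_analytic_def regular_locus_Zset
  using analytic_subset_Zset Zset_nonempty connectedin_Zset by blast

lemma analytic_dim_Zset: "analytic_dim Zset = 2"
proof -
  have "{d. \<exists>p. regular_point d Zset p} = {2}"
    using Zset_nonempty by (auto simp: regular_point_Zset)
  then show ?thesis
    by (simp add: analytic_dim_def)
qed


text \<open>On \<open>Zpar u w\<close> the functional is a polynomial with monomials
  \<open>1\<close>, \<open>u\<close>, \<open>w\<close>, \<open>u * w\<close>, so four sample points
  suffice to kill its coefficients. These are combinations of 1 and sqrt 3 over the rationals, up to
  invertible factors, so every entry of \<open>n\<close> vanishes: \<open>Zset\<close> lies in no
  proper rational subspace.\<close>

lemma rational_functional_zero: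
  fixes n :: "rat ^ idx8"
  assumes "\<And>x. x \<in> Zcone \<Longrightarrow> (\<Sum>j\<in>UNIV. of_rat (n $ j) * x $ j) = (0 :: complex)"
  shows "n = 0"
proof -
  let ?n = "\<lambda>j. complex_of_rat (n $ j)"
  define L where "L v = (\<Sum>j\<in>UNIV. ?n j * v $ j)" for v
  define A where "A = ?n i1 * sqrt3 + ?n i2"
  define B where "B = ?n i3 * sqrt3 + ?n i4"
  define C where "C = ?n i5 + (?n i7 + 2 * ?n i8) / sqrt3"
  define D where "D = ?n i6 - (2 * ?n i7 + ?n i8) / sqrt3"
  have L: "L (Evec a b c d) = A * a + B * b + C * c + D * d" for a b c d
    unfolding L_def sum_idx8 Evec_nth A_def B_def C_def D_def by (simp add: field_simps)
  have vanish: "L (Zpar u w) = 0" if "2 * (cmod u)\<^sup>2 < sqrt 3" "2 * (cmod w)\<^sup>2 < sqrt 3" for u w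
    unfolding L_def by (rule assms [OF Zpar_in_Zcone [OF that]])
  define a0 where "a0 = A / 2 + B / (2 * \<i>)"
  define a1 where "a1 = A / 2 - B / (2 * \<i>)"
  define K where "K = (D - C * Complex (- 1 / 2) (sqrt 3 / 2)) / (\<i> * sqrt3)"
  have LZ: "L (Zpar u w) = a0 + a1 * (2 / sqrt3) * (u * w) + C * u + K * (u - w)" for u w
  proof -
    have "A * ((1 + t) / 2) + B * ((1 - t) / (2 * \<i>)) = a0 + a1 * t" for t
      by (simp add: a0_def a1_def add_divide_distrib diff_divide_distrib algebra_simps)
    moreover have "C * (u - r * (y / q)) + D * (y / q) = C * u + (D - C * r) / q * y" for r y q
      by (simp add: diff_divide_distrib algebra_simps)
    ultimately show ?thesis
      unfolding Zpar_def L K_def by (simp add: add.assoc mult.assoc)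
  qed
  have "(1 :: real) < sqrt 3"
    by (simp add: real_less_rsqrt)
  moreover have "2 * (cmod (1 / 2))\<^sup>2 = 1 / 2"
    by (simp add: power2_eq_square norm_divide)
  ultimately have half: "2 * (cmod (1 / 2))\<^sup>2 < sqrt 3"
    by linarith
  have zero: "2 * (cmod 0)\<^sup>2 < sqrt 3"
    by simp
  \<comment> \<open>The four points have \<open>u\<close> and \<open>w\<close> in {0, 1/2}, inside
    the discs; each evaluation isolates one more coefficient.\<close>
  have "a0 = 0"
    using vanish [OF zero zero] unfolding LZ by simp
  moreover have "K = 0"
    using vanish [OF zero half] unfolding LZ \<open>a0 = 0\<close> by simp
  moreover have "C = 0"
    using vanish [OF half zero] unfolding LZ \<open>a0 = 0\<close> \<open>K = 0\<close> by simp
  moreover have "a1 = 0"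
    using vanish [OF half half] unfolding LZ \<open>a0 = 0\<close> \<open>K = 0\<close> \<open>C = 0\<close> by simp
  moreover have "A = a0 + a1" "B = (a0 - a1) * \<i>"
    by (simp_all add: a0_def a1_def mult.assoc)
  ultimately have "A = 0" "B = 0" "D = 0"
    by (simp_all add: K_def)
  have "n $ i1 = 0" "n $ i2 = 0" "n $ i3 = 0" "n $ i4 = 0"
    using sqrt3_independent [of "n $ i1" "n $ i2"] sqrt3_independent [of "n $ i3" "n $ i4"] \<open>A = 0\<close> \<open>B = 0\<close>
    by (simp_all add: A_def B_def)
  \<comment> \<open>\<open>C\<close> and \<open>D\<close> carry sqrt 3 in a denominator; multiplying
    by it brings them to the shape of \<open>sqrt3_independent\<close>.\<close>
  moreover have "of_rat (n $ i5) * sqrt3 + of_rat (n $ i7 + 2 * n $ i8) = 0"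
    using \<open>C = 0\<close> by (simp add: C_def of_rat_add of_rat_mult field_simps)
  note C' = sqrt3_independent [OF this]
  moreover have "of_rat (n $ i6) * sqrt3 + of_rat (- (2 * n $ i7 + n $ i8)) = 0"
    using \<open>D = 0\<close> by (simp add: D_def of_rat_add of_rat_diff of_rat_mult of_rat_minus field_simps)
  note D' = sqrt3_independent [OF this]
  moreover have "n $ i7 = 0" "n $ i8 = 0"
    using C'(2) D'(2) by linarith+
  ultimately show ?thesis
    by (simp add: vec8_eq_iff)
qed

text \<open>Since \<open>M\<close> is rational, its eigenspace for \<open>\<plusminus>sqrt 3\<close> can only contain that of \<open>psi0\<close> if the
  two agree up to sign: the kernel of the difference is rational and contains the conjugate
  eigenspace as well.\<close>

lemma eigen_matrix_contains_Zcone: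
  assumes l: "l \<in> {sqrt3, - sqrt3}" and Z: "\<And>x. x \<in> Zcone \<Longrightarrow> eigen_matrix M l *v x = 0"
    and x: "eigen_matrix M l *v x = 0"
  shows "psi0 x = sqrt3 *s x"
proof -
  obtain e :: rat where e: "e = 1 \<or> e = - 1" "l = of_rat e * sqrt3"
  proof (cases "l = sqrt3")
    case True
    then show ?thesis
      using that [of 1] by simp
  next
    case False
    then show ?thesis
      using that [of "- 1"] l by (simp add: of_rat_minus)
  qed
  have ee: "of_rat e * of_rat e = (1 :: complex)"
    using e(1) by (auto simp: of_rat_minus)
  let ?M0 = "matrix psi0 :: rat ^ idx8 ^ idx8"
  have M0: "(\<Sum>j\<in>UNIV. of_rat (?M0 $ i $ j) * x $ j) = psi0 x $ i" for i and x :: "complex ^ idx8"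
    using complexify_psi0 [of x] by (simp add: complexify_def matrix_vector_mult_def vec_eq_iff)
  have M: "(\<Sum>j\<in>UNIV. of_rat (M $ i $ j) * x $ j) = l * x $ i" if "eigen_matrix M l *v x = 0" for i x
    using that unfolding eigen_matrix_mult by (simp add: matrix_vector_mult_def vec_eq_iff)
  have "M $ i - e *s ?M0 $ i = 0" for i
  proof (rule rational_functional_zero)
    fix x assume x: "x \<in> Zcone"
    have "(\<Sum>j\<in>UNIV. of_rat ((M $ i - e *s ?M0 $ i) $ j) * x $ j)
        = (\<Sum>j\<in>UNIV. of_rat (M $ i $ j) * x $ j) - of_rat e * (\<Sum>j\<in>UNIV. of_rat (?M0 $ i $ j) * x $ j)"
      by (simp add: of_rat_diff of_rat_mult left_diff_distrib sum_subtractf sum_distrib_left mult.assoc)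
    also have "\<dots> = 0"
      using x unfolding M [OF Z [OF x]] M0 by (simp add: Zcone_def e(2))
    finally show "(\<Sum>j\<in>UNIV. of_rat ((M $ i - e *s ?M0 $ i) $ j) * x $ j) = (0 :: complex)" .
  qed
  then have Me: "M $ i = e *s ?M0 $ i" for i
    by simp
  have "sqrt3 * x $ i = psi0 x $ i" for i
  proof -
    have "of_rat e * sqrt3 * x $ i = of_rat e * psi0 x $ i"
      using M [OF x, of i] unfolding M0 [symmetric] e(2) Me
      by (simp add: of_rat_mult sum_distrib_left mult.assoc)
    then have "of_rat e * (of_rat e * sqrt3 * x $ i) = of_rat e * (of_rat e * psi0 x $ i)"
      by simp
    then show ?thesis
      using ee by (simp add: mult.assoc [symmetric])
  qed
  then show ?thesis
    by (simp add: vec_eq_iff)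
qed

lemma Zset_maximal:
  assumes W: "irreducible_analytic (period_domain Gamma_lat) W" "W \<subseteq> similarity_locus Gamma_lat 3" "Zset \<subseteq> W"
  shows "W = Zset"
proof -
  have an: "analytic_subset (period_domain Gamma_lat) W" and "W \<noteq> {}"
    and conn: "connectedin proj_topology (regular_locus W)"
    using W(1) by (auto simp: irreducible_analytic_def)
  have loc: "locally_analytic (affine_cone W)"
    by (rule locally_analytic_period_domain [OF an])
  have sub: "W \<subseteq> period_domain Gamma_lat" "W \<subseteq> proj_space"
    using an period_domain_subset_proj_space by (auto simp: analytic_subset_def)
  define I where "I = (UNIV :: (rat ^ idx8 ^ idx8) set) \<times> {sqrt3, - sqrt3}"
  define B where "B = (\<lambda>(M :: rat ^ idx8 ^ idx8, l). eigen_matrix M l)"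
  have cI: "countable I"
    unfolding I_def by (intro countable_SIGMA countableI_type) simp
  have cover: "\<exists>i\<in>I. p \<subseteq> {x. B i *v x = 0}" if p: "p \<in> W" for p
  proof -
    have "p \<in> similarity_locus Gamma_lat 3"
      using p W(2) by blast
    then obtain M l where "l \<in> {sqrt3, - sqrt3}" "p \<subseteq> {x. eigen_matrix M l *v x = 0}"
      by (rule similarity_locus_eigenspace)
    then show ?thesis
      by (intro bexI [of _ "(M, l)"]) (simp_all add: I_def B_def)
  qed
  have "\<exists>i\<in>I. \<forall>p\<in>W. p \<subseteq> {x. B i *v x = 0}"
    by (rule irreducible_in_countable_union [OF loc sub(2) \<open>W \<noteq> {}\<close> conn cI]) (rule cover)
  then obtain i where i: "i \<in> I" "\<forall>p\<in>W. p \<subseteq> {x. B i *v x = 0}" ..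
  obtain M l where Ml: "i = (M, l)"
    by (cases i)
  have l: "l \<in> {sqrt3, - sqrt3}"
    using i(1) by (simp add: I_def Ml)
  have ker: "eigen_matrix M l *v x = 0" if "vec.span {x} \<in> W" for x
  proof -
    have "x \<in> {x. B i *v x = 0}"
      using bspec [OF i(2) that] vec.span_base [of x "{x}"] by blast
    then show ?thesis
      by (simp add: Ml B_def)
  qed
  have eigen: "psi0 x = sqrt3 *s x" if "vec.span {x} \<in> W" for x
  proof (rule eigen_matrix_contains_Zcone [OF l _ ker [OF that]])
    show "eigen_matrix M l *v z = 0" if "z \<in> Zcone" for z
    proof (rule ker)
      show "vec.span {z} \<in> W"
        using W(3) that unfolding Zset_def by blast
    qed
  qed
  define P where "P = (\<lambda>x. vec.span {x}) ` ({x. cmod (tfun x) < cmod (sfun x)} - {0})"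
  define Q where "Q = (\<lambda>x. vec.span {x}) ` ({x. cmod (sfun x) < cmod (tfun x)} - {0})"
  have openPQ: "openin proj_topology P" "openin proj_topology Q"
    unfolding P_def Q_def
    by (rule openin_proj_image [OF open_cmod_less(1)], rule openin_proj_image [OF open_cmod_less(2)])
  have disj: "P \<inter> Q = {}"
  proof (rule ccontr)
    assume "P \<inter> Q \<noteq> {}"
    then obtain p where p: "p \<in> P" "p \<in> Q"
      by blast
    obtain x where x: "cmod (tfun x) < cmod (sfun x)" "x \<noteq> 0" "p = vec.span {x}"
      using p(1) by (auto simp: P_def)
    obtain y where y: "cmod (sfun y) < cmod (tfun y)" "p = vec.span {y}"
      using p(2) by (auto simp: Q_def)
    have "vec.span {x} = vec.span {y}"
      using x(3) y(2) by simp
    then obtain c where "c \<noteq> 0" "x = c *s y"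
      using x(2) by (rule span_singleton_eqD)
    then show False
      using x(1) y(1) by (simp add: sfun_smult tfun_smult norm_mult)
  qed
  have WPQ: "p \<in> Zset \<or> p \<in> Q" if p: "p \<in> W" for p
  proof -
    obtain v where v: "v \<noteq> 0" "p = vec.span {v}"
      using p sub(2) by (auto simp: proj_space_def)
    have f: "form Gamma_lat v v = 0" "Re (form Gamma_lat v (vcnj v)) > 0"
      using subsetD [OF sub(1) p] unfolding v(2) span_in_period_domain by simp_all
    have e: "psi0 v = sqrt3 *s v"
      using eigen [of v] p v(2) by simp
    show ?thesis
    proof (cases "cmod (tfun v) < cmod (sfun v)")
      case True
      then have "v \<in> Zcone"
        using e f by (simp add: Zcone_def)
      then show ?thesis
        unfolding Zset_def v(2) by blast
    next
      case False
      then have "cmod (sfun v) < cmod (tfun v)"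
        using eigen_cmod_ne [OF e f] by simp
      then show ?thesis
        unfolding Q_def v(2) using v(1) by blast
    qed
  qed
  have ZP: "Zset \<subseteq> P"
    unfolding Zset_def P_def using zero_notin_Zcone
    by (intro image_mono) (auto simp: Zcone_def)
  have regW: "regular_locus W \<subseteq> W"
    by (auto simp: regular_locus_def regular_point_def)
  have "W \<inter> Q = {}"
  proof (rule ccontr)
    assume "W \<inter> Q \<noteq> {}"
    then have "regular_locus W \<inter> Q \<noteq> {}"
      by (rule regular_locus_dense [OF loc sub(2) openPQ(2)])
    moreover have "W \<inter> P \<noteq> {}"
      using ZP W(3) Zset_nonempty by blast
    then have "regular_locus W \<inter> P \<noteq> {}"
      by (rule regular_locus_dense [OF loc sub(2) openPQ(1)])
    moreover have "regular_locus W \<subseteq> P \<union> Q"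
      using regW WPQ ZP by blast
    moreover have "P \<inter> Q \<inter> regular_locus W = {}"
      using disj by simp
    ultimately show False
      using conn openPQ unfolding connectedin by (metis inf_commute)
  qed
  then show ?thesis
    using WPQ W(3) by blast
qed

theorem proposition2p12:
  "similarity_locus Gamma_lat 3 \<noteq> {} \<and>
   (\<exists>Z. irreducible_component (period_domain Gamma_lat) (similarity_locus Gamma_lat 3) Z \<and>
        analytic_dim Z = 2)"
proof
  show "similarity_locus Gamma_lat 3 \<noteq> {}"
    using Zset_nonempty Zset_subset_similarity_locus by blast
  have "irreducible_component (period_domain Gamma_lat) (similarity_locus Gamma_lat 3) Zset"
    unfolding irreducible_component_def
    using irreducible_analytic_Zset Zset_subset_similarity_locus Zset_maximal by blast
  then show "\<exists>Z. irreducible_component (period_domain Gamma_lat) (similarity_locus Gamma_lat 3) Z \<and>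
        analytic_dim Z = 2"
    using analytic_dim_Zset by blast
qed

end
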